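(* Consider $$-\left(\varphi_p(u')\right)'+q(x)\varphi_p(u)=\lambda m(x)f(u),\quad 0<x<T,\qquad u(0)=u(T),\ u'(0)=u'(T),\qquad (N)$$ where $f\in C(\mathbb{R},\mathbb{R})$ satisfies $f(s)s>0$ for $s\neq0$. If $f_0\in(0,+\infty)$ and $f_\infty=0$, then for any $\lambda\in(\lambda_0^+/f_0,+\infty)\cup(-\infty,\lambda_0^-/f_0)$, problem (N) has two solutions $u^+$ and $u^-$ such that $u^+$ is positive and $u^-$ is negative on $[0,T]$.
   Context: Here $T>0$, $1<p<+\infty$, $\varphi_p(s)=|s|^{p-2}s$ (with $\varphi_p(0)=0$), $q\in C([0,T];[0,+\infty))$ with $q\not\equiv0$, and $m:[0,T]\to\mathbb{R}$ is a continuous sign-changing weight (it takes both positive and negative values). $f_0=\lim_{|s|\to0}f(s)/\varphi_p(s)$ and $f_\infty=\lim_{|s|\to+\infty}f(s)/\varphi_p(s)$ (assumed to exist). With $W_T^{1,p}(0,T)=\{u\in W^{1,p}(0,T)\mid u(0)=u(T)\}$, $\lambda_0^+=\inf\{\int_0^T(|u'|^p+q|u|^p)\,dx\mid u\in W_T^{1,p}(0,T),\ \int_0^T m|u|^p\,dx=1\}>0$ and $\lambda_0^-=\max\{-\int_0^T(|u'|^p+q|u|^p)\,dx\mid u\in W_T^{1,p}(0,T),\ \int_0^T -m|u|^p\,dx=1\}<0$. Solutions are classical. *)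

theory Defs
  imports "HOL-Analysis.Analysis"
begin

text \<open>Since \<open>\<bar>0\<bar> powr r * 0 = 0\<close>, the convention \<open>phi_p p 0 = 0\<close> is built in, also for \<open>p < 2\<close>.\<close>

definition phi_p :: "real \<Rightarrow> real \<Rightarrow> real" where
  "phi_p p s = \<bar>s\<bar> powr (p - 2) * s"

definition Lp_on :: "real \<Rightarrow> real \<Rightarrow> (real \<Rightarrow> real) \<Rightarrow> bool" where
  "Lp_on p T v \<longleftrightarrow>
     v \<in> borel_measurable (lebesgue_on {0<..<T}) \<and>
     integrable (lebesgue_on {0<..<T}) (\<lambda>x. \<bar>v x\<bar> powr p)"

text \<open>\<open>h\<close> is a \<open>C\<^sub>c\<^sup>1(0,T)\<close> function with derivative \<open>h'\<close>.\<close>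

definition test_function :: "real \<Rightarrow> (real \<Rightarrow> real) \<Rightarrow> (real \<Rightarrow> real) \<Rightarrow> bool" where
  "test_function T h h' \<longleftrightarrow>
     (\<forall>x. (h has_real_derivative h' x) (at x)) \<and> continuous_on UNIV h' \<and>
     compact (closure {x. h x \<noteq> 0}) \<and> closure {x. h x \<noteq> 0} \<subseteq> {0<..<T}"

definition weak_derivative :: "real \<Rightarrow> (real \<Rightarrow> real) \<Rightarrow> (real \<Rightarrow> real) \<Rightarrow> bool" where
  "weak_derivative T u v \<longleftrightarrow>
     (\<forall>h h'. test_function T h h' \<longrightarrow>
        (LINT x|lebesgue_on {0<..<T}. u x * h' x) = - (LINT x|lebesgue_on {0<..<T}. v x * h x))"

text \<open>\<open>u\<close> belongs to \<open>{u \<in> W\<^sup>1\<^sup>,\<^sup>p(0,T). u(0) = u(T)}\<close> and \<open>v\<close> is its weak derivative.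
  The boundary values refer to the continuous representative of a Sobolev class, hence the
  continuity requirement on the closed interval; \<open>v\<close> is determined by \<open>u\<close> up to null sets.\<close>

definition W1p_periodic :: "real \<Rightarrow> real \<Rightarrow> (real \<Rightarrow> real) \<Rightarrow> (real \<Rightarrow> real) \<Rightarrow> bool" where
  "W1p_periodic p T u v \<longleftrightarrow>
     Lp_on p T u \<and> Lp_on p T v \<and> weak_derivative T u v \<and>
     continuous_on {0..T} u \<and> u 0 = u T"

definition energy :: "real \<Rightarrow> real \<Rightarrow> (real \<Rightarrow> real) \<Rightarrow> (real \<Rightarrow> real) \<Rightarrow> (real \<Rightarrow> real) \<Rightarrow> real" where
  "energy p T q u v =
     (LINT x|lebesgue_on {0<..<T}. \<bar>v x\<bar> powr p + q x * \<bar>u x\<bar> powr p)"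

definition lambda0_plus :: "real \<Rightarrow> real \<Rightarrow> (real \<Rightarrow> real) \<Rightarrow> (real \<Rightarrow> real) \<Rightarrow> real" where
  "lambda0_plus p T q m =
     Inf {energy p T q u v | u v. W1p_periodic p T u v \<and>
            (LINT x|lebesgue_on {0<..<T}. m x * \<bar>u x\<bar> powr p) = 1}"

text \<open>The \<open>GREATEST\<close> element is the maximum of a possibly infinite set (\<open>Max\<close> is only
  meaningful for finite ones).\<close>

definition lambda0_minus :: "real \<Rightarrow> real \<Rightarrow> (real \<Rightarrow> real) \<Rightarrow> (real \<Rightarrow> real) \<Rightarrow> real" where
  "lambda0_minus p T q m =
     (GREATEST y. y \<in> {- energy p T q u v | u v. W1p_periodic p T u v \<and>
            (LINT x|lebesgue_on {0<..<T}. - m x * \<bar>u x\<bar> powr p) = 1})"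

text \<open>Classical solutions: \<open>u\<close> is \<open>C\<^sup>1\<close> on \<open>[0,T]\<close> (one-sided derivatives at the endpoints) with
  derivative \<open>u'\<close>, and \<open>phi_p p \<circ> u'\<close> has a pointwise derivative \<open>w\<close> in \<open>(0,T)\<close> satisfying the
  equation; \<open>w\<close> is then automatically continuous when \<open>q\<close>, \<open>m\<close> and \<open>f\<close> are.\<close>

definition classical_solution ::
  "real \<Rightarrow> real \<Rightarrow> (real \<Rightarrow> real) \<Rightarrow> (real \<Rightarrow> real) \<Rightarrow> (real \<Rightarrow> real) \<Rightarrow> real \<Rightarrow> (real \<Rightarrow> real) \<Rightarrow> bool"
  where
  "classical_solution p T q m f l u \<longleftrightarrow>
     (\<exists>u' w.
        (\<forall>x\<in>{0..T}. (u has_real_derivative u' x) (at x within {0..T})) \<and>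
        continuous_on {0..T} u' \<and>
        (\<forall>x\<in>{0<..<T}. ((\<lambda>y. phi_p p (u' y)) has_real_derivative w x) (at x) \<and>
            - w x + q x * phi_p p (u x) = l * m x * f (u x)) \<and>
        u 0 = u T \<and> u' 0 = u' T)"

end

(*
  Discretise (0,T) by N equal cells and minimise the discrete action over periodic grid functions;
  since f is sublinear at infinity and the integral of q is positive, the action is coercive
  uniformly in N.  A minimiser satisfies a discrete equation for the flux phi_p(u'), whose increments
  and mean are controlled, so that values and fluxes are uniformly bounded and Lipschitz.  By
  Arzela-Ascoli a subsequence converges to a C^1 solution.  Grid values of a function in W^{1,p}
  do not increase the gradient energy (Jensen), so a competitor with energy below l f_0 keeps the
  discrete minima bounded away from 0 and the limit is nontrivial.  The limit is positive because
  |phi_p(u')'| <= B u^(p-1) lets a double zero spread over [0,T].  The same compactness, applied to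
  the discrete Rayleigh quotient, shows that the extremum defining lambda_0^- is attained, which the
  GREATEST in its definition needs in order to have a value at all.  Negative solutions and l < 0
  follow by replacing f(s) with -f(-s) and m with -m.
*)
theory Submission
  imports Defs "HOL-Complex_Analysis.Great_Picard"
begin

subsection \<open>The p-Laplace nonlinearity and Riemann sums\<close>

text \<open>Compactness is needed for grid functions only, where it reduces to uniform convergence
  of values and fluxes; Sobolev functions occur just as competitors, so weak convergence never
  enters. With the flux y = phi_p(u') as second unknown the equation becomes the first-order system
  u' = phi_(p')(y), y' = q phi_p(u) - l m f(u), where p' = p/(p-1), and the factor |u'|^(p-2),
  degenerate or singular at 0, disappears.

  Two reductions shape the existence proof. The nonlinearity is replaced by the odd extension of its
  restriction to [0,\<infinity>): positive solutions do not see the change, while the primitive F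
  becomes even, so taking absolute values does not raise the action and minimisers may be chosen
  nonnegative. The parameter l is absorbed into the weight, so that both ranges of l become one
  condition: some w has energy below f_0 times the integral of l m |w|^p. Since F(s) behaves like
  f_0 |s|^p / p near 0, small multiples of w have negative action. In the limit only a lower bound
  for the weight term has to survive, for which convergence of values is enough.\<close>

lemma phi_p_eq_sgn: "phi_p p s = sgn s * \<bar>s\<bar> powr (p - 1)"
proof (cases "s = 0")
  case False
  have "\<bar>s\<bar> powr (p - 1) = \<bar>s\<bar> powr (p - 2) * \<bar>s\<bar>"
    using powr_mult_base[of "\<bar>s\<bar>" "p - 2"] by (simp add: mult.commute)
  then show ?thesis
    unfolding phi_p_def by (metis mult.assoc mult.commute sgn_mult_abs)
qed (simp add: phi_p_def)

lemma abs_phi_p: "\<bar>phi_p p s\<bar> = \<bar>s\<bar> powr (p - 1)"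
  by (simp add: phi_p_eq_sgn abs_mult abs_sgn_eq)

lemma phi_p_0 [simp]: "phi_p p 0 = 0"
  by (simp add: phi_p_def)

lemma phi_p_nonneg: "s \<ge> 0 \<Longrightarrow> phi_p p s = s powr (p - 1)"
  by (cases "s = 0") (auto simp: phi_p_eq_sgn)

lemma phi_p_minus [simp]: "phi_p p (- s) = - phi_p p s"
  by (simp add: phi_p_def)

lemma sgn_phi_p [simp]: "sgn (phi_p p s) = sgn s"
  by (simp add: phi_p_eq_sgn sgn_mult sgn_if)

text \<open>For p' = p/(p-1) one has (p-1)(p'-1) = 1, so the exponents cancel. The inverse recovers
  the slope u' from the flux phi_p(u').\<close>

lemma phi_p_inverse:
  assumes "p > 1"
  shows "phi_p p (phi_p (p / (p - 1)) s) = s"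
proof -
  have e: "p / (p - 1) - 1 = 1 / (p - 1)"
    using assms by (simp add: field_simps)
  have "phi_p p (phi_p (p / (p - 1)) s) = sgn s * (\<bar>s\<bar> powr (p / (p - 1) - 1)) powr (p - 1)"
    by (simp only: phi_p_eq_sgn[of p "phi_p _ _"] sgn_phi_p abs_phi_p)
  also have "\<dots> = sgn s * \<bar>s\<bar>"
    unfolding e using assms by (simp add: powr_powr)
  finally show ?thesis
    by (simp add: mult_sgn_abs)
qed

lemma phi_p_inverse':
  assumes "p > 1"
  shows "phi_p (p / (p - 1)) (phi_p p s) = s"
proof -
  have "p / (p - 1) / (p / (p - 1) - 1) = p" "p / (p - 1) > 1"
    using assms by (simp_all add: field_simps)
  then show ?thesis
    using phi_p_inverse[of "p / (p - 1)" s] by simp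
qed

lemma conjugate_exponent_gt_1: "p > 1 \<Longrightarrow> p / (p - 1) > (1::real)"
  by (simp add: field_simps)

lemma continuous_on_phi_p [continuous_intros]:
  assumes "p > 1" "continuous_on S g"
  shows "continuous_on S (\<lambda>x. phi_p p (g x))"
proof -
  \<comment> \<open>Both powers have the positive exponent \<open>p - 1\<close>, so this form is
    continuous at 0 even for p < 2, where the factor |s|^(p-2) blows up.\<close>
  have "phi_p p s = (max 0 s) powr (p - 1) - (max 0 (- s)) powr (p - 1)" for s
    by (cases "s = 0"; cases "s > 0") (auto simp: phi_p_eq_sgn sgn_if max_def)
  then show ?thesis
    using assms by (auto intro!: continuous_intros continuous_on_powr')
qed

lemma tendsto_phi_p:
  assumes "p > 1" "(g \<longlongrightarrow> a) F"
  shows "((\<lambda>x. phi_p p (g x)) \<longlongrightarrow> phi_p p a) F"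
proof -
  have "isCont (phi_p p) a"
    using continuous_on_phi_p[OF assms(1) continuous_on_id, of UNIV]
    by (simp add: continuous_on_eq_continuous_at)
  then show ?thesis
    using assms(2) isCont_tendsto_compose by blast
qed

lemma phi_p_mono:
  assumes "p > 1" "s \<le> t"
  shows "phi_p p s \<le> phi_p p t"
proof (cases "s \<ge> 0")
  case True
  then show ?thesis using assms by (simp add: phi_p_nonneg powr_mono2)
next
  case False
  show ?thesis
  proof (cases "t \<ge> 0")
    case True
    have "phi_p p s = - ((- s) powr (p - 1))"
      using False by (simp add: phi_p_eq_sgn)
    moreover have "phi_p p t = t powr (p - 1)"
      using True by (rule phi_p_nonneg)
    ultimately show ?thesis
      using powr_ge_zero[of "- s" "p - 1"] powr_ge_zero[of t "p - 1"] by linarith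
  next
    case f: False
    have "(- t) powr (p - 1) \<le> (- s) powr (p - 1)"
      using assms f by (intro powr_mono2) auto
    then show ?thesis using False f by (simp add: phi_p_eq_sgn)
  qed
qed

lemma DERIV_abs_powr:
  assumes "p > 1"
  shows "((\<lambda>s. \<bar>s\<bar> powr p) has_real_derivative p * phi_p p s) (at s)"
proof -
  consider "s > 0" | "s < 0" | "s = 0" by linarith
  then show ?thesis
  proof cases
    case 1
    have "((\<lambda>s. s powr p) has_real_derivative p * s powr (p - 1)) (at s)"
      using 1 by (auto intro!: derivative_eq_intros)
    then have "((\<lambda>s. \<bar>s\<bar> powr p) has_real_derivative p * s powr (p - 1)) (at s)"
      by (rule has_field_derivative_transform_within_open[where S = "{0<..}"]) (use 1 in auto)
    then show ?thesis using 1 by (simp add: phi_p_nonneg)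
  next
    case 2
    have "((\<lambda>s. (- s) powr p) has_real_derivative - (p * (- s) powr (p - 1))) (at s)"
      using 2 by (auto intro!: derivative_eq_intros)
    then have "((\<lambda>s. \<bar>s\<bar> powr p) has_real_derivative - (p * (- s) powr (p - 1))) (at s)"
      by (rule has_field_derivative_transform_within_open[where S = "{..<0}"]) (use 2 in auto)
    then show ?thesis using 2 by (simp add: phi_p_eq_sgn)
  next
    case 3
    have "phi_p p \<midarrow>0\<rightarrow> phi_p p 0"
      by (rule tendsto_phi_p[OF assms]) simp
    \<comment> \<open>At 0 the difference quotient of |h|^p is \<open>phi_p p h\<close> itself,
      which tends to 0.\<close>
    moreover have "\<bar>h\<bar> powr p = h * phi_p p h" for h
    proof -
      have "\<bar>h\<bar> powr p = \<bar>h\<bar> * \<bar>h\<bar> powr (p - 1)"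
        using powr_mult_base[of "\<bar>h\<bar>" "p - 1"] by simp
      also have "\<dots> = (h * sgn h) * \<bar>h\<bar> powr (p - 1)"
        by (simp only: abs_sgn[symmetric])
      finally show ?thesis
        by (simp only: phi_p_eq_sgn mult.assoc)
    qed
    then have "phi_p p h = (\<bar>0 + h\<bar> powr p - \<bar>0\<bar> powr p) / h" if "h \<noteq> 0" for h
      using that by (simp add: field_simps)
    then have "\<forall>\<^sub>F h in at 0. phi_p p h = (\<bar>0 + h\<bar> powr p - \<bar>0\<bar> powr p) / h"
      by (simp add: eventually_at_filter)
    ultimately have "(\<lambda>h. (\<bar>0 + h\<bar> powr p - \<bar>0\<bar> powr p) / h) \<midarrow>0\<rightarrow> 0"
      using Lim_transform_eventually[of "phi_p p" "phi_p p 0" "at 0"] by simp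
    then show ?thesis
      unfolding DERIV_def 3 by simp
  qed
qed

text \<open>Convexity, from the mean value theorem and the monotone derivative. Summed or integrated
  with \<open>c\<close> the mean of \<open>v\<close>, the linear term cancels and Jensen's
  inequality results.\<close>

lemma abs_powr_tangent:
  assumes "p > 1"
  shows "\<bar>c\<bar> powr p + p * phi_p p c * (v - c) \<le> \<bar>v\<bar> powr p"
proof -
  consider "v = c" | "c < v" | "v < c" by linarith
  then show ?thesis
  proof cases
    case 2
    obtain z where z: "c < z" "z < v" "\<bar>v\<bar> powr p - \<bar>c\<bar> powr p = (v - c) * (p * phi_p p z)"
      using MVT2[OF 2 DERIV_abs_powr[OF assms]] by metis
    have "phi_p p c * (v - c) \<le> phi_p p z * (v - c)"
      using z 2 by (intro mult_right_mono phi_p_mono assms) auto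
    then have "p * (phi_p p c * (v - c)) \<le> p * (phi_p p z * (v - c))"
      using assms by simp
    then show ?thesis using z(3) by (simp add: algebra_simps)
  next
    case 3
    obtain z where z: "v < z" "z < c" "\<bar>c\<bar> powr p - \<bar>v\<bar> powr p = (c - v) * (p * phi_p p z)"
      using MVT2[OF 3 DERIV_abs_powr[OF assms]] by metis
    have "phi_p p z * (c - v) \<le> phi_p p c * (c - v)"
      using z 3 by (intro mult_right_mono phi_p_mono assms) auto
    then have "p * (phi_p p z * (c - v)) \<le> p * (phi_p p c * (c - v))"
      using assms by simp
    then show ?thesis using z(3) by (simp add: algebra_simps)
  qed simp
qed

lemma sum_abs_powr_ge:
  assumes "p > 1" "h \<ge> 0" "real N * h = T" "T > 0"
  shows "T * ((\<Sum>i<N. h * \<bar>e i\<bar>) / T) powr p \<le> (\<Sum>i<N. h * \<bar>e i\<bar> powr p)"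
proof -
  define c where "c = (\<Sum>i<N. h * \<bar>e i\<bar>) / T"
  have "c \<ge> 0"
    unfolding c_def using assms by (intro divide_nonneg_nonneg sum_nonneg) auto
  have Tc: "T * c = (\<Sum>i<N. h * \<bar>e i\<bar>)"
    using assms by (simp add: c_def)
  have "(\<Sum>i<N. h * (\<bar>c\<bar> powr p + p * phi_p p c * (\<bar>e i\<bar> - c))) \<le> (\<Sum>i<N. h * \<bar>e i\<bar> powr p)"
    using abs_powr_tangent[OF assms(1), of c "\<bar>e _\<bar>"] assms
    by (intro sum_mono mult_left_mono) auto
  also have "(\<Sum>i<N. h * (\<bar>c\<bar> powr p + p * phi_p p c * (\<bar>e i\<bar> - c)))
      = T * \<bar>c\<bar> powr p + p * phi_p p c * ((\<Sum>i<N. h * \<bar>e i\<bar>) - T * c)"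
  proof -
    have "(\<Sum>i<N. h * (\<bar>c\<bar> powr p + p * phi_p p c * (\<bar>e i\<bar> - c)))
      = (\<Sum>i<N. h * \<bar>c\<bar> powr p - p * phi_p p c * (h * c) + p * phi_p p c * (h * \<bar>e i\<bar>))"
      by (intro sum.cong refl) (simp add: algebra_simps)
    also have "\<dots> = (real N * h) * \<bar>c\<bar> powr p - p * phi_p p c * ((real N * h) * c)
        + p * phi_p p c * (\<Sum>i<N. h * \<bar>e i\<bar>)"
      by (simp add: sum.distrib sum_subtractf sum_distrib_left[symmetric] right_diff_distrib)
    finally show ?thesis
      by (simp add: assms(3) right_diff_distrib)
  qed
  finally show ?thesis
    unfolding c_def[symmetric] using \<open>c \<ge> 0\<close> Tc by simp
qed

section \<open>Riemann sums on the uniform grid\<close>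

definition node :: "real \<Rightarrow> nat \<Rightarrow> nat \<Rightarrow> real" where
  "node T N i = T * real i / real N"

lemma node_0 [simp]: "node T N 0 = 0"
  by (simp add: node_def)

lemma node_Suc: "node T N (Suc i) = node T N i + T / real N"
  by (simp add: node_def field_simps add_divide_distrib)

lemma node_last [simp]: "N > 0 \<Longrightarrow> node T N N = T"
  by (simp add: node_def)

lemma node_mem: "T > 0 \<Longrightarrow> i \<le> N \<Longrightarrow> node T N i \<in> {0..T}"
  by (cases "N = 0") (auto simp: node_def divide_simps)

text \<open>The partial sums are controlled up to every node at once, because the limit has to be
  identified as a function and not only at \<open>T\<close>. A sample may be close to
  \<open>Z\<close> at any point of its cell, since both left and right endpoints occur
  later.\<close>

lemma riemann_sum_uniform:
  fixes Z :: "real \<Rightarrow> real" and z :: "nat \<Rightarrow> nat \<Rightarrow> real" and N :: "nat \<Rightarrow> nat"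
  assumes T: "T > 0" and Z: "continuous_on {0..T} Z" and N: "filterlim N at_top sequentially"
    and e: "e > 0"
    and z: "\<And>e. e > 0 \<Longrightarrow> \<forall>\<^sub>F n in sequentially. \<forall>i<N n.
              \<exists>\<xi>\<in>{node T (N n) i..node T (N n) (Suc i)}. \<bar>z n i - Z \<xi>\<bar> < e"
  shows "\<forall>\<^sub>F n in sequentially. \<forall>k\<le>N n.
           \<bar>(\<Sum>i<k. T / real (N n) * z n i) - integral {0..node T (N n) k} Z\<bar> < e"
proof -
  \<comment> \<open>A cell contributes at most \<open>2 * e'\<close> times its width: one
    \<open>e'\<close> for the sample, one for the oscillation of \<open>Z\<close>. All cells
    together give at most e/2.\<close>
  define e' where "e' = e / (4 * T)"
  have e': "e' > 0" using e T by (simp add: e'_def)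
  have "uniformly_continuous_on {0..T} Z"
    using Z by (simp add: compact_uniformly_continuous)
  then obtain d where d: "d > 0"
    "\<And>x y. x \<in> {0..T} \<Longrightarrow> y \<in> {0..T} \<Longrightarrow> \<bar>x - y\<bar> < d \<Longrightarrow> \<bar>Z x - Z y\<bar> < e'"
    using e' unfolding uniformly_continuous_on_def dist_real_def by metis
  have "\<forall>\<^sub>F n in sequentially. N n \<ge> nat \<lceil>T / d\<rceil> + 1"
    using N by (simp add: filterlim_at_top)
  then show ?thesis
    using z[OF e']
  proof eventually_elim
    case (elim n)
    define M where "M = N n"
    have M: "M > 0" "T / d < real M"
      using elim(1) by (auto simp: M_def) linarith
    have h: "T / real M < d" "T / real M > 0"
      using M d T by (auto simp: field_simps)
    have "\<bar>(\<Sum>i<k. T / M * z n i) - integral {0..node T M k} Z\<bar> \<le> node T M k * (2 * e')"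
      if "k \<le> M" for k
      using that
    proof (induction k)
      case (Suc k)
      have mem: "node T M k \<in> {0..T}" "node T M (Suc k) \<in> {0..T}"
        using node_mem[OF T] Suc.prems by auto
      have lt: "node T M k < node T M (Suc k)"
        using h by (simp add: node_Suc)
      define A where "A x = integral {0..x} Z" for x
      have A: "(A has_real_derivative Z x) (at x within {0..T})" if "x \<in> {0..T}" for x
        unfolding A_def using integral_has_real_derivative[OF Z that] .
      \<comment> \<open>By the mean value theorem for the primitive, the integral over a cell is
        exactly \<open>Z \<eta>\<close> times the cell width.\<close>
      have "\<exists>\<eta>\<in>{node T M k<..<node T M (Suc k)}.
          A (node T M (Suc k)) - A (node T M k) = (\<lambda>t. Z \<eta> * t) (node T M (Suc k) - node T M k)"
      proof (rule mvt_simple[OF lt])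
        fix x assume x: "node T M k \<le> x" "x \<le> node T M (Suc k)"
        then have "(A has_real_derivative Z x) (at x within {node T M k..node T M (Suc k)})"
          using mem by (intro DERIV_subset[OF A]) auto
        then show "(A has_derivative (\<lambda>t. Z x * t)) (at x within {node T M k..node T M (Suc k)})"
          by (simp add: has_field_derivative_def)
      qed
      then obtain \<eta> where \<eta>: "node T M k < \<eta>" "\<eta> < node T M (Suc k)"
        "A (node T M (Suc k)) - A (node T M k) = Z \<eta> * (T / M)"
        by (auto simp: node_Suc)
      obtain \<xi> where \<xi>: "\<xi> \<in> {node T M k..node T M (Suc k)}" "\<bar>z n k - Z \<xi>\<bar> < e'"
        using elim(2) Suc.prems unfolding M_def by (meson Suc_le_lessD)
      have "\<bar>Z \<xi> - Z \<eta>\<bar> < e'"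
        using \<xi> \<eta> mem h by (intro d) (auto simp: node_Suc)
      then have "\<bar>z n k - Z \<eta>\<bar> \<le> 2 * e'" using \<xi> by linarith
      then have "T / M * \<bar>z n k - Z \<eta>\<bar> \<le> T / M * (2 * e')"
        using h by (intro mult_left_mono) auto
      moreover have "T / M * z n k - Z \<eta> * (T / M) = T / M * (z n k - Z \<eta>)"
        by (simp add: right_diff_distrib mult.commute)
      then have "\<bar>T / M * z n k - Z \<eta> * (T / M)\<bar> = T / M * \<bar>z n k - Z \<eta>\<bar>"
        using h by (simp only: abs_mult abs_of_pos)
      ultimately have le: "\<bar>T / M * z n k - Z \<eta> * (T / M)\<bar> \<le> T / M * (2 * e')"
        by simp
      have "\<bar>(\<Sum>i<k. T / M * z n i) - A (node T M k)\<bar> \<le> node T M k * (2 * e')"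
        using Suc by (simp add: A_def)
      then have "\<bar>(\<Sum>i<Suc k. T / M * z n i) - A (node T M (Suc k))\<bar>
          \<le> node T M k * (2 * e') + T / M * (2 * e')"
        using le \<eta>(3) unfolding sum.lessThan_Suc by linarith
      then show ?case
        unfolding A_def by (simp add: node_Suc distrib_right)
    qed simp
    moreover have "node T M k * (2 * e') < e" if "k \<le> M" for k
    proof -
      have "node T M k * (2 * e') \<le> T * (2 * e')"
        using node_mem[OF T that] e' by (intro mult_right_mono) auto
      also have "\<dots> < e" using T e by (simp add: e'_def)
      finally show ?thesis .
    qed
    ultimately show ?case
      unfolding M_def by (meson le_less_trans)
  qed
qed

lemma riemann_sum_limit:
  fixes Z :: "real \<Rightarrow> real"
  assumes T: "T > 0" and Z: "continuous_on {0..T} Z" and N: "filterlim N at_top sequentially"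
    and z: "\<And>e. e > 0 \<Longrightarrow> \<forall>\<^sub>F n in sequentially. \<forall>i<N n.
              \<exists>\<xi>\<in>{node T (N n) i..node T (N n) (Suc i)}. \<bar>z n i - Z \<xi>\<bar> < e"
  shows "(\<lambda>n. \<Sum>i<N n. T / real (N n) * z n i) \<longlonglongrightarrow> integral {0..T} Z"
  unfolding tendsto_iff
proof (intro allI impI)
  fix e :: real assume e: "e > 0"
  have "\<forall>\<^sub>F n in sequentially. N n \<ge> 1"
    using N by (simp add: filterlim_at_top)
  moreover have "\<forall>\<^sub>F n in sequentially. \<forall>k\<le>N n.
      \<bar>(\<Sum>i<k. T / real (N n) * z n i) - integral {0..node T (N n) k} Z\<bar> < e"
    by (rule riemann_sum_uniform[OF T Z N e z])
  ultimately show "\<forall>\<^sub>F n in sequentially. dist (\<Sum>i<N n. T / real (N n) * z n i) (integral {0..T} Z) < e"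
    by eventually_elim (auto simp: dist_real_def)
qed

lemma node_sum_limit:
  fixes Z :: "real \<Rightarrow> real"
  assumes T: "T > 0" and Z: "continuous_on {0..T} Z" and N: "filterlim N at_top sequentially"
  shows "(\<lambda>n. \<Sum>i<N n. T / real (N n) * Z (node T (N n) i)) \<longlonglongrightarrow> integral {0..T} Z"
proof (rule riemann_sum_limit[OF T Z N])
  fix e :: real assume "e > 0"
  have "node T M i \<in> {node T M i..node T M (Suc i)}" for M i
    using T by (simp add: node_Suc)
  then show "\<forall>\<^sub>F n in sequentially. \<forall>i<N n. \<exists>\<xi>\<in>{node T (N n) i..node T (N n) (Suc i)}.
      \<bar>Z (node T (N n) i) - Z \<xi>\<bar> < e"
    using \<open>e > 0\<close> by (intro always_eventually allI impI) (metis abs_zero diff_self)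
qed

subsection \<open>Limits of discrete solutions\<close>

text \<open>McShane's extension: the lower envelope of the cones of slope \<open>L\<close> over the
  data. It turns grid functions into equicontinuous functions of a real variable, to which
  Arzela-Ascoli applies.\<close>

lemma lipschitz_extension_finite:
  fixes x y :: "nat \<Rightarrow> real"
  assumes L: "L \<ge> 0" and lip: "\<And>i j. i \<le> N \<Longrightarrow> j \<le> N \<Longrightarrow> \<bar>y i - y j\<bar> \<le> L * \<bar>x i - x j\<bar>"
  obtains F where "\<And>i. i \<le> N \<Longrightarrow> F (x i) = y i" "\<And>s t. \<bar>F s - F t\<bar> \<le> L * \<bar>s - t\<bar>"
proof -
  define F where "F s = Min ((\<lambda>i. y i + L * \<bar>s - x i\<bar>) ` {..N})" for s
  have F_le: "F s \<le> y i + L * \<bar>s - x i\<bar>" if "i \<le> N" for s i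
    unfolding F_def using that by (intro Min_le) auto
  have F_ex: "\<exists>i\<le>N. F s = y i + L * \<bar>s - x i\<bar>" for s
  proof -
    have "F s \<in> (\<lambda>i. y i + L * \<bar>s - x i\<bar>) ` {..N}"
      unfolding F_def by (intro Min_in) auto
    then show ?thesis by auto
  qed
  have le: "F s - F t \<le> L * \<bar>s - t\<bar>" for s t
  proof -
    obtain i where i: "i \<le> N" "F t = y i + L * \<bar>t - x i\<bar>" using F_ex by blast
    have "L * \<bar>s - x i\<bar> \<le> L * (\<bar>s - t\<bar> + \<bar>t - x i\<bar>)"
      using L by (intro mult_left_mono) auto
    then show ?thesis using F_le[OF i(1), of s] i(2) by (simp add: distrib_left)
  qed
  show thesis
  proof
    fix i assume i: "i \<le> N"
    obtain j where j: "j \<le> N" "F (x i) = y j + L * \<bar>x i - x j\<bar>" using F_ex by blast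
    show "F (x i) = y i"
      using F_le[OF i, of "x i"] lip[OF i j(1)] j(2) by simp
  next
    show "\<bar>F s - F t\<bar> \<le> L * \<bar>s - t\<bar>" for s t
      using le[of s t] le[of t s] by (simp add: abs_le_iff abs_minus_commute)
  qed
qed

lemma grid_lipschitz:
  assumes step: "\<And>i. i < N \<Longrightarrow> \<bar>y (Suc i) - y i\<bar> \<le> L * (T / real N)" and T: "T > 0"
    and ij: "i \<le> N" "j \<le> N"
  shows "\<bar>y i - y j\<bar> \<le> L * \<bar>node T N i - node T N j\<bar>"
proof -
  have *: "j \<le> N \<Longrightarrow> \<bar>y j - y i\<bar> \<le> L * (node T N j - node T N i)" if "i \<le> j" for i j
    using that
  proof (induction j rule: dec_induct)
    case (step n)
    have "\<bar>y (Suc n) - y i\<bar> \<le> L * (node T N n - node T N i) + L * (T / real N)"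
      using step assms(1)[of n] by linarith
    then show ?case
      by (simp add: node_Suc algebra_simps)
  qed simp
  have mono: "node T N i \<le> node T N j" if "i \<le> j" for i j
    using that T by (auto simp: node_def intro!: divide_right_mono mult_left_mono)
  show ?thesis
    using *[of i j] *[of j i] mono[of i j] mono[of j i] ij
    by (cases "i \<le> j") (auto simp: abs_minus_commute)
qed

lemma node_floor:
  assumes "T > 0" "N > 0" "x \<in> {0..T}"
  obtains k where "k \<le> N" "\<bar>x - node T N k\<bar> \<le> T / real N"
proof
  define k where "k = nat \<lfloor>x * N / T\<rfloor>"
  have nn: "x * N / T \<ge> 0" using assms by simp
  have k: "real k \<le> x * N / T" "x * N / T < real k + 1"
    unfolding k_def using nn by linarith+
  have "x * N / T \<le> N" using assms by (simp add: field_simps)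
  then show "k \<le> N" using k(1) by linarith
  have "x = T / N * (x * N / T)" using assms by simp
  moreover have "T / N * real k \<le> T / N * (x * N / T)" "T / N * (x * N / T) \<le> T / N * (real k + 1)"
    using k assms by (intro mult_left_mono; simp)+
  ultimately have "T / N * real k \<le> x" "x \<le> T / N * real k + T / N"
    by (simp_all add: distrib_left)
  then show "\<bar>x - node T N k\<bar> \<le> T / real N"
    by (simp add: node_def)
qed

text \<open>The steps telescope, and in the limit U(x) - U(0) is the integral of \<open>Z\<close>
  over [0,x]; the fundamental theorem then yields the derivative, one-sided at the
  endpoints.\<close>

lemma has_derivative_of_difference_limit:
  fixes U Z :: "real \<Rightarrow> real" and v z :: "nat \<Rightarrow> nat \<Rightarrow> real"
  assumes T: "T > 0" and N: "filterlim N at_top sequentially"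
    and U: "continuous_on {0..T} U" and Z: "continuous_on {0..T} Z"
    and conv: "\<And>e. e > 0 \<Longrightarrow> \<forall>\<^sub>F n in sequentially. \<forall>i\<le>N n. \<bar>v n i - U (node T (N n) i)\<bar> < e"
    and z: "\<And>e. e > 0 \<Longrightarrow> \<forall>\<^sub>F n in sequentially. \<forall>i<N n.
              \<exists>\<xi>\<in>{node T (N n) i..node T (N n) (Suc i)}. \<bar>z n i - Z \<xi>\<bar> < e"
    and step: "\<And>n i. i < N n \<Longrightarrow> v n (Suc i) - v n i = T / real (N n) * z n i"
    and x: "x \<in> {0..T}"
  shows "(U has_real_derivative Z x) (at x within {0..T})"
proof -
  define D where "D x = U x - U 0 - integral {0..x} Z" for x
  have I: "((\<lambda>x. integral {0..x} Z) has_real_derivative Z x) (at x within {0..T})" if "x \<in> {0..T}" for x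
    by (rule integral_has_real_derivative[OF Z that])
  have "continuous_on {0..T} (\<lambda>x. integral {0..x} Z)"
    by (rule DERIV_continuous_on[OF I])
  then have "continuous_on {0..T} D"
    unfolding D_def by (intro continuous_intros U)
  then have uc: "uniformly_continuous_on {0..T} D"
    by (simp add: compact_uniformly_continuous)
  have D0: "D x = 0" if x: "x \<in> {0..T}" for x
  proof (rule ccontr)
    assume "D x \<noteq> 0"
    \<comment> \<open>Four errors below \<open>e\<close> give the contradiction: \<open>D\<close> at
      \<open>x\<close> against \<open>D\<close> at a nearby node, the Riemann sum, and
      \<open>v n\<close> against \<open>U\<close> at that node and at 0.\<close>
    define e where "e = \<bar>D x\<bar> / 4"
    have e: "e > 0" using \<open>D x \<noteq> 0\<close> by (simp add: e_def)
    obtain d where d: "d > 0"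
      "\<And>x y. x \<in> {0..T} \<Longrightarrow> y \<in> {0..T} \<Longrightarrow> \<bar>x - y\<bar> < d \<Longrightarrow> \<bar>D x - D y\<bar> < e"
      using e uc unfolding uniformly_continuous_on_def dist_real_def by metis
    have "\<forall>\<^sub>F n in sequentially. N n \<ge> nat \<lceil>T / d\<rceil> + 1"
      using N by (simp add: filterlim_at_top)
    moreover have "\<forall>\<^sub>F n in sequentially. \<forall>k\<le>N n.
        \<bar>(\<Sum>i<k. T / real (N n) * z n i) - integral {0..node T (N n) k} Z\<bar> < e"
      by (rule riemann_sum_uniform[OF T Z N e z])
    ultimately have "\<forall>\<^sub>F n::nat in sequentially. False"
      using conv[OF e]
    proof eventually_elim
      case (elim n)
      define M where "M = N n"
      have M: "M > 0" "T / d < real M"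
        using elim(1) by (auto simp: M_def) linarith
      have h: "T / real M < d"
        using M d T by (auto simp: field_simps)
      obtain k where k: "k \<le> M" "\<bar>x - node T M k\<bar> \<le> T / real M"
        using node_floor[OF T M(1) x] by blast
      have "(\<Sum>i<k. T / real M * z n i) = (\<Sum>i<k. v n (Suc i) - v n i)"
        using k(1) by (intro sum.cong) (auto simp: step M_def)
      also have "\<dots> = v n k - v n 0"
        by (rule sum_lessThan_telescope)
      finally have "\<bar>v n k - v n 0 - integral {0..node T M k} Z\<bar> < e"
        using elim(2)[rule_format, of k] k(1) by (simp add: M_def)
      moreover have "\<bar>v n k - U (node T M k)\<bar> < e" "\<bar>v n 0 - U 0\<bar> < e"
        using elim(3) k(1) unfolding M_def by (auto dest: spec[where x = 0])
      moreover have "\<bar>D x - D (node T M k)\<bar> < e"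
        using k h by (intro d x node_mem[OF T]) auto
      moreover have "\<bar>D x\<bar> = 4 * e"
        by (simp add: e_def)
      moreover have "D (node T M k) = U (node T M k) - U 0 - integral {0..node T M k} Z"
        by (simp add: D_def)
      ultimately show ?case
        by linarith
    qed
    then show False by simp
  qed
  have "((\<lambda>x. U 0 + integral {0..x} Z) has_real_derivative Z x) (at x within {0..T})"
    using I[OF x] by (auto intro!: derivative_eq_intros)
  then show ?thesis
  proof (rule has_field_derivative_transform_within[where d = 1])
    fix y assume "y \<in> {0..T}" "dist y x < 1"
    then show "U 0 + integral {0..y} Z = U y"
      using D0[of y] by (simp add: D_def)
  qed (use x in auto)
qed

text \<open>Shared by the eigenvalue problem, where \<open>f\<close> is \<open>phi_p p\<close> and
  \<open>lam n\<close> varies, and the nonlinear problem, where \<open>lam n\<close> is 1. Bounds on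
  \<open>u\<close> and \<open>lam\<close> are the only a priori input: they bound the increments of
  \<open>y\<close>, periodicity of \<open>u\<close> then bounds \<open>y\<close> itself, and
  \<open>y\<close> bounds the increments of \<open>u\<close>, all uniformly in
  \<open>n\<close>.\<close>

lemma discrete_solutions_limit:
  fixes u y :: "nat \<Rightarrow> nat \<Rightarrow> real" and lam :: "nat \<Rightarrow> real" and N :: "nat \<Rightarrow> nat"
  assumes T: "T > 0" and p: "p > 1"
    and q: "continuous_on {0..T} q" and m: "continuous_on {0..T} m" and f: "continuous_on UNIV f"
    and N: "filterlim N at_top sequentially" and Npos: "\<And>n. N n > 0"
    and u_step: "\<And>n i. i < N n \<Longrightarrow>
      u n (Suc i) - u n i = T / real (N n) * phi_p (p / (p - 1)) (y n (Suc i))"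
    and y_step: "\<And>n i. i < N n \<Longrightarrow> y n (Suc i) - y n i = T / real (N n) *
      (q (node T (N n) i) * phi_p p (u n i) - lam n * m (node T (N n) i) * f (u n i))"
    and u_per: "\<And>n. u n (N n) = u n 0" and y_per: "\<And>n. y n (N n) = y n 0"
    and R: "\<And>n i. i \<le> N n \<Longrightarrow> \<bar>u n i\<bar> \<le> R" and K: "\<And>n. \<bar>lam n\<bar> \<le> K"
  obtains r U W l where "strict_mono (r :: nat \<Rightarrow> nat)" "(\<lambda>n. lam (r n)) \<longlonglongrightarrow> l"
    "\<forall>x\<in>{0..T}. (U has_real_derivative phi_p (p / (p - 1)) (W x)) (at x within {0..T})"
    "\<forall>x\<in>{0..T}. (W has_real_derivative q x * phi_p p (U x) - l * m x * f (U x)) (at x within {0..T})"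
    "U 0 = U T" "W 0 = W T"
    "\<forall>e>0. \<forall>\<^sub>F n in sequentially. \<forall>i\<le>N (r n).
        \<bar>u (r n) i - U (node T (N (r n)) i)\<bar> < e \<and> \<bar>y (r n) i - W (node T (N (r n)) i)\<bar> < e"
proof -
  define p' where "p' = p / (p - 1)"
  have p': "p' > 1" using p conjugate_exponent_gt_1 by (simp add: p'_def)
  define H where "H = (\<lambda>(x, s, t). q x * phi_p p s - t * m x * f s)"
  have cont_H: "continuous_on ({0..T} \<times> S) H" for S
  proof -
    have fst: "continuous_on ({0..T} \<times> S) (\<lambda>z. g (fst z))" if "continuous_on {0..T} g" for g :: "real \<Rightarrow> real"
      by (rule continuous_on_compose2[OF that]) (auto intro: continuous_intros)
    have snd: "continuous_on ({0..T} \<times> S) (\<lambda>z. f (fst (snd z)))"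
      by (rule continuous_on_compose2[OF f]) (auto intro!: continuous_on_fst continuous_on_snd)
    show ?thesis
      unfolding H_def case_prod_unfold by (intro continuous_intros fst snd q m p)
  qed
  have "R \<ge> 0" using R[of 0 0] by simp
  have "K \<ge> 0" using K[of 0] by simp
  have "compact ({0..T} \<times> ({-R..R} \<times> {-K..K}))"
    by (intro compact_Times compact_Icc)
  then have "bounded (H ` ({0..T} \<times> ({-R..R} \<times> {-K..K})))"
    using cont_H compact_continuous_image compact_imp_bounded by blast
  then obtain B where B: "B > 0" "\<And>z. z \<in> {0..T} \<times> ({-R..R} \<times> {-K..K}) \<Longrightarrow> \<bar>H z\<bar> \<le> B"
    unfolding bounded_pos by auto
  have h_pos: "T / real (N n) > 0" for n using T Npos by simp
  have y_lip_step: "\<bar>y n (Suc i) - y n i\<bar> \<le> B * (T / real (N n))" if "i < N n" for n i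
  proof -
    have "\<bar>H (node T (N n) i, u n i, lam n)\<bar> \<le> B"
      using R[of i n] K[of n] that node_mem[OF T, of i "N n"] by (intro B) (auto simp: abs_le_iff)
    moreover have "y n (Suc i) - y n i = T / real (N n) * H (node T (N n) i, u n i, lam n)"
      using y_step[OF that] by (simp add: H_def)
    ultimately show ?thesis
      using mult_left_mono[of _ B "T / real (N n)"] h_pos[of n]
      by (simp only: abs_mult abs_of_pos less_imp_le mult.commute[of B])
  qed
  have y_lip: "\<bar>y n i - y n j\<bar> \<le> B * \<bar>node T (N n) i - node T (N n) j\<bar>"
    if "i \<le> N n" "j \<le> N n" for n i j
    using y_lip_step T that by (rule grid_lipschitz)
  have y_bound: "\<bar>y n j\<bar> \<le> B * T" if "j \<le> N n" for n j
  proof -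
    have osc: "\<bar>y n j - y n i\<bar> \<le> B * T" if "i \<le> N n" for i
    proof -
      have "\<bar>node T (N n) j - node T (N n) i\<bar> \<le> T"
        using node_mem[OF T \<open>j \<le> N n\<close>] node_mem[OF T that] by auto
      then have "B * \<bar>node T (N n) j - node T (N n) i\<bar> \<le> B * T"
        using B by (intro mult_left_mono) auto
      then show ?thesis using y_lip[OF \<open>j \<le> N n\<close> that] by linarith
    qed
    \<comment> \<open>By periodicity of \<open>u\<close> the slopes have mean 0, so \<open>y\<close>
      is neither positive throughout nor negative throughout, and its oscillation bounds it.\<close>
    have sum0: "(\<Sum>i<N n. T / real (N n) * phi_p p' (y n (Suc i))) = 0"
    proof -
      have "(\<Sum>i<N n. T / real (N n) * phi_p p' (y n (Suc i))) = (\<Sum>i<N n. u n (Suc i) - u n i)"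
        by (intro sum.cong) (auto simp: u_step p'_def)
      then show ?thesis
        using sum_lessThan_telescope[of "u n" "N n"] u_per by simp
    qed
    have ne: "{..<N n} \<noteq> {}" using Npos[of n] by auto
    have sgn_phi: "phi_p p' s > 0 \<longleftrightarrow> s > 0" "phi_p p' s < 0 \<longleftrightarrow> s < 0" for s
      using sgn_phi_p[of p' s] by (auto simp: sgn_if split: if_splits)
    have "\<exists>i<N n. y n (Suc i) \<ge> 0"
    proof (rule ccontr)
      assume "\<not> ?thesis"
      then have "(\<Sum>i<N n. - (T / real (N n) * phi_p p' (y n (Suc i)))) > 0"
        using h_pos[of n] ne
        by (intro sum_pos) (auto simp: sgn_phi not_le mult_pos_neg simp del: times_divide_eq_left)
      then show False using sum0 by (simp only: sum_negf)
    qed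
    moreover have "\<exists>i<N n. y n (Suc i) \<le> 0"
    proof (rule ccontr)
      assume "\<not> ?thesis"
      then have "(\<Sum>i<N n. T / real (N n) * phi_p p' (y n (Suc i))) > 0"
        using h_pos[of n] ne by (intro sum_pos) (auto simp: sgn_phi not_le simp del: times_divide_eq_left)
      then show False using sum0 by simp
    qed
    ultimately obtain i i' where "i < N n" "y n (Suc i) \<ge> 0" "i' < N n" "y n (Suc i') \<le> 0"
      by blast
    then show ?thesis
      using osc[of "Suc i"] osc[of "Suc i'"] by auto
  qed
  define C where "C = (B * T) powr (p' - 1)"
  have u_lip_step: "\<bar>u n (Suc i) - u n i\<bar> \<le> C * (T / real (N n))" if "i < N n" for n i
  proof -
    have "\<bar>phi_p p' (y n (Suc i))\<bar> \<le> C"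
      unfolding abs_phi_p C_def using p' y_bound[of "Suc i" n] that by (intro powr_mono2) auto
    then show ?thesis
      using mult_left_mono[of _ C "T / real (N n)"] h_pos[of n]
      by (simp only: u_step[OF that] p'_def[symmetric] abs_mult abs_of_pos less_imp_le mult.commute[of C])
  qed
  have u_lip: "\<bar>u n i - u n j\<bar> \<le> C * \<bar>node T (N n) i - node T (N n) j\<bar>"
    if "i \<le> N n" "j \<le> N n" for n i j
    using u_lip_step T that by (rule grid_lipschitz)
  have C: "C \<ge> 0" by (simp add: C_def)
  have "\<exists>F. (\<forall>i\<le>N n. F (node T (N n) i) = u n i) \<and> (\<forall>s t. \<bar>F s - F t\<bar> \<le> C * \<bar>s - t\<bar>)" for n
    by (rule lipschitz_extension_finite[OF C u_lip[of _ n]]) auto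
  then obtain F where F: "\<And>n i. i \<le> N n \<Longrightarrow> F n (node T (N n) i) = u n i"
      "\<And>n s t. \<bar>F n s - F n t\<bar> \<le> C * \<bar>s - t\<bar>" by metis
  have "\<exists>F. (\<forall>i\<le>N n. F (node T (N n) i) = y n i) \<and> (\<forall>s t. \<bar>F s - F t\<bar> \<le> B * \<bar>s - t\<bar>)" for n
    by (rule lipschitz_extension_finite[OF less_imp_le[OF B(1)] y_lip[of _ n]]) auto
  then obtain G where G: "\<And>n i. i \<le> N n \<Longrightarrow> G n (node T (N n) i) = y n i"
      "\<And>n s t. \<bar>G n s - G n t\<bar> \<le> B * \<bar>s - t\<bar>" by metis
  \<comment> \<open>Treating the three components as one vector-valued family gives a single
    subsequence for values, fluxes and \<open>lam\<close>, the last as a constant function of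
    \<open>x\<close>.\<close>
  define V where "V n x = (F n x, G n x, lam n)" for n x
  have V_norm: "norm (a, b, c) \<le> \<bar>a\<bar> + \<bar>b\<bar> + \<bar>c\<bar>" for a b c :: real
    using norm_Pair_le[of a "(b, c)"] norm_Pair_le[of b c] by simp
  have bd: "norm (V n x) \<le> (R + C * T) + (B * T + B * T) + K" if "x \<in> {0..T}" for n x
  proof -
    have "C * \<bar>x - 0\<bar> \<le> C * T" "B * \<bar>x - 0\<bar> \<le> B * T"
      using that C B by (auto intro!: mult_left_mono)
    moreover have "\<bar>F n 0\<bar> \<le> R" "\<bar>G n 0\<bar> \<le> B * T"
      using F(1)[of 0 n] G(1)[of 0 n] R[of 0 n] y_bound[of 0 n] by auto
    ultimately show ?thesis
      using F(2)[of n x 0] G(2)[of n x 0] K[of n] V_norm[of "F n x" "G n x" "lam n"]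
      unfolding V_def by linarith
  qed
  have eq: "\<exists>d. 0 < d \<and> (\<forall>n y. y \<in> {0..T} \<and> norm (x - y) < d \<longrightarrow> norm (V n x - V n y) < e)"
    if "e > 0" for x e
  proof (intro exI conjI allI impI)
    show "e / (C + B) > 0" using that B C by simp
    fix n y assume "y \<in> {0..T} \<and> norm (x - y) < e / (C + B)"
    then have "(C + B) * \<bar>x - y\<bar> < e"
      using B C by (simp add: field_simps)
    then show "norm (V n x - V n y) < e"
      using F(2)[of n x y] G(2)[of n x y] V_norm[of "F n x - F n y" "G n x - G n y" 0]
      unfolding V_def by (simp add: distrib_right)
  qed
  obtain g r where g: "continuous_on {0..T} g" "strict_mono (r :: nat \<Rightarrow> nat)"
    "\<And>e. 0 < e \<Longrightarrow> \<exists>N. \<forall>n x. n \<ge> N \<and> x \<in> {0..T} \<longrightarrow> norm (V (r n) x - g x) < e"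
    using Arzela_Ascoli[of "{0..T}" V, OF compact_Icc bd eq] by metis
  define U where "U x = fst (g x)" for x
  define W where "W x = fst (snd (g x))" for x
  define l where "l = snd (snd (g 0))"
  have contU: "continuous_on {0..T} U" and contW: "continuous_on {0..T} W"
    unfolding U_def W_def by (intro continuous_intros g)+
  have conv: "\<forall>\<^sub>F n in sequentially. (\<forall>x\<in>{0..T}. \<bar>F (r n) x - U x\<bar> < e \<and> \<bar>G (r n) x - W x\<bar> < e)
      \<and> \<bar>lam (r n) - l\<bar> < e" if e: "e > 0" for e
  proof -
    obtain N0 where N0: "\<And>n x. n \<ge> N0 \<Longrightarrow> x \<in> {0..T} \<Longrightarrow> norm (V (r n) x - g x) < e"
      using g(3)[OF e] by metis
    have *: "\<bar>fst z\<bar> \<le> norm z" "\<bar>fst (snd z)\<bar> \<le> norm z" "\<bar>snd (snd z)\<bar> \<le> norm z" for z :: "real \<times> real \<times> real"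
      using norm_fst_le[of "fst z" "snd z"] norm_snd_le[of "snd z" "fst z"]
        norm_fst_le[of "fst (snd z)" "snd (snd z)"] norm_snd_le[of "snd (snd z)" "fst (snd z)"]
      by auto
    have "\<bar>F (r n) x - U x\<bar> < e \<and> \<bar>G (r n) x - W x\<bar> < e" if "n \<ge> N0" "x \<in> {0..T}" for n x
      using N0[OF that] *[of "V (r n) x - g x"] unfolding V_def U_def W_def by auto
    moreover have "\<bar>lam (r n) - l\<bar> < e" if "n \<ge> N0" for n
      using N0[OF that, of 0] T *[of "V (r n) 0 - g 0"] unfolding V_def l_def by auto
    ultimately show ?thesis
      unfolding eventually_sequentially by blast
  qed
  have lam: "(\<lambda>n. lam (r n)) \<longlonglongrightarrow> l"
    unfolding tendsto_iff dist_real_def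
  proof (intro allI impI)
    fix e :: real assume "e > 0"
    from conv[OF this] show "\<forall>\<^sub>F n in sequentially. \<bar>lam (r n) - l\<bar> < e"
      by eventually_elim simp
  qed
  have Nr: "filterlim (\<lambda>n. N (r n)) at_top sequentially"
    by (rule filterlim_compose[OF N]) (rule filterlim_subseq[OF g(2)])
  have conv_nodes: "\<forall>\<^sub>F n in sequentially. \<forall>i\<le>N (r n).
      \<bar>u (r n) i - U (node T (N (r n)) i)\<bar> < e \<and> \<bar>y (r n) i - W (node T (N (r n)) i)\<bar> < e" if "e > 0" for e
    using conv[OF that]
  proof eventually_elim
    case (elim n)
    show ?case
    proof (intro allI impI)
      fix i assume i: "i \<le> N (r n)"
      show "\<bar>u (r n) i - U (node T (N (r n)) i)\<bar> < e \<and> \<bar>y (r n) i - W (node T (N (r n)) i)\<bar> < e"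
        using elim node_mem[OF T i] F(1)[OF i] G(1)[OF i] by metis
    qed
  qed
  have bdd: "\<exists>M. \<forall>x\<in>{0..T}. \<bar>h x\<bar> \<le> M" if "continuous_on {0..T} h" for h :: "real \<Rightarrow> real"
    using compact_imp_bounded[OF compact_continuous_image[OF that compact_Icc]]
    unfolding bounded_iff by auto
  have dU: "(U has_real_derivative phi_p p' (W x)) (at x within {0..T})" if x: "x \<in> {0..T}" for x
  proof (rule has_derivative_of_difference_limit[OF T Nr contU _ _ _ _ x])
    show "continuous_on {0..T} (\<lambda>x. phi_p p' (W x))"
      by (intro continuous_intros p' contW)
    show "\<forall>\<^sub>F n in sequentially. \<forall>i\<le>N (r n). \<bar>u (r n) i - U (node T (N (r n)) i)\<bar> < e"
      if "e > 0" for e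
      using conv_nodes[OF that] by eventually_elim auto
    show "u (r n) (Suc i) - u (r n) i = T / real (N (r n)) * phi_p p' (y (r n) (Suc i))"
      if "i < N (r n)" for n i using u_step[OF that] by (simp add: p'_def)
    fix e :: real assume e: "e > 0"
    obtain M where M: "\<And>x. x \<in> {0..T} \<Longrightarrow> \<bar>W x\<bar> \<le> M" using bdd[OF contW] by blast
    \<comment> \<open>\<open>M'\<close> covers the values of the limit and of the grid functions, so
      that uniform continuity of \<open>phi_p p'\<close> on one compact interval applies.\<close>
    define M' where "M' = max M (B * T)"
    have "uniformly_continuous_on {-M'..M'} (phi_p p')"
      using p' by (intro compact_uniformly_continuous compact_Icc) (intro continuous_intros)
    then obtain d where d: "d > 0"
      "\<And>x y. x \<in> {-M'..M'} \<Longrightarrow> y \<in> {-M'..M'} \<Longrightarrow> \<bar>x - y\<bar> < d \<Longrightarrow> \<bar>phi_p p' x - phi_p p' y\<bar> < e"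
      using e unfolding uniformly_continuous_on_def dist_real_def by metis
    show "\<forall>\<^sub>F n in sequentially. \<forall>i<N (r n). \<exists>\<xi>\<in>{node T (N (r n)) i..node T (N (r n)) (Suc i)}.
        \<bar>phi_p p' (y (r n) (Suc i)) - phi_p p' (W \<xi>)\<bar> < e"
      using conv_nodes[OF d(1)]
    proof eventually_elim
      case (elim n)
      show ?case
      proof (intro allI impI bexI)
        fix i assume i: "i < N (r n)"
        \<comment> \<open>The right endpoint is the sample point, matching the index
          \<open>Suc i\<close> in \<open>u_step\<close>.\<close>
        show "node T (N (r n)) (Suc i) \<in> {node T (N (r n)) i..node T (N (r n)) (Suc i)}"
          using T by (simp add: node_Suc)
        show "\<bar>phi_p p' (y (r n) (Suc i)) - phi_p p' (W (node T (N (r n)) (Suc i)))\<bar> < e"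
        proof (rule d)
          show "y (r n) (Suc i) \<in> {-M'..M'}"
            using y_bound[of "Suc i" "r n"] i unfolding M'_def by (auto simp: abs_le_iff)
          show "W (node T (N (r n)) (Suc i)) \<in> {-M'..M'}"
            using M[OF node_mem[OF T, of "Suc i" "N (r n)"]] i unfolding M'_def by (auto simp: abs_le_iff)
        qed (use elim i in auto)
      qed
    qed
  qed
  have dW: "(W has_real_derivative q x * phi_p p (U x) - l * m x * f (U x)) (at x within {0..T})"
    if x: "x \<in> {0..T}" for x
  proof (rule has_derivative_of_difference_limit[OF T Nr contW _ _ _ _ x])
    show "continuous_on {0..T} (\<lambda>x. q x * phi_p p (U x) - l * m x * f (U x))"
      by (intro continuous_intros p contU q m continuous_on_compose2[OF f contU]) auto
    show "\<forall>\<^sub>F n in sequentially. \<forall>i\<le>N (r n). \<bar>y (r n) i - W (node T (N (r n)) i)\<bar> < e"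
      if "e > 0" for e
      using conv_nodes[OF that] by eventually_elim auto
    show "y (r n) (Suc i) - y (r n) i = T / real (N (r n)) *
        (q (node T (N (r n)) i) * phi_p p (u (r n) i) - lam (r n) * m (node T (N (r n)) i) * f (u (r n) i))"
      if "i < N (r n)" for n i using y_step[OF that] .
    fix e :: real assume e: "e > 0"
    obtain M where M: "\<And>x. x \<in> {0..T} \<Longrightarrow> \<bar>U x\<bar> \<le> M" using bdd[OF contU] by blast
    define M' where "M' = max M R"
    define K' where "K' = max K \<bar>l\<bar>"
    define Q where "Q = {0..T} \<times> ({-M'..M'} \<times> {-K'..K'})"
    have "uniformly_continuous_on Q H"
      unfolding Q_def by (intro compact_uniformly_continuous cont_H compact_Times compact_Icc)
    then obtain d where d: "d > 0"
      "\<And>x y. x \<in> Q \<Longrightarrow> y \<in> Q \<Longrightarrow> norm (x - y) < d \<Longrightarrow> \<bar>H x - H y\<bar> < e"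
      using e unfolding uniformly_continuous_on_def dist_norm real_norm_def by metis
    have d2: "d / 2 > 0" using d by simp
    show "\<forall>\<^sub>F n in sequentially. \<forall>i<N (r n). \<exists>\<xi>\<in>{node T (N (r n)) i..node T (N (r n)) (Suc i)}.
        \<bar>q (node T (N (r n)) i) * phi_p p (u (r n) i) - lam (r n) * m (node T (N (r n)) i) * f (u (r n) i)
          - (q \<xi> * phi_p p (U \<xi>) - l * m \<xi> * f (U \<xi>))\<bar> < e"
      using conv_nodes[OF d2] conv[OF d2]
    proof eventually_elim
      case (elim n)
      show ?case
      proof (intro allI impI bexI)
        fix i assume i: "i < N (r n)"
        define x where "x = node T (N (r n)) i"
        have x: "x \<in> {0..T}" using i node_mem[OF T] by (simp add: x_def)
        have "\<bar>H (x, u (r n) i, lam (r n)) - H (x, U x, l)\<bar> < e"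
        proof (rule d)
          show "(x, u (r n) i, lam (r n)) \<in> Q"
            using x R[of i "r n"] K[of "r n"] i unfolding Q_def M'_def K'_def
            by (auto simp: abs_le_iff)
          show "(x, U x, l) \<in> Q"
            using x M[OF x] unfolding Q_def M'_def K'_def by (auto simp: abs_le_iff)
          have "\<bar>u (r n) i - U x\<bar> < d / 2" "\<bar>lam (r n) - l\<bar> < d / 2"
            using elim less_imp_le[OF i] unfolding x_def by blast+
          moreover have "(x, u (r n) i, lam (r n)) - (x, U x, l) = (0, u (r n) i - U x, lam (r n) - l)"
            by simp
          ultimately show "norm ((x, u (r n) i, lam (r n)) - (x, U x, l)) < d"
            using V_norm[of 0 "u (r n) i - U x" "lam (r n) - l"] by (simp only:)
        qed
        then show "\<bar>q x * phi_p p (u (r n) i) - lam (r n) * m x * f (u (r n) i)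
            - (q x * phi_p p (U x) - l * m x * f (U x))\<bar> < e"
          by (simp add: H_def)
        show "x \<in> {node T (N (r n)) i..node T (N (r n)) (Suc i)}"
          using T by (simp add: node_Suc x_def)
      qed
    qed
  qed
  \<comment> \<open>The grid functions are exactly periodic, so the limit is periodic up to
    \<open>2 * e\<close>; taking \<open>e\<close> as a quarter of the discrepancy forces it to
    vanish.\<close>
  have small: "\<bar>U 0 - U T\<bar> \<le> 2 * e \<and> \<bar>W 0 - W T\<bar> \<le> 2 * e" if e: "e > 0" for e
  proof -
    obtain n where n: "\<And>i. i \<le> N (r n) \<Longrightarrow> \<bar>u (r n) i - U (node T (N (r n)) i)\<bar> < e \<and>
        \<bar>y (r n) i - W (node T (N (r n)) i)\<bar> < e"
      using eventually_happens[OF conv_nodes[OF e]] by auto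
    show ?thesis
      using n[of 0] n[of "N (r n)"] Npos[of "r n"] u_per[of "r n"] y_per[of "r n"]
      by auto
  qed
  have per: "U 0 = U T" "W 0 = W T"
    using small[of "\<bar>U 0 - U T\<bar> / 4"] small[of "\<bar>W 0 - W T\<bar> / 4"] by (auto split: if_splits)
  show thesis
    by (rule that[OF g(2) lam _ _ per]) (use dU dW conv_nodes in \<open>auto simp only: p'_def\<close>)
qed

subsection \<open>Periodic Sobolev functions\<close>

lemma integrable_lebesgue_on_iff:
  fixes g :: "real \<Rightarrow> real"
  assumes "S \<in> sets lebesgue"
  shows "integrable (lebesgue_on S) g \<longleftrightarrow> g absolutely_integrable_on S"
  using assms by (simp add: integrable_restrict_space set_integrable_def)

lemma continuous_integrable_open:
  fixes g :: "real \<Rightarrow> real"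
  assumes "continuous_on {a..b} g"
  shows "integrable (lebesgue_on {a<..<b}) g"
proof -
  have "g absolutely_integrable_on {a..b}"
    using assms by (rule absolutely_integrable_continuous_real)
  then have "g absolutely_integrable_on {a<..<b}"
    by (rule set_integrable_subset) (auto simp: less_imp_le)
  then show ?thesis by (simp add: integrable_lebesgue_on_iff)
qed

text \<open>The definitions integrate over the open interval, the fundamental theorem and the
  Riemann sums over the closed one; the endpoints are negligible.\<close>

lemma has_integral_LINT_open:
  fixes g :: "real \<Rightarrow> real"
  assumes "integrable (lebesgue_on {a<..<b}) g"
  shows "(g has_integral (LINT x|lebesgue_on {a<..<b}. g x)) {a..b}"
proof -
  have *: "(g has_integral (LINT x|lebesgue_on {a<..<b}. g x)) {a<..<b}"
    by (rule has_integral_integral_lebesgue_on[OF assms]) simp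
  then have "g integrable_on {a..b}"
    using integrable_on_open_interval_real by blast
  then show ?thesis
    using * integral_open_interval_real[of a b g] by (simp add: has_integral_iff)
qed

lemma LINT_open_eq_integral:
  fixes g :: "real \<Rightarrow> real"
  assumes "integrable (lebesgue_on {a<..<b}) g"
  shows "(LINT x|lebesgue_on {a<..<b}. g x) = integral {a..b} g"
  using has_integral_LINT_open[OF assms] by (simp add: integral_unique)

section \<open>C^1 cutoff functions and the fundamental theorem for weak derivatives\<close>

definition pos_sq :: "real \<Rightarrow> real" where
  "pos_sq t = (max 0 t)\<^sup>2 / 2"

lemma DERIV_pos_sq: "(pos_sq has_real_derivative max 0 t) (at t)"
proof -
  consider "t > 0" | "t < 0" | "t = 0" by linarith
  then show ?thesis
  proof cases
    case 1
    have "((\<lambda>t. t\<^sup>2 / 2) has_real_derivative t) (at t)"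
      by (auto intro!: derivative_eq_intros)
    then have "(pos_sq has_real_derivative t) (at t)"
      by (rule has_field_derivative_transform_within_open[where S = "{0<..}"])
        (use 1 in \<open>auto simp: pos_sq_def\<close>)
    then show ?thesis using 1 by simp
  next
    case 2
    have "((\<lambda>t. 0) has_real_derivative 0) (at t)" by simp
    then have "(pos_sq has_real_derivative 0) (at t)"
      by (rule has_field_derivative_transform_within_open[where S = "{..<0}"])
        (use 2 in \<open>auto simp: pos_sq_def\<close>)
    then show ?thesis using 2 by simp
  next
    case 3
    have "(\<lambda>h. max 0 h / 2) \<midarrow>0\<rightarrow> max 0 0 / (2::real)"
      by (intro tendsto_intros) auto
    moreover have "\<forall>\<^sub>F h in at 0. max 0 h / 2 = (pos_sq (0 + h) - pos_sq 0) / h"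
      by (auto simp: eventually_at_filter pos_sq_def max_def power2_eq_square)
    ultimately have "(\<lambda>h. (pos_sq (0 + h) - pos_sq 0) / h) \<midarrow>0\<rightarrow> 0"
      using Lim_transform_eventually by fastforce
    then show ?thesis unfolding DERIV_def 3 by simp
  qed
qed

lemma DERIV_pos_sq_compose [derivative_intros]:
  "(g has_real_derivative g') (at x within S) \<Longrightarrow>
    ((\<lambda>x. pos_sq (g x)) has_real_derivative max 0 (g x) * g') (at x within S)"
  by (rule DERIV_chain2[OF DERIV_pos_sq])

text \<open>A second difference of a C^1 primitive of the positive part: it rises from 0 to 1 on
  [0,2] with just the smoothness that \<open>test_function\<close> asks for. Its derivative
  \<open>hat\<close> is the tent of mass 1 on [0,2].\<close>

definition smooth_step :: "real \<Rightarrow> real" where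
  "smooth_step t = pos_sq t - 2 * pos_sq (t - 1) + pos_sq (t - 2)"

definition hat :: "real \<Rightarrow> real" where
  "hat t = max 0 t - 2 * max 0 (t - 1) + max 0 (t - 2)"

lemma DERIV_smooth_step [derivative_intros]:
  "(g has_real_derivative g') (at x within S) \<Longrightarrow>
    ((\<lambda>x. smooth_step (g x)) has_real_derivative hat (g x) * g') (at x within S)"
  unfolding smooth_step_def hat_def
  by (auto intro!: derivative_eq_intros simp: algebra_simps)

lemma smooth_step_eq_0: "t \<le> 0 \<Longrightarrow> smooth_step t = 0"
  by (simp add: smooth_step_def pos_sq_def max_def)

lemma smooth_step_eq_1: "t \<ge> 2 \<Longrightarrow> smooth_step t = 1"
  by (simp add: smooth_step_def pos_sq_def max_def power2_eq_square algebra_simps add_divide_distrib diff_divide_distrib)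

lemma hat_nonneg: "hat t \<ge> 0"
  by (simp add: hat_def max_def)

lemma hat_eq_0: "t \<le> 0 \<or> t \<ge> 2 \<Longrightarrow> hat t = 0"
  by (auto simp: hat_def max_def)

lemma continuous_on_hat [continuous_intros]:
  "continuous_on S g \<Longrightarrow> continuous_on S (\<lambda>x. hat (g x))"
  unfolding hat_def by (intro continuous_intros)

lemma smooth_step_mono: "s \<le> t \<Longrightarrow> smooth_step s \<le> smooth_step t"
  by (rule DERIV_nonneg_imp_nondecreasing[of s t smooth_step])
    (use hat_nonneg DERIV_smooth_step[OF DERIV_ident] in auto)

lemma smooth_step_bounds: "0 \<le> smooth_step t" "smooth_step t \<le> 1"
  using smooth_step_mono[of 0 t] smooth_step_mono[of t 2] smooth_step_eq_0[of t] smooth_step_eq_0[of 0]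
    smooth_step_eq_1[of t] smooth_step_eq_1[of 2] by linarith+

text \<open>The kernel n hat(n(x-a)) has mass 1 and support in [a, a + 2/n], so the integral
  averages \<open>u\<close> just to the right of \<open>a\<close>.\<close>

lemma hat_approximate_identity:
  assumes a: "0 < a" "a < T" and u: "continuous_on {0..T} u"
  shows "(\<lambda>n. integral {0..T} (\<lambda>x. u x * (real n * hat (real n * (x - a))))) \<longlonglongrightarrow> u a"
  unfolding tendsto_iff
proof (intro allI impI)
  fix e :: real assume e: "e > 0"
  have "a \<in> {0..T}" using a by simp
  then obtain d where d: "d > 0" "\<And>x. x \<in> {0..T} \<Longrightarrow> \<bar>x - a\<bar> < d \<Longrightarrow> \<bar>u x - u a\<bar> < e / 2"
    using u e unfolding continuous_on_iff dist_real_def by (metis half_gt_zero)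
  \<comment> \<open>For n d' > 2 the support [a, a + 2/n] lies within distance \<open>d\<close> of
    \<open>a\<close> and inside [0,T], so that the kernel keeps its full mass.\<close>
  define d' where "d' = min d (T - a)"
  have d': "d' > 0" using d a by (simp add: d'_def)
  have "\<forall>\<^sub>F n in sequentially. n \<ge> nat \<lceil>2 / d'\<rceil> + 1"
    by (rule eventually_ge_at_top)
  then show "\<forall>\<^sub>F n in sequentially.
      dist (integral {0..T} (\<lambda>x. u x * (real n * hat (real n * (x - a))))) (u a) < e"
  proof eventually_elim
    case (elim n)
    then have "real n > 2 / d'" by linarith
    then have nd: "real n * d' > 2" using d' by (simp add: field_simps)
    have n: "real n > 0" using nd by (cases "n = 0") auto
    define k where "k x = real n * hat (real n * (x - a))" for x
    have k_cont: "continuous_on S k" for S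
      unfolding k_def by (intro continuous_intros)
    have k_nonneg: "k x \<ge> 0" for x
      unfolding k_def by (simp add: hat_nonneg)
    have "(k has_integral (smooth_step (real n * (T - a)) - smooth_step (real n * (0 - a)))) {0..T}"
      unfolding k_def using a
      by (intro fundamental_theorem_of_calculus)
        (auto intro!: derivative_eq_intros simp: has_real_derivative_iff_has_vector_derivative[symmetric])
    moreover have "real n * d' \<le> real n * (T - a)"
      using n by (intro mult_left_mono) (auto simp: d'_def)
    then have "smooth_step (real n * (T - a)) = 1"
      using nd by (intro smooth_step_eq_1) linarith
    moreover have "smooth_step (real n * (0 - a)) = 0"
      using n a by (intro smooth_step_eq_0) (simp add: mult_nonneg_nonpos)
    ultimately have k_int: "(k has_integral 1) {0..T}" by simp
    have uk_int: "(\<lambda>x. u x * k x) integrable_on {0..T}"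
      by (intro integrable_continuous_real continuous_intros u k_cont)
    have "((\<lambda>x. u x * k x - u a * k x) has_integral (integral {0..T} (\<lambda>x. u x * k x) - u a * 1)) {0..T}"
      by (intro has_integral_diff has_integral_mult_right k_int integrable_integral uk_int)
    moreover have "((\<lambda>x. e / 2 * k x) has_integral e / 2 * 1) {0..T}"
      by (intro has_integral_mult_right k_int)
    moreover have "norm (u x * k x - u a * k x) \<le> e / 2 * k x" if x: "x \<in> {0..T}" for x
    proof (cases "\<bar>x - a\<bar> < d")
      case True
      have "\<bar>u x - u a\<bar> * k x \<le> e / 2 * k x"
        using d(2)[OF x True] k_nonneg[of x] by (intro mult_right_mono) auto
      then show ?thesis
        using k_nonneg[of x] by (simp add: left_diff_distrib[symmetric] abs_mult)
    next
      case False
      have "k x = 0"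
      proof (cases "x \<le> a")
        case True
        then have "real n * (x - a) \<le> 0" using n by (simp add: mult_nonneg_nonpos)
        then show ?thesis unfolding k_def by (simp add: hat_eq_0)
      next
        case F: False
        then have "x - a \<ge> d'" using False by (auto simp: d'_def)
        then have "real n * (x - a) \<ge> real n * d'" using n by simp
        then show ?thesis unfolding k_def using nd by (simp add: hat_eq_0)
      qed
      then show ?thesis by simp
    qed
    ultimately have "norm (integral {0..T} (\<lambda>x. u x * k x) - u a * 1) \<le> e / 2 * 1"
      using has_integral_norm_bound_integral_component integral_norm_bound_integral
      by (metis (no_types, lifting) has_integral_iff)
    then show ?case
      using e unfolding k_def by (simp add: dist_real_def)
  qed
qed

lemma Lp_on_imp_integrable:
  assumes "p > 1" "Lp_on p T v"
  shows "integrable (lebesgue_on {0<..<T}) v"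
proof (rule Bochner_Integration.integrable_bound)
  have "integrable (lebesgue_on {0<..<T}) (\<lambda>x. 1 :: real)"
    by (rule continuous_integrable_open) simp
  then show "integrable (lebesgue_on {0<..<T}) (\<lambda>x. 1 + \<bar>v x\<bar> powr p)"
    using assms by (intro Bochner_Integration.integrable_add) (auto simp: Lp_on_def)
  show "v \<in> borel_measurable (lebesgue_on {0<..<T})"
    using assms by (simp add: Lp_on_def)
  have "\<bar>v x\<bar> \<le> 1 + \<bar>v x\<bar> powr p" for x
  proof (cases "\<bar>v x\<bar> \<le> 1")
    case False
    then have "\<bar>v x\<bar> powr 1 \<le> \<bar>v x\<bar> powr p"
      using assms by (intro powr_mono) auto
    then show ?thesis using False by simp
  qed (simp add: add_increasing2)
  then show "AE x in lebesgue_on {0<..<T}. norm (v x) \<le> norm (1 + \<bar>v x\<bar> powr p)"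
    by (auto intro: order_trans[OF _ abs_ge_self])
qed

text \<open>The test functions \<open>h n\<close> are differences of two steps and tend to the
  indicator of (a,b], while their derivatives are differences of approximate identities at
  \<open>a\<close> and \<open>b\<close>. The weak identity passes to the limit. The strict
  inequalities keep the supports compact in (0,T) for large \<open>n\<close>.\<close>

lemma weak_derivative_interior:
  assumes T: "T > 0" and v: "integrable (lebesgue_on {0<..<T}) v"
    and w: "weak_derivative T u v" and u: "continuous_on {0..T} u"
    and ab: "0 < a" "a < b" "b < T"
  shows "u b - u a = integral {a..b} v"
proof -
  define h where "h n x = smooth_step (real n * (x - a)) - smooth_step (real n * (x - b))" for n x
  define h' where "h' n x = real n * hat (real n * (x - a)) - real n * hat (real n * (x - b))" for n x
  have h_cont: "continuous_on S (h n)" for n S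
  proof -
    have "(h n has_real_derivative h' n x) (at x)" for x
      unfolding h_def h'_def by (auto intro!: derivative_eq_intros)
    then show ?thesis by (meson DERIV_isCont continuous_at_imp_continuous_on)
  qed
  have h_deriv: "(h n has_real_derivative h' n x) (at x)" for n x
    unfolding h_def h'_def by (auto intro!: derivative_eq_intros)
  have h'_cont: "continuous_on S (h' n)" for n S
    unfolding h'_def by (intro continuous_intros)
  have test: "test_function T (h n) (h' n)" if n: "real n * (T - b) > 2" for n
  proof -
    have n0: "real n > 0" using n by (cases "n = 0") auto
    define c where "c = b + 2 / real n"
    have c: "c < T" using n n0 by (simp add: c_def field_simps)
    have "h n x = 0" if "x \<notin> {a..c}" for x
    proof (cases "x < a")
      case True
      then show ?thesis
        unfolding h_def using n0 ab by (simp add: smooth_step_eq_0 mult_nonneg_nonpos)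
    next
      case False
      then have x: "x > c" using that by auto
      then have "real n * (x - b) \<ge> 2" using n0 by (simp add: c_def field_simps)
      moreover have "real n * (x - b) \<le> real n * (x - a)" using n0 ab by simp
      ultimately show ?thesis unfolding h_def by (simp add: smooth_step_eq_1)
    qed
    then have "{x. h n x \<noteq> 0} \<subseteq> {a..c}" by blast
    then have *: "closure {x. h n x \<noteq> 0} \<subseteq> {a..c}"
      by (intro closure_minimal) auto
    moreover have "compact (closure {x. h n x \<noteq> 0})"
      using * by (meson bounded_closed_interval bounded_subset closed_closure compact_eq_bounded_closed)
    moreover have "{a..c} \<subseteq> {0<..<T}" using ab c by auto
    ultimately show ?thesis
      unfolding test_function_def using h_deriv h'_cont by auto
  qed
  have lhs: "(\<lambda>n. LINT x|lebesgue_on {0<..<T}. u x * h' n x) \<longlonglongrightarrow> u a - u b"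
  proof -
    have cu: "(\<lambda>x. u x * (real n * hat (real n * (x - c)))) integrable_on {0..T}" for n c
      by (intro integrable_continuous_real continuous_intros u)
    have "(LINT x|lebesgue_on {0<..<T}. u x * h' n x)
        = integral {0..T} (\<lambda>x. u x * (real n * hat (real n * (x - a))))
          - integral {0..T} (\<lambda>x. u x * (real n * hat (real n * (x - b))))" for n
    proof -
      have "(LINT x|lebesgue_on {0<..<T}. u x * h' n x) = integral {0..T} (\<lambda>x. u x * h' n x)"
        by (intro LINT_open_eq_integral continuous_integrable_open continuous_intros u h'_cont)
      also have "\<dots> = integral {0..T} (\<lambda>x. u x * (real n * hat (real n * (x - a)))
          - u x * (real n * hat (real n * (x - b))))"
        by (simp add: h'_def right_diff_distrib)
      finally show ?thesis
        using Henstock_Kurzweil_Integration.integral_diff[OF cu cu] by simp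
    qed
    then show ?thesis
      using tendsto_diff[OF hat_approximate_identity[OF _ _ u, of a] hat_approximate_identity[OF _ _ u, of b]] ab
      by simp
  qed
  have rhs: "(\<lambda>n. LINT x|lebesgue_on {0<..<T}. v x * h n x) \<longlonglongrightarrow>
      (LINT x|lebesgue_on {0<..<T}. v x * indicator {a<..b} x)"
  proof (rule integral_dominated_convergence[where w = "\<lambda>x. \<bar>v x\<bar>"])
    have v_meas: "v \<in> borel_measurable (lebesgue_on {0<..<T})"
      using v by (rule borel_measurable_integrable)
    show "(\<lambda>x. v x * indicator {a<..b} x) \<in> borel_measurable (lebesgue_on {0<..<T})"
      by (intro borel_measurable_times v_meas borel_measurable_indicator) (use ab in \<open>auto simp: sets_restrict_space_iff\<close>)
    show "(\<lambda>x. v x * h n x) \<in> borel_measurable (lebesgue_on {0<..<T})" for n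
      by (intro borel_measurable_times v_meas continuous_imp_measurable_on_sets_lebesgue h_cont) auto
    show "integrable (lebesgue_on {0<..<T}) (\<lambda>x. \<bar>v x\<bar>)"
      using v by (rule Bochner_Integration.integrable_abs)
    \<comment> \<open>The step vanishes at \<open>c\<close> itself, so the limit is the indicator of
      an open half-line; the difference of two such indicators belongs to (a,b].\<close>
    have lim: "(\<lambda>n. smooth_step (real n * (x - c))) \<longlonglongrightarrow> indicator {c<..} x" for x c
    proof (cases "x \<le> c")
      case True
      then have "smooth_step (real n * (x - c)) = 0" for n
        by (intro smooth_step_eq_0) (simp add: mult_nonneg_nonpos)
      then show ?thesis using True by simp
    next
      case False
      have "\<forall>\<^sub>F n in sequentially. smooth_step (real n * (x - c)) = 1"
        using eventually_ge_at_top[of "nat \<lceil>2 / (x - c)\<rceil>"]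
      proof eventually_elim
        case (elim n)
        then have "2 / (x - c) \<le> real n" by linarith
        then show ?case using False by (intro smooth_step_eq_1) (simp add: field_simps)
      qed
      then show ?thesis using False by (simp add: tendsto_eventually)
    qed
    have "(\<lambda>n. v x * h n x) \<longlonglongrightarrow> v x * (indicator {a<..} x - indicator {b<..} x)" for x
      unfolding h_def by (intro tendsto_intros lim)
    moreover have "indicator {a<..} x - indicator {b<..} x = (indicator {a<..b} x :: real)" for x
      using ab by (auto simp: indicator_def)
    ultimately show "AE x in lebesgue_on {0<..<T}. (\<lambda>n. v x * h n x) \<longlonglongrightarrow> v x * indicator {a<..b} x"
      by simp
    have "\<bar>h n x\<bar> \<le> 1" for n x
      using smooth_step_bounds[of "real n * (x - a)"] smooth_step_bounds[of "real n * (x - b)"]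
      unfolding h_def by linarith
    then show "AE x in lebesgue_on {0<..<T}. norm (v x * h n x) \<le> \<bar>v x\<bar>" for n
      by (simp add: abs_mult mult_left_le)
  qed
  have "\<forall>\<^sub>F n in sequentially. (LINT x|lebesgue_on {0<..<T}. u x * h' n x)
      = - (LINT x|lebesgue_on {0<..<T}. v x * h n x)"
    using eventually_ge_at_top[of "nat \<lceil>2 / (T - b)\<rceil> + 1"]
  proof eventually_elim
    case (elim n)
    then have "2 / (T - b) < real n" by linarith
    then have "real n * (T - b) > 2" using ab by (simp add: field_simps)
    then show ?case using w test unfolding weak_derivative_def by blast
  qed
  then have "(\<lambda>n. LINT x|lebesgue_on {0<..<T}. u x * h' n x) \<longlonglongrightarrow>
      - (LINT x|lebesgue_on {0<..<T}. v x * indicator {a<..b} x)"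
    using Lim_transform_eventually[OF tendsto_minus[OF rhs]] by (simp add: eq_commute)
  then have "u a - u b = - (LINT x|lebesgue_on {0<..<T}. v x * indicator {a<..b} x)"
    using lhs LIMSEQ_unique by blast
  also have "(LINT x|lebesgue_on {0<..<T}. v x * indicator {a<..b} x)
      = integral {0..T} (\<lambda>x. v x * indicator {a<..b} x)"
    by (intro LINT_open_eq_integral integrable_real_mult_indicator v) (use ab in \<open>auto simp: sets_restrict_space_iff\<close>)
  also have "\<dots> = integral {0..T} (\<lambda>x. if x \<in> {a..b} then v x else 0)"
    by (rule integral_spike[of "{a}"]) (auto simp: indicator_def)
  also have "\<dots> = integral {a..b} v"
    using ab by (simp only: Henstock_Kurzweil_Integration.integral_restrict_Int) (simp add: Int_absorb1 max_def)
  finally show ?thesis by simp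
qed

text \<open>The interior case makes the defect \<open>D\<close> constant on (0,T), and continuity of
  \<open>u\<close> carries this to the endpoints.\<close>

lemma weak_derivative_FTC:
  assumes T: "T > 0" and v: "integrable (lebesgue_on {0<..<T}) v"
    and w: "weak_derivative T u v" and u: "continuous_on {0..T} u"
    and ab: "0 \<le> a" "a \<le> b" "b \<le> T"
  shows "u b - u a = integral {a..b} v"
proof -
  have vi: "v integrable_on {0..T}"
    using has_integral_LINT_open[OF v] by blast
  define D where "D x = u x - integral {0..x} v" for x
  have comb: "integral {0..s} v + integral {s..t} v = integral {0..t} v" if "0 \<le> s" "s \<le> t" "t \<le> T" for s t
    using that by (intro Henstock_Kurzweil_Integration.integral_combine integrable_on_subinterval[OF vi]) auto
  have "continuous_on {0..T} D"
    unfolding D_def by (intro continuous_intros u indefinite_integral_continuous_1 vi)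
  then have cD: "continuous_on (closure {0<..<T}) D"
    using T by simp
  have D_eq: "D s = D t" if "0 < s" "s < t" "t < T" for s t
    using weak_derivative_interior[OF T v w u that] comb[of s t] that by (simp add: D_def)
  have D_eq_mid: "D x = D (T / 2)" if x: "x \<in> {0<..<T}" for x
  proof -
    consider "x < T / 2" | "x = T / 2" | "x > T / 2" by linarith
    then show ?thesis
    proof cases
      case 1
      then show ?thesis using D_eq[of x "T / 2"] x T by simp
    next
      case 2
      then show ?thesis by (simp only:)
    next
      case 3
      then show ?thesis using D_eq[of "T / 2" x] x T by simp
    qed
  qed
  have D_const: "D x = D (T / 2)" if "x \<in> {0..T}" for x
  proof (rule continuous_constant_on_closure[OF cD])
    show "x \<in> closure {0<..<T}" using that T by simp
  qed (rule D_eq_mid)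
  have "a \<in> {0..T}" "b \<in> {0..T}" using ab by auto
  then have "D a = D b" by (rule trans[OF D_const D_const[symmetric]])
  then show ?thesis
    using comb[of a b] ab by (simp add: D_def)
qed

lemma integral_powr_ge_mean:
  fixes p :: real and v :: "real \<Rightarrow> real"
  assumes p: "p > 1" and ab: "a < b" and v: "v integrable_on {a..b}"
    and vp: "(\<lambda>x. \<bar>v x\<bar> powr p) integrable_on {a..b}"
  shows "(b - a) * \<bar>integral {a..b} v / (b - a)\<bar> powr p \<le> integral {a..b} (\<lambda>x. \<bar>v x\<bar> powr p)"
proof -
  define c where "c = integral {a..b} v / (b - a)"
  have const: "((\<lambda>x. k) has_integral k * (b - a)) {a..b}" for k :: real
    using has_integral_const_real[of k a b] ab by (simp add: mult.commute)
  have "((\<lambda>x. \<bar>c\<bar> powr p + p * phi_p p c * (v x - c)) has_integral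
      (\<bar>c\<bar> powr p * (b - a) + p * phi_p p c * (integral {a..b} v - c * (b - a)))) {a..b}"
    by (intro has_integral_add has_integral_mult_right has_integral_diff integrable_integral v const)
  moreover have "integral {a..b} v - c * (b - a) = 0"
    using ab by (simp add: c_def)
  ultimately have "((\<lambda>x. \<bar>c\<bar> powr p + p * phi_p p c * (v x - c)) has_integral (b - a) * \<bar>c\<bar> powr p) {a..b}"
    by (simp add: mult.commute)
  then show ?thesis
    unfolding c_def[symmetric]
    by (rule has_integral_le[OF _ integrable_integral[OF vp]]) (rule abs_powr_tangent[OF p])
qed

text \<open>On each cell the difference quotient of \<open>u\<close> is the mean of
  \<open>v\<close>, so Jensen's inequality applies cell by cell. An arbitrary Sobolev competitor can
  therefore be sampled without being smoothed first.\<close>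

lemma interpolant_energy_le:
  assumes T: "T > 0" and p: "p > 1" and w: "W1p_periodic p T u v" and N: "N > 0"
  shows "(\<Sum>i<N. T / real N * \<bar>(u (node T N (Suc i)) - u (node T N i)) / (T / real N)\<bar> powr p)
    \<le> integral {0..T} (\<lambda>x. \<bar>v x\<bar> powr p)"
proof -
  have v: "integrable (lebesgue_on {0<..<T}) v"
    using Lp_on_imp_integrable[OF p] w by (simp add: W1p_periodic_def)
  have vi: "v integrable_on {0..T}" and vpi: "(\<lambda>x. \<bar>v x\<bar> powr p) integrable_on {0..T}"
    using has_integral_LINT_open[OF v] has_integral_LINT_open[of 0 T "\<lambda>x. \<bar>v x\<bar> powr p"] w
    by (auto simp: W1p_periodic_def Lp_on_def)
  have "(\<Sum>i<k. T / real N * \<bar>(u (node T N (Suc i)) - u (node T N i)) / (T / real N)\<bar> powr p)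
    \<le> integral {0..node T N k} (\<lambda>x. \<bar>v x\<bar> powr p)" if "k \<le> N" for k
    using that
  proof (induction k)
    case (Suc k)
    define a b where "a = node T N k" and "b = node T N (Suc k)"
    have ab: "0 \<le> a" "a < b" "b \<le> T" "b - a = T / real N"
      using node_mem[OF T, of k N] node_mem[OF T, of "Suc k" N] Suc.prems T N
      by (auto simp: a_def b_def node_Suc)
    have "u b - u a = integral {a..b} v"
      using w ab by (intro weak_derivative_FTC[OF T v]) (auto simp: W1p_periodic_def)
    then have "T / real N * \<bar>(u b - u a) / (T / real N)\<bar> powr p \<le> integral {a..b} (\<lambda>x. \<bar>v x\<bar> powr p)"
      using integral_powr_ge_mean[OF p ab(2), of v] integrable_on_subinterval[OF vi, of a b]
        integrable_on_subinterval[OF vpi, of a b] ab(1,3) ab(4)[symmetric] by simp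
    moreover have "integral {0..a} (\<lambda>x. \<bar>v x\<bar> powr p) + integral {a..b} (\<lambda>x. \<bar>v x\<bar> powr p)
        = integral {0..b} (\<lambda>x. \<bar>v x\<bar> powr p)"
      using ab by (intro Henstock_Kurzweil_Integration.integral_combine integrable_on_subinterval[OF vpi]) auto
    ultimately show ?case
      using Suc by (simp add: a_def b_def)
  qed simp
  from this[of N] show ?thesis using N by simp
qed

lemma energy_eq_integral:
  assumes p: "p > 1" and q: "continuous_on {0..T} q" and w: "W1p_periodic p T u v"
  shows "energy p T q u v = integral {0..T} (\<lambda>x. \<bar>v x\<bar> powr p) + integral {0..T} (\<lambda>x. q x * \<bar>u x\<bar> powr p)"
proof -
  have u: "continuous_on {0..T} u" using w by (simp add: W1p_periodic_def)
  have i: "integrable (lebesgue_on {0<..<T}) (\<lambda>x. \<bar>v x\<bar> powr p)"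
      "integrable (lebesgue_on {0<..<T}) (\<lambda>x. q x * \<bar>u x\<bar> powr p)"
    using w p by (auto simp: W1p_periodic_def Lp_on_def
        intro!: continuous_integrable_open continuous_intros continuous_on_powr' q u)
  show ?thesis
    unfolding energy_def Bochner_Integration.integral_add[OF i] LINT_open_eq_integral[OF i(1)]
      LINT_open_eq_integral[OF i(2)] ..
qed

lemma C1_imp_W1p_periodic:
  assumes T: "T > 0" and p: "p > 1"
    and d: "\<And>x. x \<in> {0..T} \<Longrightarrow> (u has_real_derivative v x) (at x within {0..T})"
    and v: "continuous_on {0..T} v" and per: "u 0 = u T"
  shows "W1p_periodic p T u v"
proof -
  have u: "continuous_on {0..T} u" by (rule DERIV_continuous_on[OF d])
  have Lp: "Lp_on p T g" if "continuous_on {0..T} g" for g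
    unfolding Lp_on_def using p that
    by (intro conjI borel_measurable_integrable continuous_integrable_open continuous_intros continuous_on_powr') auto
  have "weak_derivative T u v"
    unfolding weak_derivative_def
  proof (intro allI impI)
    fix h h' assume "test_function T h h'"
    then have h: "\<And>x. (h has_real_derivative h' x) (at x)" "continuous_on UNIV h'"
        "closure {x. h x \<noteq> 0} \<subseteq> {0<..<T}"
      by (auto simp: test_function_def)
    have h0: "h 0 = 0" "h T = 0"
      using h(3) closure_subset[of "{x. h x \<noteq> 0}"] by force+
    have hc: "continuous_on {0..T} h" "continuous_on {0..T} h'"
      using h(1,2) by (meson DERIV_isCont continuous_at_imp_continuous_on continuous_on_subset subset_UNIV)+
    have "((\<lambda>x. v x * h x + u x * h' x) has_integral (u T * h T - u 0 * h 0)) {0..T}"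
    proof (rule fundamental_theorem_of_calculus)
      fix x assume x: "x \<in> {0..T}"
      have "((\<lambda>x. u x * h x) has_real_derivative v x * h x + u x * h' x) (at x within {0..T})"
        using DERIV_mult[OF d[OF x] has_field_derivative_at_within[OF h(1)]] by (simp add: add.commute mult.commute)
      then show "((\<lambda>x. u x * h x) has_vector_derivative v x * h x + u x * h' x) (at x within {0..T})"
        by (simp add: has_real_derivative_iff_has_vector_derivative)
    qed (use T in simp)
    then have "integral {0..T} (\<lambda>x. v x * h x + u x * h' x) = 0"
      using h0 by (simp add: integral_unique)
    moreover have "integral {0..T} (\<lambda>x. v x * h x + u x * h' x)
        = integral {0..T} (\<lambda>x. v x * h x) + integral {0..T} (\<lambda>x. u x * h' x)"
      by (intro Henstock_Kurzweil_Integration.integral_add integrable_continuous_real continuous_intros u v hc)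
    moreover have "(LINT x|lebesgue_on {0<..<T}. v x * h x) = integral {0..T} (\<lambda>x. v x * h x)"
        "(LINT x|lebesgue_on {0<..<T}. u x * h' x) = integral {0..T} (\<lambda>x. u x * h' x)"
      by (intro LINT_open_eq_integral continuous_integrable_open continuous_intros u v hc)+
    ultimately show "(LINT x|lebesgue_on {0<..<T}. u x * h' x) = - (LINT x|lebesgue_on {0<..<T}. v x * h x)"
      by simp
  qed
  then show ?thesis
    unfolding W1p_periodic_def using u v per Lp by blast
qed

text \<open>A C^1 bump on an interval where \<open>m\<close> is positive. It makes the constraint of
  the eigenvalue problem satisfiable and, once sampled, that of its discrete versions.\<close>

lemma W1p_periodic_positive_weight_exists:
  assumes T: "T > 0" and p: "p > 1" and m: "continuous_on {0..T} m" and pos: "\<exists>x\<in>{0..T}. m x > 0"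
  obtains u v where "W1p_periodic p T u v" "integral {0..T} (\<lambda>x. m x * \<bar>u x\<bar> powr p) > 0"
proof -
  obtain c where c: "c \<in> {0..T}" "m c > 0" using pos by blast
  obtain d where d: "d > 0" "\<And>x. x \<in> {0..T} \<Longrightarrow> \<bar>x - c\<bar> < d \<Longrightarrow> \<bar>m x - m c\<bar> < m c"
    using m c unfolding continuous_on_iff dist_real_def by metis
  define a b where "a = max 0 (c - d / 2)" and "b = min T (c + d / 2)"
  have ab: "0 \<le> a" "a < b" "b \<le> T" using c d T by (auto simp: a_def b_def)
  have m_pos: "m x > 0" if "x \<in> {a..b}" for x
    using d(2)[of x] that d(1) ab by (auto simp: a_def b_def abs_less_iff)
  define u where "u x = pos_sq (x - a) * pos_sq (b - x)" for x
  define v where "v x = max 0 (x - a) * pos_sq (b - x) - pos_sq (x - a) * max 0 (b - x)" for x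
  have du: "(u has_real_derivative v x) (at x within S)" for x S
    unfolding u_def v_def by (auto intro!: derivative_eq_intros)
  have pos_cont: "continuous_on S (\<lambda>x. pos_sq (g x))" if "continuous_on S g" for S g
    unfolding pos_sq_def by (intro continuous_intros that) auto
  have "continuous_on {0..T} v"
    unfolding v_def by (intro continuous_intros pos_cont)
  then have w: "W1p_periodic p T u v"
    using du ab by (intro C1_imp_W1p_periodic[OF T p]) (auto simp: u_def pos_sq_def max_def)
  have u_cont: "continuous_on {0..T} u"
    unfolding u_def by (intro continuous_intros pos_cont)
  have u0: "u x = 0" if "x \<notin> {a..b}" for x
    using that by (auto simp: u_def pos_sq_def max_def)
  have nn: "m x * \<bar>u x\<bar> powr p \<ge> 0" for x
    using m_pos[of x] u0[of x] by (cases "x \<in> {a..b}") auto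
  have cont: "continuous_on {0..T} (\<lambda>x. m x * \<bar>u x\<bar> powr p)"
    using p by (intro continuous_intros continuous_on_powr' m u_cont) auto
  have mid: "(a + b) / 2 \<in> {0..T}" "(a + b) / 2 \<in> {a..b}" using ab by auto
  have "u ((a + b) / 2) > 0"
    using ab by (simp add: u_def pos_sq_def field_simps)
  then have "m ((a + b) / 2) * \<bar>u ((a + b) / 2)\<bar> powr p \<noteq> 0"
    using m_pos[OF mid(2)] by simp
  then have "integral {0..T} (\<lambda>x. m x * \<bar>u x\<bar> powr p) \<noteq> 0"
    using integral_eq_0_iff[OF cont T] nn mid(1) by blast
  moreover have "integral {0..T} (\<lambda>x. m x * \<bar>u x\<bar> powr p) \<ge> 0"
    using nn by (intro Henstock_Kurzweil_Integration.integral_nonneg integrable_continuous_real cont)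
  ultimately show thesis using that[OF w] by simp
qed

subsection \<open>Discrete variational problems\<close>

lemma DERIV_abs_powr_div:
  assumes "p > 1"
  shows "((\<lambda>s. \<bar>s\<bar> powr p / p) has_real_derivative phi_p p s) (at s)"
  using DERIV_cdivide[OF DERIV_abs_powr[OF assms], of p s] assms by simp

text \<open>Periodicity is not built in: competitors are restricted by \<open>u N = u 0\<close>. The
  potential term is the same sum as in \<open>dweight\<close>, with weight \<open>q\<close>.\<close>

definition denergy :: "real \<Rightarrow> real \<Rightarrow> (real \<Rightarrow> real) \<Rightarrow> nat \<Rightarrow> (nat \<Rightarrow> real) \<Rightarrow> real" where
  "denergy p T q N u = (\<Sum>i<N. T / real N * \<bar>(u (Suc i) - u i) / (T / real N)\<bar> powr p)
     + (\<Sum>i<N. T / real N * (q (node T N i) * \<bar>u i\<bar> powr p))"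

definition dweight :: "real \<Rightarrow> real \<Rightarrow> (real \<Rightarrow> real) \<Rightarrow> nat \<Rightarrow> (nat \<Rightarrow> real) \<Rightarrow> real" where
  "dweight p T m N u = (\<Sum>i<N. T / real N * (m (node T N i) * \<bar>u i\<bar> powr p))"

lemma denergy_scale: "denergy p T q N (\<lambda>i. s * u i) = \<bar>s\<bar> powr p * denergy p T q N u"
proof -
  have "\<bar>(s * u (Suc i) - s * u i) / (T / real N)\<bar> powr p
      = \<bar>s\<bar> powr p * \<bar>(u (Suc i) - u i) / (T / real N)\<bar> powr p" for i
    by (simp add: right_diff_distrib[symmetric] abs_mult powr_mult times_divide_eq_right[symmetric]
        del: times_divide_eq_right)
  then show ?thesis
    unfolding denergy_def
    by (simp add: sum_distrib_left distrib_left abs_mult powr_mult mult.left_commute del: times_divide_eq_left)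
qed

lemma dweight_scale: "dweight p T m N (\<lambda>i. s * u i) = \<bar>s\<bar> powr p * dweight p T m N u"
  unfolding dweight_def
  by (simp add: sum_distrib_left abs_mult powr_mult mult.left_commute del: times_divide_eq_left)

lemma denergy_cong: "(\<And>i. i \<le> N \<Longrightarrow> u i = v i) \<Longrightarrow> denergy p T q N u = denergy p T q N v"
  unfolding denergy_def by simp

lemma dweight_cong: "(\<And>i. i \<le> N \<Longrightarrow> u i = v i) \<Longrightarrow> dweight p T m N u = dweight p T m N v"
  unfolding dweight_def by simp

lemma denergy_nonneg:
  assumes "T > 0" "\<And>x. x \<in> {0..T} \<Longrightarrow> q x \<ge> 0"
  shows "denergy p T q N u \<ge> 0"
  unfolding denergy_def
  using assms node_mem[OF assms(1)] by (intro add_nonneg_nonneg sum_nonneg) auto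

text \<open>The reverse triangle inequality, applied to each difference quotient. It allows
  minimisers of the action to be taken nonnegative.\<close>

lemma denergy_abs_le:
  assumes "T > 0" "p > 1"
  shows "denergy p T q N (\<lambda>i. \<bar>u i\<bar>) \<le> denergy p T q N u"
proof -
  have "T / real N * \<bar>(\<bar>u (Suc i)\<bar> - \<bar>u i\<bar>) / (T / real N)\<bar> powr p
      \<le> T / real N * \<bar>(u (Suc i) - u i) / (T / real N)\<bar> powr p" for i
    using assms abs_triangle_ineq3[of "u (Suc i)" "u i"]
    by (intro mult_left_mono powr_mono2) (auto simp: abs_mult intro!: divide_right_mono mult_right_mono)
  then have "(\<Sum>i<N. T / real N * \<bar>(\<bar>u (Suc i)\<bar> - \<bar>u i\<bar>) / (T / real N)\<bar> powr p)
      \<le> (\<Sum>i<N. T / real N * \<bar>(u (Suc i) - u i) / (T / real N)\<bar> powr p)"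
    by (rule sum_mono)
  then show ?thesis
    unfolding denergy_def abs_idempotent by (rule add_right_mono)
qed

lemma continuous_on_coordinate: "continuous_on S (\<lambda>u :: nat \<Rightarrow> real. u i)"
  by (rule continuous_on_subset[OF continuous_on_product_coordinates]) simp

lemma continuous_on_abs_powr:
  fixes g :: "'a :: topological_space \<Rightarrow> real"
  assumes "p > 1" "continuous_on S g"
  shows "continuous_on S (\<lambda>x. \<bar>g x\<bar> powr p)"
  using assms by (intro continuous_on_powr' continuous_on_rabs continuous_on_const) auto

lemma continuous_on_denergy:
  assumes "p > 1"
  shows "continuous_on S (\<lambda>u. denergy p T q N u)"
  unfolding denergy_def divide_inverse
  by (intro continuous_on_add continuous_on_sum continuous_on_mult continuous_on_const
      continuous_on_abs_powr[OF assms] continuous_on_diff continuous_on_coordinate)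

lemma continuous_on_dweight:
  assumes "p > 1"
  shows "continuous_on S (\<lambda>u. dweight p T m N u)"
  unfolding dweight_def
  by (intro continuous_on_sum continuous_on_mult continuous_on_const
      continuous_on_abs_powr[OF assms] continuous_on_coordinate)

lemma abs_diff_le_sum:
  fixes u :: "nat \<Rightarrow> real"
  assumes "i \<le> N" "j \<le> N"
  shows "\<bar>u i - u j\<bar> \<le> (\<Sum>k<N. \<bar>u (Suc k) - u k\<bar>)"
proof -
  have *: "\<bar>u j - u i\<bar> \<le> (\<Sum>k<N. \<bar>u (Suc k) - u k\<bar>)" if "i \<le> j" "j \<le> N" for i j
  proof -
    have "\<bar>u j - u i\<bar> = \<bar>\<Sum>k=i..<j. u (Suc k) - u k\<bar>"
      using that by (simp add: sum_Suc_diff')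
    also have "\<dots> \<le> (\<Sum>k=i..<j. \<bar>u (Suc k) - u k\<bar>)" by (rule sum_abs)
    also have "\<dots> \<le> (\<Sum>k<N. \<bar>u (Suc k) - u k\<bar>)"
      using that by (intro sum_mono2) auto
    finally show ?thesis .
  qed
  show ?thesis
    using *[of i j] *[of j i] assms by (cases "i \<le> j") (auto simp: abs_minus_commute)
qed

text \<open>A dichotomy on the total variation \<open>V\<close>. If \<open>V\<close> is at least
  half of \<open>\<bar>u j\<bar>\<close>, Jensen's inequality bounds the gradient term from below;
  otherwise every value has at least half the size of \<open>u j\<close>, and the potential term is
  at least \<open>Q\<close> times the power of that half. The minimum combines the two
  constants.\<close>

lemma denergy_coercive:
  assumes T: "T > 0" and p: "p > 1" and N: "N > 0" and q: "\<And>x. x \<in> {0..T} \<Longrightarrow> q x \<ge> 0"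
    and Q: "(\<Sum>i<N. T / real N * q (node T N i)) \<ge> Q" and j: "j \<le> N"
  shows "min (T / (2 * T) powr p) (Q / 2 powr p) * \<bar>u j\<bar> powr p \<le> denergy p T q N u"
proof -
  define h where "h = T / real N"
  have h: "h > 0" using T N by (simp add: h_def)
  define V where "V = (\<Sum>k<N. \<bar>u (Suc k) - u k\<bar>)"
  have V_eq: "V = (\<Sum>k<N. h * \<bar>(u (Suc k) - u k) / h\<bar>)"
    unfolding V_def using h by (intro sum.cong) (auto simp: abs_divide)
  have qi: "q (node T N i) \<ge> 0" if "i < N" for i
    using q node_mem[OF T] that by simp
  have s1: "0 \<le> (\<Sum>i<N. h * (q (node T N i) * \<bar>u i\<bar> powr p))"
    using h qi by (intro sum_nonneg) auto
  have s2: "T * (V / T) powr p \<le> (\<Sum>i<N. h * \<bar>(u (Suc i) - u i) / h\<bar> powr p)"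
    unfolding V_eq using h N T by (intro sum_abs_powr_ge p) (auto simp: h_def)
  have s3: "0 \<le> (\<Sum>i<N. h * \<bar>(u (Suc i) - u i) / h\<bar> powr p)"
    using h by (intro sum_nonneg) auto
  show ?thesis
  proof (cases "V \<ge> \<bar>u j\<bar> / 2")
    case True
    have "min (T / (2 * T) powr p) (Q / 2 powr p) * \<bar>u j\<bar> powr p \<le> T / (2 * T) powr p * \<bar>u j\<bar> powr p"
      by (intro mult_right_mono) auto
    also have "\<dots> = T * ((\<bar>u j\<bar> / 2) / T) powr p"
      using T by (simp add: powr_divide powr_mult)
    also have "\<dots> \<le> T * (V / T) powr p"
      using True T p by (intro mult_left_mono powr_mono2 divide_right_mono) auto
    finally show ?thesis
      using s1 s2 unfolding denergy_def h_def[symmetric] by linarith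
  next
    case False
    have ui: "\<bar>u i\<bar> \<ge> \<bar>u j\<bar> / 2" if "i < N" for i
      using abs_diff_le_sum[of i N j u] that j False unfolding V_def by linarith
    have "min (T / (2 * T) powr p) (Q / 2 powr p) * \<bar>u j\<bar> powr p \<le> Q / 2 powr p * \<bar>u j\<bar> powr p"
      by (intro mult_right_mono) auto
    also have "\<dots> = Q * (\<bar>u j\<bar> / 2) powr p"
      by (simp add: powr_divide)
    also have "\<dots> \<le> (\<Sum>i<N. h * q (node T N i)) * (\<bar>u j\<bar> / 2) powr p"
      using Q by (intro mult_right_mono) (auto simp: h_def)
    also have "\<dots> = (\<Sum>i<N. h * (q (node T N i) * (\<bar>u j\<bar> / 2) powr p))"
      by (simp add: sum_distrib_right mult.assoc)
    also have "\<dots> \<le> (\<Sum>i<N. h * (q (node T N i) * \<bar>u i\<bar> powr p))"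
      using h qi ui p by (intro sum_mono mult_left_mono powr_mono2) auto
    finally show ?thesis
      using s3 unfolding denergy_def h_def[symmetric] by linarith
  qed
qed

text \<open>The flux variable \<open>dflux\<close> is shifted by one index against the difference quotients, so that
  the Euler-Lagrange equation at the grid point \<open>0\<close>, which is identified with the grid point \<open>N\<close>,
  only evaluates the coefficients at \<open>0\<close>: these need not be periodic.\<close>

definition dflux :: "real \<Rightarrow> real \<Rightarrow> nat \<Rightarrow> (nat \<Rightarrow> real) \<Rightarrow> nat \<Rightarrow> real" where
  "dflux p h N u i = phi_p p ((if i = 0 then u N - u (N - 1) else u i - u (i - 1)) / h)"

text \<open>The general \<open>G\<close> covers both the eigenvalue problem and the action.
  Minimality is asked only for small \<open>t\<close> along each periodic direction, because in the
  eigenvalue problem a perturbation is admissible only while its weight stays positive.\<close>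

lemma discrete_euler_lagrange:
  fixes u :: "nat \<Rightarrow> real" and G :: "nat \<Rightarrow> real \<Rightarrow> real"
  assumes p: "p > 1" and h: "h > 0" and N: "N > 0"
    and G: "\<And>i. i < N \<Longrightarrow> (G i has_real_derivative g i) (at (u i))"
    and min: "\<And>w. w N = w 0 \<Longrightarrow> \<forall>\<^sub>F t in at 0.
      (\<Sum>i<N. h * (\<bar>(u (Suc i) - u i) / h\<bar> powr p / p + G i (u i))) \<le>
      (\<Sum>i<N. h * (\<bar>((u (Suc i) + t * w (Suc i)) - (u i + t * w i)) / h\<bar> powr p / p + G i (u i + t * w i)))"
    and i: "i < N"
  shows "dflux p h N u (Suc i) - dflux p h N u i = h * g i"
proof -
  \<comment> \<open>\<open>w\<close> is the unit vector of grid point \<open>i\<close>, repeated at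
    \<open>N\<close> when \<open>i = 0\<close> to remain periodic; \<open>pr\<close> is the cell to
    the left of that point in cyclic order.\<close>
  define w :: "nat \<Rightarrow> real" where "w k = of_bool (k = i \<or> i = 0 \<and> k = N)" for k
  define pr where "pr = (if i = 0 then N - 1 else i - 1)"
  define e where "e k = (u (Suc k) - u k) / h" for k
  define J where "J t = (\<Sum>k<N. h * (\<bar>((u (Suc k) + t * w (Suc k)) - (u k + t * w k)) / h\<bar> powr p / p
      + G k (u k + t * w k)))" for t
  have "pr < N" using i by (auto simp: pr_def)
  have "h \<noteq> 0" using h by simp
  have "w N = w 0" using i by (auto simp: w_def)
  have wk: "w k = of_bool (k = i)" "w (Suc k) = of_bool (k = pr)" if "k < N" for k
    using that i by (auto simp: w_def pr_def)
  have dJ: "(J has_real_derivative (\<Sum>k<N. h * (phi_p p (e k) * ((w (Suc k) - w k) / h) + g k * w k))) (at 0)"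
    unfolding J_def
  proof (intro DERIV_sum DERIV_cmult DERIV_add)
    fix k assume k: "k \<in> {..<N}"
    have "((\<lambda>t. ((u (Suc k) + t * w (Suc k)) - (u k + t * w k)) / h) has_real_derivative (w (Suc k) - w k) / h) (at 0)"
      using \<open>h \<noteq> 0\<close> by (auto intro!: derivative_eq_intros)
    moreover have "((\<lambda>s. \<bar>s\<bar> powr p / p) has_real_derivative phi_p p (e k)) (at (e k))"
      by (rule DERIV_abs_powr_div[OF p])
    ultimately show "((\<lambda>t. \<bar>((u (Suc k) + t * w (Suc k)) - (u k + t * w k)) / h\<bar> powr p / p)
        has_real_derivative phi_p p (e k) * ((w (Suc k) - w k) / h)) (at 0)"
      using DERIV_chain2[of "\<lambda>s. \<bar>s\<bar> powr p / p" "phi_p p (e k)"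
          "\<lambda>t. ((u (Suc k) + t * w (Suc k)) - (u k + t * w k)) / h" 0 "(w (Suc k) - w k) / h" UNIV]
      by (simp add: e_def)
    have "((\<lambda>t. u k + t * w k) has_real_derivative w k) (at 0)"
      by (auto intro!: derivative_eq_intros)
    then show "((\<lambda>t. G k (u k + t * w k)) has_real_derivative g k * w k) (at 0)"
      using DERIV_chain2[of "G k" "g k" "\<lambda>t. u k + t * w k" 0 "w k" UNIV] G k by simp
  qed
  have "\<forall>\<^sub>F t in at 0. J 0 \<le> J t"
    unfolding J_def using min[OF \<open>w N = w 0\<close>] by simp
  then obtain d where d: "d > 0" "\<And>t. t \<noteq> 0 \<Longrightarrow> \<bar>t\<bar> < d \<Longrightarrow> J 0 \<le> J t"
    unfolding eventually_at by auto
  have "\<forall>t. \<bar>0 - t\<bar> < d \<longrightarrow> J 0 \<le> J t"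
    using d(2) by (metis abs_minus_commute diff_zero order_refl)
  then have "(\<Sum>k<N. h * (phi_p p (e k) * ((w (Suc k) - w k) / h) + g k * w k)) = 0"
    using DERIV_local_min[OF dJ d(1)] by blast
  moreover have "(\<Sum>k<N. h * (phi_p p (e k) * ((w (Suc k) - w k) / h) + g k * w k))
      = (\<Sum>k<N. (if k = pr then phi_p p (e k) else 0) - (if k = i then phi_p p (e k) else 0)
          + (if k = i then h * g k else 0))"
    using wk \<open>h \<noteq> 0\<close> by (intro sum.cong) (auto simp: field_simps)
  moreover have "\<dots> = phi_p p (e pr) - phi_p p (e i) + h * g i"
    using i \<open>pr < N\<close> by (simp add: sum.distrib sum_subtractf)
  moreover have "dflux p h N u (Suc i) = phi_p p (e i)"
    by (simp add: dflux_def e_def)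
  moreover have "dflux p h N u i = phi_p p (e pr)"
    using N by (simp add: dflux_def e_def pr_def)
  ultimately show ?thesis by simp
qed

lemma dflux_step:
  assumes "p > 1" "h > 0"
  shows "u (Suc i) - u i = h * phi_p (p / (p - 1)) (dflux p h N u (Suc i))"
  using assms by (simp add: dflux_def phi_p_inverse')

lemma dflux_periodic:
  assumes "u N = u 0" "N > 0"
  shows "dflux p h N u N = dflux p h N u 0"
  using assms by (simp add: dflux_def)

text \<open>Tychonoff over all of \<open>nat\<close>: the coordinates beyond \<open>N\<close> are
  bounded as well, so competitors are cut off to 0 there before they are compared.\<close>

lemma compact_periodic_box:
  "compact {u :: nat \<Rightarrow> real. (\<forall>i. \<bar>u i\<bar> \<le> R) \<and> u N = u 0}"
proof -
  have "compactin (product_topology (\<lambda>i. euclidean) UNIV) (PiE UNIV (\<lambda>i::nat. {-R..R}))"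
    by (simp add: compactin_PiE)
  then have "compact (PiE UNIV (\<lambda>i::nat. {-R..R}))"
    by (simp add: euclidean_product_topology)
  moreover have "closed {u :: nat \<Rightarrow> real. u N = u 0}"
    by (intro closed_Collect_eq continuous_on_coordinate)
  ultimately have "compact (PiE UNIV (\<lambda>i::nat. {-R..R}) \<inter> {u. u N = u 0})"
    by (rule compact_Int_closed)
  moreover have "PiE UNIV (\<lambda>i::nat. {-R..R}) \<inter> {u. u N = u 0} = {u. (\<forall>i. \<bar>u i\<bar> \<le> R) \<and> u N = u 0}"
    by (auto simp: PiE_def Pi_def abs_le_iff minus_le_iff)
  ultimately show ?thesis by simp
qed

text \<open>Energy and weight are both homogeneous of degree \<open>p\<close>, so the constraint can
  be scaled away. The resulting Rayleigh inequality also compares with grid functions whose weight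
  is not 1, such as perturbations of \<open>u\<close> and samples of Sobolev functions.\<close>

lemma discrete_constrained_minimizer:
  assumes T: "T > 0" and p: "p > 1" and N: "N > 0" and c: "c > 0"
    and coerc: "\<And>u j. j \<le> N \<Longrightarrow> c * \<bar>u j\<bar> powr p \<le> denergy p T q N u"
    and w: "w N = w 0" "dweight p T m N w > 0"
  obtains u where "u N = u 0" "dweight p T m N u = 1"
    "\<And>z. z N = z 0 \<Longrightarrow> dweight p T m N z > 0 \<Longrightarrow> denergy p T q N u * dweight p T m N z \<le> denergy p T q N z"
proof -
  let ?E = "denergy p T q N" and ?M = "dweight p T m N"
  have normalize: "?M (\<lambda>i. (1 / ?M z) powr (1 / p) * z i) = 1"
      "?E (\<lambda>i. (1 / ?M z) powr (1 / p) * z i) = ?E z / ?M z" if "?M z > 0" for z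
    using that p by (simp_all add: dweight_scale denergy_scale powr_powr)
  define w1 where "w1 = (\<lambda>i. (1 / ?M w) powr (1 / p) * w i)"
  have w1: "w1 N = w1 0" "?M w1 = 1"
    using w normalize(1)[OF w(2)] by (auto simp: w1_def)
  \<comment> \<open>Coercivity puts every grid function with energy at most that of
    \<open>w1\<close> into the box of radius \<open>R\<close>.\<close>
  define R where "R = (?E w1 / c) powr (1 / p)"
  have "c * \<bar>w1 0\<bar> powr p \<le> ?E w1" using coerc by blast
  then have E1: "?E w1 \<ge> 0"
    using c by (meson abs_ge_zero less_imp_le mult_nonneg_nonneg order_trans powr_ge_zero)
  have Rp: "c * R powr p = ?E w1"
    using p c E1 by (simp add: R_def powr_powr)
  have in_box: "\<bar>z j\<bar> \<le> R" if "?E z \<le> ?E w1" "j \<le> N" for z j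
  proof (rule ccontr)
    assume "\<not> ?thesis"
    then have "R powr p < \<bar>z j\<bar> powr p"
      using p by (intro powr_less_mono2) (auto simp: R_def)
    then have "c * R powr p < c * \<bar>z j\<bar> powr p" using c by simp
    then show False using coerc[OF that(2), of z] that(1) Rp by linarith
  qed
  define K where "K = {u. (\<forall>i. \<bar>u i\<bar> \<le> R) \<and> u N = u 0} \<inter> {u. ?M u = 1}"
  have "compact K"
    unfolding K_def using p
    by (intro compact_Int_closed compact_periodic_box closed_Collect_eq continuous_on_dweight continuous_on_const)
  define tr :: "(nat \<Rightarrow> real) \<Rightarrow> nat \<Rightarrow> real" where "tr z = (\<lambda>i. if i \<le> N then z i else 0)" for z
  have tr: "tr z \<in> K" "?E (tr z) = ?E z" if "z N = z 0" "?M z = 1" "?E z \<le> ?E w1" for z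
  proof -
    have "?M (tr z) = ?M z" by (intro dweight_cong) (simp add: tr_def)
    moreover have "\<bar>tr z i\<bar> \<le> R" for i
      using in_box[OF that(3), of i] by (auto simp: tr_def R_def)
    ultimately show "tr z \<in> K"
      using that by (simp add: K_def tr_def)
    show "?E (tr z) = ?E z" by (intro denergy_cong) (simp add: tr_def)
  qed
  have "K \<noteq> {}" using tr(1)[of w1] w1 by auto
  then obtain u where u: "u \<in> K" "\<And>z. z \<in> K \<Longrightarrow> ?E u \<le> ?E z"
    using continuous_attains_inf[OF \<open>compact K\<close> _ continuous_on_denergy[OF p]] by blast
  have min1: "?E u \<le> ?E z" if "z N = z 0" "?M z = 1" for z
  proof (cases "?E z \<le> ?E w1")
    case True
    then show ?thesis using u(2)[OF tr(1)[OF that True]] tr(2)[OF that True] by simp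
  next
    case False
    then show ?thesis using u(2)[OF tr(1)[OF w1 order_refl]] tr(2)[OF w1 order_refl] by simp
  qed
  show thesis
  proof
    show "u N = u 0" "?M u = 1" using u(1) by (auto simp: K_def)
    fix z assume z: "z N = z 0" "?M z > 0"
    have "?E u \<le> ?E z / ?M z"
      using min1[of "\<lambda>i. (1 / ?M z) powr (1 / p) * z i"] normalize[OF z(2)] z(1) by simp
    then show "?E u * ?M z \<le> ?E z" using z(2) by (simp add: field_simps)
  qed
qed

text \<open>With L the minimal energy, energy minus L times weight is nonnegative wherever the
  weight is positive, and 0 at \<open>u\<close>. So \<open>u\<close> is an unconstrained local
  minimiser of this difference, and the multiplier is L without any Lagrange rule.\<close>

lemma discrete_eigen_equation:
  assumes T: "T > 0" and p: "p > 1" and N: "N > 0"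
    and u: "dweight p T m N u = 1"
    and min: "\<And>z. z N = z 0 \<Longrightarrow> dweight p T m N z > 0 \<Longrightarrow>
      denergy p T q N u * dweight p T m N z \<le> denergy p T q N z"
    and per: "u N = u 0" and i: "i < N"
  shows "dflux p (T / real N) N u (Suc i) - dflux p (T / real N) N u i = T / real N *
    (q (node T N i) * phi_p p (u i) - denergy p T q N u * m (node T N i) * phi_p p (u i))"
proof -
  define L where "L = denergy p T q N u"
  define G where "G i s = (q (node T N i) - L * m (node T N i)) * (\<bar>s\<bar> powr p / p)" for i s
  have J: "(\<Sum>i<N. T / real N * (\<bar>(z (Suc i) - z i) / (T / real N)\<bar> powr p / p + G i (z i)))
      = (denergy p T q N z - L * dweight p T m N z) / p" for z
    unfolding denergy_def dweight_def G_def
    by (simp add: sum_distrib_left sum.distrib[symmetric] sum_subtractf[symmetric] sum_divide_distrib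
        del: times_divide_eq_left)
      (intro sum.cong refl, simp add: algebra_simps add_divide_distrib diff_divide_distrib)
  have "dflux p (T / real N) N u (Suc i) - dflux p (T / real N) N u i
      = T / real N * ((q (node T N i) - L * m (node T N i)) * phi_p p (u i))"
  proof (rule discrete_euler_lagrange[OF p _ N, where G = G])
    show "T / real N > 0" using T N by simp
    show "(G i has_real_derivative (q (node T N i) - L * m (node T N i)) * phi_p p (u i)) (at (u i))" for i
      unfolding G_def by (intro DERIV_cmult DERIV_abs_powr_div p)
    fix w :: "nat \<Rightarrow> real" assume w: "w N = w 0"
    have "((\<lambda>t. dweight p T m N (\<lambda>i. u i + t * w i)) \<longlongrightarrow> dweight p T m N (\<lambda>i. u i + 0 * w i)) (at 0)"
    proof -
      have "isCont (\<lambda>t. dweight p T m N (\<lambda>i. u i + t * w i)) 0"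
      proof -
        have "continuous_on UNIV (\<lambda>t. dweight p T m N (\<lambda>i. u i + t * w i))"
          unfolding dweight_def
          by (intro continuous_on_sum continuous_on_add continuous_on_mult continuous_on_const
              continuous_on_abs_powr[OF p] continuous_on_id)
        then show ?thesis by (simp add: continuous_on_eq_continuous_at)
      qed
      then show ?thesis by (simp add: isCont_def)
    qed
    then have "\<forall>\<^sub>F t in at 0. dweight p T m N (\<lambda>i. u i + t * w i) > 0"
      using u by (intro order_tendstoD(1)) auto
    then show "\<forall>\<^sub>F t in at 0.
      (\<Sum>i<N. T / real N * (\<bar>(u (Suc i) - u i) / (T / real N)\<bar> powr p / p + G i (u i))) \<le>
      (\<Sum>i<N. T / real N * (\<bar>((u (Suc i) + t * w (Suc i)) - (u i + t * w i)) / (T / real N)\<bar> powr p / p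
        + G i (u i + t * w i)))"
    proof eventually_elim
      case (elim t)
      have "L * dweight p T m N (\<lambda>i. u i + t * w i) \<le> denergy p T q N (\<lambda>i. u i + t * w i)"
        unfolding L_def using min[OF _ elim] per w by simp
      then show ?case
        using J[of u] J[of "\<lambda>i. u i + t * w i"] u p by (simp add: L_def[symmetric] del: times_divide_eq_left)
    qed
  qed (rule i)
  then show ?thesis by (simp add: L_def algebra_simps del: times_divide_eq_left)
qed

definition daction :: "real \<Rightarrow> real \<Rightarrow> (real \<Rightarrow> real) \<Rightarrow> (real \<Rightarrow> real) \<Rightarrow> (real \<Rightarrow> real) \<Rightarrow> nat \<Rightarrow> (nat \<Rightarrow> real) \<Rightarrow> real" where
  "daction p T q m F N u = denergy p T q N u / p - (\<Sum>i<N. T / real N * (m (node T N i) * F (u i)))"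

text \<open>Let \<open>k\<close> be the index of the largest modulus. Coercivity provides c/p times
  \<open>\<bar>u k\<bar> powr p\<close>, and the growth bound on \<open>F\<close> uses up half of
  that; the other half is at most \<open>C\<close>.\<close>

lemma daction_nonpos_imp_bounded:
  assumes T: "T > 0" and p: "p > 1" and N: "N > 0"
    and coerc: "\<And>j. j \<le> N \<Longrightarrow> c * \<bar>u j\<bar> powr p \<le> denergy p T q N u"
    and m: "\<And>x. x \<in> {0..T} \<Longrightarrow> \<bar>m x\<bar> \<le> K"
    and F: "\<And>s. K * T * \<bar>F s\<bar> \<le> c / (2 * p) * \<bar>s\<bar> powr p + C" and c: "c > 0"
    and le: "daction p T q m F N u \<le> 0" and j: "j \<le> N"
  shows "\<bar>u j\<bar> \<le> (2 * p * C / c) powr (1 / p)"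
proof -
  obtain k where k: "k \<le> N" "\<And>i. i \<le> N \<Longrightarrow> \<bar>u i\<bar> \<le> \<bar>u k\<bar>"
  proof -
    have "Max ((\<lambda>i. \<bar>u i\<bar>) ` {..N}) \<in> (\<lambda>i. \<bar>u i\<bar>) ` {..N}"
      by (intro Max_in) auto
    then obtain k where "k \<le> N" "Max ((\<lambda>i. \<bar>u i\<bar>) ` {..N}) = \<bar>u k\<bar>"
      by (metis (no_types, lifting) imageE atMost_iff)
    then show thesis using that[of k] by (metis (no_types, lifting) Max_ge atMost_iff finite_atMost finite_imageI imageI)
  qed
  have "m (node T N i) * F (u i) \<le> (c / (2 * p) * \<bar>u k\<bar> powr p + C) / T" if "i < N" for i
  proof -
    have "m (node T N i) * F (u i) \<le> \<bar>m (node T N i)\<bar> * \<bar>F (u i)\<bar>"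
      by (simp add: abs_mult[symmetric])
    also have "\<dots> \<le> K * \<bar>F (u i)\<bar>"
      using m[OF node_mem[OF T]] that by (intro mult_right_mono) auto
    also have "\<dots> \<le> (c / (2 * p) * \<bar>u i\<bar> powr p + C) / T"
      using F[of "u i"] T by (simp add: field_simps)
    also have "\<dots> \<le> (c / (2 * p) * \<bar>u k\<bar> powr p + C) / T"
      using T p c k(2)[of i] that by (intro divide_right_mono add_right_mono mult_left_mono powr_mono2) auto
    finally show ?thesis .
  qed
  then have "(\<Sum>i<N. T / real N * (m (node T N i) * F (u i)))
      \<le> (\<Sum>i<N. T / real N * ((c / (2 * p) * \<bar>u k\<bar> powr p + C) / T))"
    using T by (intro sum_mono mult_left_mono) auto
  also have "\<dots> = c / (2 * p) * \<bar>u k\<bar> powr p + C"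
    using T N by simp
  finally have "c * \<bar>u k\<bar> powr p / p \<le> c / (2 * p) * \<bar>u k\<bar> powr p + C"
    using le divide_right_mono[OF coerc[OF k(1)], of p] p unfolding daction_def by linarith
  then have "\<bar>u k\<bar> powr p \<le> 2 * p * C / c"
    using p c by (simp add: field_simps)
  then have "(\<bar>u k\<bar> powr p) powr (1 / p) \<le> (2 * p * C / c) powr (1 / p)"
    using p by (intro powr_mono2) auto
  then show ?thesis
    using k(2)[OF j] p by (simp add: powr_powr)
qed

text \<open>The zero function has action 0, so a minimiser over the box containing all grid
  functions of nonpositive action is a global one. Evenness of \<open>F\<close> then permits passing
  to absolute values.\<close>

lemma discrete_action_minimizer:
  assumes T: "T > 0" and p: "p > 1" and N: "N > 0" and c: "c > 0"
    and coerc: "\<And>u j. j \<le> N \<Longrightarrow> c * \<bar>u j\<bar> powr p \<le> denergy p T q N u"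
    and m: "\<And>x. x \<in> {0..T} \<Longrightarrow> \<bar>m x\<bar> \<le> K"
    and F: "\<And>s. K * T * \<bar>F s\<bar> \<le> c / (2 * p) * \<bar>s\<bar> powr p + C"
    and F_cont: "continuous_on UNIV F" and F_even: "\<And>s. F (- s) = F s" and F0: "F 0 = 0"
  obtains u where "u N = u 0" "\<And>i. u i \<ge> 0" "\<And>i. i \<le> N \<Longrightarrow> u i \<le> (2 * p * C / c) powr (1 / p)"
    "\<And>z. z N = z 0 \<Longrightarrow> daction p T q m F N u \<le> daction p T q m F N z"
proof -
  let ?J = "daction p T q m F N"
  define R where "R = (2 * p * C / c) powr (1 / p)"
  have in_box: "\<bar>z j\<bar> \<le> R" if "?J z \<le> 0" "j \<le> N" for z j
    unfolding R_def by (rule daction_nonpos_imp_bounded[OF T p N coerc m F c that])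
  define K where "K = {u. (\<forall>i. \<bar>u i\<bar> \<le> R) \<and> u N = u 0}"
  have "compact K"
    unfolding K_def by (rule compact_periodic_box)
  have J_cong: "?J u = ?J v" if "\<And>i. i \<le> N \<Longrightarrow> u i = v i" for u v
    using that denergy_cong[of N u v] unfolding daction_def by simp
  have J_cont: "continuous_on K (\<lambda>u. ?J u)"
    unfolding daction_def divide_inverse
    by (intro continuous_on_diff continuous_on_sum continuous_on_mult continuous_on_const
        continuous_on_denergy[OF p] continuous_on_compose2[OF F_cont continuous_on_coordinate] subset_UNIV)
  have J0: "?J (\<lambda>i. 0) = 0"
    using p by (simp add: daction_def denergy_def F0)
  have "(\<lambda>i. 0) \<in> K" by (simp add: K_def R_def)
  then obtain v where v: "v \<in> K" "\<And>z. z \<in> K \<Longrightarrow> ?J v \<le> ?J z"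
    using continuous_attains_inf[OF \<open>compact K\<close> _ J_cont] by blast
  have v0: "?J v \<le> 0" using v(2)[OF \<open>(\<lambda>i. 0) \<in> K\<close>] J0 by simp
  have vmin: "?J v \<le> ?J z" if "z N = z 0" for z
  proof (cases "?J z \<le> 0")
    case True
    define z' where "z' = (\<lambda>i. if i \<le> N then z i else 0)"
    have "z' \<in> K"
      using in_box[OF True] that by (auto simp: K_def z'_def R_def)
    moreover have "?J z' = ?J z" by (rule J_cong) (simp add: z'_def)
    ultimately show ?thesis using v(2) by metis
  next
    case False
    then show ?thesis using v0 by simp
  qed
  have Fabs: "F \<bar>s\<bar> = F s" for s using F_even[of s] by (auto simp: abs_if)
  have "?J (\<lambda>i. \<bar>v i\<bar>) \<le> ?J v"
    unfolding daction_def Fabs using divide_right_mono[OF denergy_abs_le[OF T p, of q N v], of p] p by simp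
  show thesis
  proof (rule that[of "\<lambda>i. \<bar>v i\<bar>"])
    show "\<bar>v N\<bar> = \<bar>v 0\<bar>" using v(1) by (simp add: K_def)
    show "\<bar>v i\<bar> \<le> (2 * p * C / c) powr (1 / p)" if "i \<le> N" for i
      using in_box[OF v0 that] by (simp add: R_def)
    show "?J (\<lambda>i. \<bar>v i\<bar>) \<le> ?J z" if "z N = z 0" for z
      using \<open>?J (\<lambda>i. \<bar>v i\<bar>) \<le> ?J v\<close> vmin[OF that] by simp
  qed simp
qed

lemma discrete_action_equation:
  assumes T: "T > 0" and p: "p > 1" and N: "N > 0"
    and F: "\<And>s. (F has_real_derivative f s) (at s)"
    and min: "\<And>z. z N = z 0 \<Longrightarrow> daction p T q m F N u \<le> daction p T q m F N z"
    and per: "u N = u 0" and i: "i < N"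
  shows "dflux p (T / real N) N u (Suc i) - dflux p (T / real N) N u i = T / real N *
    (q (node T N i) * phi_p p (u i) - m (node T N i) * f (u i))"
proof -
  define G where "G i s = q (node T N i) * (\<bar>s\<bar> powr p / p) - m (node T N i) * F s" for i s
  have J: "(\<Sum>i<N. T / real N * (\<bar>(z (Suc i) - z i) / (T / real N)\<bar> powr p / p + G i (z i)))
      = daction p T q m F N z" for z
    unfolding daction_def denergy_def G_def
    by (simp add: sum.distrib[symmetric] sum_subtractf[symmetric] sum_divide_distrib add_divide_distrib
        del: times_divide_eq_left)
      (intro sum.cong refl, simp add: algebra_simps)
  show ?thesis
  proof (rule discrete_euler_lagrange[OF p _ N, where G = G])
    show "T / real N > 0" using T N by simp
    show "(G i has_real_derivative q (node T N i) * phi_p p (u i) - m (node T N i) * f (u i)) (at (u i))" for i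
      unfolding G_def by (intro DERIV_diff DERIV_cmult DERIV_abs_powr_div p F)
    show "\<forall>\<^sub>F t in at 0.
      (\<Sum>i<N. T / real N * (\<bar>(u (Suc i) - u i) / (T / real N)\<bar> powr p / p + G i (u i))) \<le>
      (\<Sum>i<N. T / real N * (\<bar>((u (Suc i) + t * w (Suc i)) - (u i + t * w i)) / (T / real N)\<bar> powr p / p
        + G i (u i + t * w i)))" if w: "w N = w 0" for w
      using J[of u] J[of "\<lambda>i. u i + t * w i" for t] min[of "\<lambda>i. u i + t * w i" for t] per w
      by (intro always_eventually allI) (simp only:)
  qed (rule i)
qed

subsection \<open>Attainment of the principal eigenvalues\<close>

lemma uniformly_close_compose:
  fixes U g a :: "real \<Rightarrow> real"
  assumes U: "continuous_on {0..T} U" and g: "continuous_on UNIV g" and a: "continuous_on {0..T} a"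
    and e: "e > 0"
  obtains d where "d > 0"
    "\<And>x s. x \<in> {0..T} \<Longrightarrow> \<bar>s - U x\<bar> < d \<Longrightarrow> \<bar>a x * g s - a x * g (U x)\<bar> < e"
proof -
  have bdd: "\<exists>M. \<forall>x\<in>{0..T}. \<bar>h x\<bar> \<le> M" if "continuous_on {0..T} h" for h :: "real \<Rightarrow> real"
    using compact_imp_bounded[OF compact_continuous_image[OF that compact_Icc]]
    unfolding bounded_iff by auto
  obtain M where M: "\<And>x. x \<in> {0..T} \<Longrightarrow> \<bar>U x\<bar> \<le> M" using bdd[OF U] by blast
  obtain A where A: "\<And>x. x \<in> {0..T} \<Longrightarrow> \<bar>a x\<bar> \<le> A" using bdd[OF a] by blast
  define e' where "e' = e / (\<bar>A\<bar> + 1)"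
  have e': "e' > 0" using e by (simp add: e'_def)
  have "uniformly_continuous_on {-M-1..M+1} g"
    by (intro compact_uniformly_continuous compact_Icc continuous_on_subset[OF g]) auto
  then obtain d where d: "d > 0"
    "\<And>x y. x \<in> {-M-1..M+1} \<Longrightarrow> y \<in> {-M-1..M+1} \<Longrightarrow> \<bar>x - y\<bar> < d \<Longrightarrow> \<bar>g x - g y\<bar> < e'"
    using e' unfolding uniformly_continuous_on_def dist_real_def by metis
  show thesis
  proof (rule that[of "min d 1"])
    show "min d 1 > 0" using d by simp
    fix x s assume x: "x \<in> {0..T}" and s: "\<bar>s - U x\<bar> < min d 1"
    have "\<bar>g s - g (U x)\<bar> < e'"
      using M[OF x] s by (intro d(2)) (auto simp: abs_le_iff abs_less_iff)
    then have "\<bar>a x\<bar> * \<bar>g s - g (U x)\<bar> \<le> \<bar>A\<bar> * e'"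
      using A[OF x] by (intro mult_mono) auto
    also have "\<dots> < (\<bar>A\<bar> + 1) * e'" using e' by simp
    also have "\<dots> = e" by (simp add: e'_def)
    finally show "\<bar>a x * g s - a x * g (U x)\<bar> < e"
      by (simp add: right_diff_distrib[symmetric] abs_mult)
  qed
qed

text \<open>Left samples with a coefficient serve the terms in \<open>q\<close> and
  \<open>m\<close>; right samples serve the slopes, which are functions of the flux at
  \<open>Suc i\<close>.\<close>

lemma grid_sum_limit:
  fixes U g a :: "real \<Rightarrow> real" and v :: "nat \<Rightarrow> nat \<Rightarrow> real"
  assumes T: "T > 0" and N: "filterlim N at_top sequentially"
    and U: "continuous_on {0..T} U" and g: "continuous_on UNIV g" and a: "continuous_on {0..T} a"
    and conv: "\<And>e. e > 0 \<Longrightarrow> \<forall>\<^sub>F n in sequentially. \<forall>i\<le>N n. \<bar>v n i - U (node T (N n) i)\<bar> < e"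
  shows "(\<lambda>n. \<Sum>i<N n. T / real (N n) * (a (node T (N n) i) * g (v n i)))
      \<longlonglongrightarrow> integral {0..T} (\<lambda>x. a x * g (U x))"
    and "(\<lambda>n. \<Sum>i<N n. T / real (N n) * g (v n (Suc i))) \<longlonglongrightarrow> integral {0..T} (\<lambda>x. g (U x))"
proof -
  have gU: "continuous_on {0..T} (\<lambda>x. g (U x))"
    using continuous_on_compose2[OF g U] by simp
  have node_mem': "node T M i \<in> {node T M i..node T M (Suc i)}"
      "node T M (Suc i) \<in> {node T M i..node T M (Suc i)}" for M i
    using T by (simp_all add: node_Suc)
  show "(\<lambda>n. \<Sum>i<N n. T / real (N n) * (a (node T (N n) i) * g (v n i)))
      \<longlonglongrightarrow> integral {0..T} (\<lambda>x. a x * g (U x))"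
  proof (rule riemann_sum_limit[OF T _ N])
    show "continuous_on {0..T} (\<lambda>x. a x * g (U x))" by (intro continuous_on_mult a gU)
    fix e :: real assume "e > 0"
    then obtain d where d: "d > 0"
      "\<And>x s. x \<in> {0..T} \<Longrightarrow> \<bar>s - U x\<bar> < d \<Longrightarrow> \<bar>a x * g s - a x * g (U x)\<bar> < e"
      using uniformly_close_compose[OF U g a] by metis
    show "\<forall>\<^sub>F n in sequentially. \<forall>i<N n. \<exists>\<xi>\<in>{node T (N n) i..node T (N n) (Suc i)}.
        \<bar>a (node T (N n) i) * g (v n i) - a \<xi> * g (U \<xi>)\<bar> < e"
      using conv[OF d(1)]
    proof eventually_elim
      case (elim n)
      then show ?case
        using d(2)[OF node_mem[OF T]] node_mem'(1)[of "N n"] by (meson less_imp_le)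
    qed
  qed
  show "(\<lambda>n. \<Sum>i<N n. T / real (N n) * g (v n (Suc i))) \<longlonglongrightarrow> integral {0..T} (\<lambda>x. g (U x))"
  proof (rule riemann_sum_limit[OF T gU N])
    fix e :: real assume "e > 0"
    then obtain d where d: "d > 0"
      "\<And>x s. x \<in> {0..T} \<Longrightarrow> \<bar>s - U x\<bar> < d \<Longrightarrow> \<bar>1 * g s - 1 * g (U x)\<bar> < e"
      using uniformly_close_compose[OF U g, of "\<lambda>x. 1"] continuous_on_const by metis
    show "\<forall>\<^sub>F n in sequentially. \<forall>i<N n. \<exists>\<xi>\<in>{node T (N n) i..node T (N n) (Suc i)}.
        \<bar>g (v n (Suc i)) - g (U \<xi>)\<bar> < e"
      using conv[OF d(1)]
    proof eventually_elim
      case (elim n)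
      show ?case
      proof (intro allI impI)
        fix i assume i: "i < N n"
        then have "\<bar>g (v n (Suc i)) - g (U (node T (N n) (Suc i)))\<bar> < e"
          using d(2)[OF node_mem[OF T], of "Suc i" "N n" "v n (Suc i)"] elim by (simp add: Suc_leI)
        then show "\<exists>\<xi>\<in>{node T (N n) i..node T (N n) (Suc i)}. \<bar>g (v n (Suc i)) - g (U \<xi>)\<bar> < e"
          using node_mem'(2) by blast
      qed
    qed
  qed
qed

lemma continuous_on_UNIV_abs_powr: "p > 1 \<Longrightarrow> continuous_on UNIV (\<lambda>s :: real. \<bar>s\<bar> powr p)"
  by (rule continuous_on_abs_powr) (auto intro: continuous_on_id)

lemma dweight_limit:
  assumes T: "T > 0" and p: "p > 1" and N: "filterlim N at_top sequentially"
    and U: "continuous_on {0..T} U" and m: "continuous_on {0..T} m"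
    and conv: "\<And>e. e > 0 \<Longrightarrow> \<forall>\<^sub>F n in sequentially. \<forall>i\<le>N n. \<bar>v n i - U (node T (N n) i)\<bar> < e"
  shows "(\<lambda>n. dweight p T m (N n) (v n)) \<longlonglongrightarrow> integral {0..T} (\<lambda>x. m x * \<bar>U x\<bar> powr p)"
  unfolding dweight_def
  by (rule grid_sum_limit(1)[OF T N U continuous_on_UNIV_abs_powr[OF p] m conv])

lemma dweight_samples_limit:
  assumes T: "T > 0" and p: "p > 1" and N: "filterlim N at_top sequentially"
    and U: "continuous_on {0..T} U" and m: "continuous_on {0..T} m"
  shows "(\<lambda>n. dweight p T m (N n) (\<lambda>i. U (node T (N n) i))) \<longlonglongrightarrow> integral {0..T} (\<lambda>x. m x * \<bar>U x\<bar> powr p)"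
  by (rule dweight_limit[OF T p N U m]) simp

lemma denergy_samples_le:
  assumes "T > 0" "p > 1" "W1p_periodic p T u v" "N > 0"
  shows "denergy p T q N (\<lambda>i. u (node T N i))
    \<le> integral {0..T} (\<lambda>x. \<bar>v x\<bar> powr p) + dweight p T q N (\<lambda>i. u (node T N i))"
  unfolding denergy_def dweight_def by (rule add_right_mono) (rule interpolant_energy_le[OF assms])

lemma LINT_weight:
  fixes p T :: real and m u :: "real \<Rightarrow> real"
  assumes "p > 1" "continuous_on {0..T} m" "continuous_on {0..T} u"
  shows "(LINT x|lebesgue_on {0<..<T}. m x * \<bar>u x\<bar> powr p) = integral {0..T} (\<lambda>x. m x * \<bar>u x\<bar> powr p)"
  by (intro LINT_open_eq_integral continuous_integrable_open continuous_on_mult continuous_on_abs_powr assms)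

text \<open>The integral of \<open>q\<close> is positive because \<open>q\<close> is continuous,
  nonnegative and not identically 0. The Riemann sums eventually exceed half of it, which makes
  \<open>c\<close> independent of \<open>N\<close>.\<close>

lemma eventually_coercive:
  assumes T: "T > 0" and p: "p > 1" and q: "continuous_on {0..T} q" "\<And>x. x \<in> {0..T} \<Longrightarrow> q x \<ge> 0"
    "\<exists>x\<in>{0..T}. q x \<noteq> 0"
  obtains c where "c > 0"
    "\<forall>\<^sub>F N in sequentially. \<forall>u j. j \<le> N \<longrightarrow> c * \<bar>u j\<bar> powr p \<le> denergy p T q N u"
proof -
  define Q where "Q = integral {0..T} q"
  have "Q \<ge> 0"
    unfolding Q_def using q by (intro Henstock_Kurzweil_Integration.integral_nonneg integrable_continuous_real) auto
  moreover have "Q \<noteq> 0"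
    unfolding Q_def using integral_eq_0_iff[OF q(1) T q(2)] q(3) by blast
  ultimately have Q: "Q > 0" by simp
  have "filterlim (\<lambda>n::nat. n) at_top sequentially" by (rule filterlim_ident)
  then have "(\<lambda>n. \<Sum>i<n. T / real n * q (node T n i)) \<longlonglongrightarrow> Q"
    unfolding Q_def by (rule node_sum_limit[OF T q(1)])
  then have "\<forall>\<^sub>F n in sequentially. (\<Sum>i<n. T / real n * q (node T n i)) > Q / 2"
    using Q by (intro order_tendstoD(1)) auto
  then have "\<forall>\<^sub>F N in sequentially. \<forall>u j. j \<le> N \<longrightarrow>
      min (T / (2 * T) powr p) (Q / 2 / 2 powr p) * \<bar>u j\<bar> powr p \<le> denergy p T q N u"
    using eventually_ge_at_top[of 1]
  proof eventually_elim
    case (elim N)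
    then show ?case
    proof (intro allI impI)
      fix u j assume "j \<le> N"
      then show "min (T / (2 * T) powr p) (Q / 2 / 2 powr p) * \<bar>u j\<bar> powr p \<le> denergy p T q N u"
        using elim by (intro denergy_coercive[OF T p _ q(2)]) auto
    qed
  qed
  moreover have "min (T / (2 * T) powr p) (Q / 2 / 2 powr p) > 0"
    using Q T by simp
  ultimately show thesis
    using that by blast
qed

text \<open>Uniform convergence of values and fluxes makes weight and energy of the discrete
  minimisers converge to those of the limit, so neither the constraint nor the minimal value is
  lost. It is applied to \<open>m\<close> and to \<open>- m\<close>.\<close>

lemma principal_minimizer_exists:
  assumes T: "T > 0" and p: "p > 1" and q: "continuous_on {0..T} q" "\<And>x. x \<in> {0..T} \<Longrightarrow> q x \<ge> 0"
    "\<exists>x\<in>{0..T}. q x \<noteq> 0" and m: "continuous_on {0..T} m" "\<exists>x\<in>{0..T}. m x > 0"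
  obtains u v where "W1p_periodic p T u v" "(LINT x|lebesgue_on {0<..<T}. m x * \<bar>u x\<bar> powr p) = 1"
    "\<forall>w z. W1p_periodic p T w z \<longrightarrow> (LINT x|lebesgue_on {0<..<T}. m x * \<bar>w x\<bar> powr p) = 1 \<longrightarrow>
      energy p T q u v \<le> energy p T q w z"
proof -
  obtain c where c: "c > 0"
      "\<forall>\<^sub>F N in sequentially. \<forall>u j. j \<le> N \<longrightarrow> c * \<bar>u j\<bar> powr p \<le> denergy p T q N u"
    by (rule eventually_coercive[OF T p q])
  obtain w0 z0 where w0: "W1p_periodic p T w0 z0" "integral {0..T} (\<lambda>x. m x * \<bar>w0 x\<bar> powr p) > 0"
    by (rule W1p_periodic_positive_weight_exists[OF T p m])
  define M0 where "M0 = integral {0..T} (\<lambda>x. m x * \<bar>w0 x\<bar> powr p)"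
  have M0: "M0 > 0" using w0 by (simp add: M0_def)
  have id: "filterlim (\<lambda>n::nat. n) at_top sequentially" by (rule filterlim_ident)
  have w0_cont: "continuous_on {0..T} w0" using w0 by (simp add: W1p_periodic_def)
  have "\<forall>\<^sub>F n in sequentially. dweight p T m n (\<lambda>i. w0 (node T n i)) > M0 / 2"
    using M0 dweight_samples_limit[OF T p id w0_cont m(1)] unfolding M0_def
    by (intro order_tendstoD(1)) auto
  moreover have "\<forall>\<^sub>F n in sequentially. dweight p T q n (\<lambda>i. w0 (node T n i))
      < integral {0..T} (\<lambda>x. q x * \<bar>w0 x\<bar> powr p) + 1"
    using dweight_samples_limit[OF T p id w0_cont q(1)] by (intro order_tendstoD(2)) auto
  ultimately have "\<forall>\<^sub>F n in sequentially. dweight p T m n (\<lambda>i. w0 (node T n i)) > M0 / 2 \<and>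
      dweight p T q n (\<lambda>i. w0 (node T n i)) < integral {0..T} (\<lambda>x. q x * \<bar>w0 x\<bar> powr p) + 1 \<and>
      (\<forall>u j. j \<le> n \<longrightarrow> c * \<bar>u j\<bar> powr p \<le> denergy p T q n u) \<and> n \<ge> 1"
    using c(2) eventually_ge_at_top[of 1] by eventually_elim blast
  then obtain n0 where n0: "\<And>n. n \<ge> n0 \<Longrightarrow> dweight p T m n (\<lambda>i. w0 (node T n i)) > M0 / 2"
      "\<And>n. n \<ge> n0 \<Longrightarrow> dweight p T q n (\<lambda>i. w0 (node T n i)) < integral {0..T} (\<lambda>x. q x * \<bar>w0 x\<bar> powr p) + 1"
      "\<And>n u j. n \<ge> n0 \<Longrightarrow> j \<le> n \<Longrightarrow> c * \<bar>u j\<bar> powr p \<le> denergy p T q n u"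
      "\<And>n. n \<ge> n0 \<Longrightarrow> n \<ge> 1"
    unfolding eventually_sequentially by blast
  \<comment> \<open>The shift turns estimates valid for large grids into estimates for every index,
    as \<open>discrete_solutions_limit\<close> demands.\<close>
  define N where "N n = n + n0" for n :: nat
  have N: "filterlim N at_top sequentially"
    unfolding N_def by (rule filterlim_add_const_nat_at_top)
  have Nn0: "N n \<ge> n0" for n by (simp add: N_def)
  have Npos: "N n > 0" for n using n0(4)[OF Nn0, of n] by simp
  have w0_per: "w0 (node T (N n) (N n)) = w0 (node T (N n) 0)" for n
    using w0(1) Npos by (simp add: W1p_periodic_def)
  have w0_pos: "dweight p T m (N n) (\<lambda>i. w0 (node T (N n) i)) > 0" for n
    using n0(1)[OF Nn0, of n] M0 by simp
  have "\<exists>u. u (N n) = u 0 \<and> dweight p T m (N n) u = 1 \<and> (\<forall>z. z (N n) = z 0 \<longrightarrow> dweight p T m (N n) z > 0 \<longrightarrow>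
      denergy p T q (N n) u * dweight p T m (N n) z \<le> denergy p T q (N n) z)" for n
    by (rule discrete_constrained_minimizer[OF T p Npos c(1) n0(3)[OF Nn0] w0_per w0_pos]) blast+
  then obtain u where u: "\<And>n. u n (N n) = u n 0" "\<And>n. dweight p T m (N n) (u n) = 1"
      "\<And>n z. z (N n) = z 0 \<Longrightarrow> dweight p T m (N n) z > 0 \<Longrightarrow>
        denergy p T q (N n) (u n) * dweight p T m (N n) z \<le> denergy p T q (N n) z"
    by metis
  define lam where "lam n = denergy p T q (N n) (u n)" for n
  \<comment> \<open>\<open>E0\<close> bounds the energy of the samples of \<open>w0\<close>, with 1
    added for the quadrature error; divided by half the weight of \<open>w0\<close> it bounds all
    discrete minima.\<close>
  define E0 where "E0 = integral {0..T} (\<lambda>x. \<bar>z0 x\<bar> powr p) + integral {0..T} (\<lambda>x. q x * \<bar>w0 x\<bar> powr p) + 1"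
  have lam_nonneg: "lam n \<ge> 0" for n
    unfolding lam_def by (rule denergy_nonneg[OF T q(2)])
  have lam_le: "lam n \<le> E0 / (M0 / 2)" for n
  proof -
    have "lam n * (M0 / 2) \<le> lam n * dweight p T m (N n) (\<lambda>i. w0 (node T (N n) i))"
      using lam_nonneg n0(1)[OF Nn0, of n] by (intro mult_left_mono) auto
    also have "\<dots> \<le> denergy p T q (N n) (\<lambda>i. w0 (node T (N n) i))"
      unfolding lam_def by (rule u(3)[OF w0_per w0_pos])
    also have "\<dots> \<le> E0"
      using denergy_samples_le[OF T p w0(1) Npos, of q n] n0(2)[OF Nn0, of n] unfolding E0_def by linarith
    finally show ?thesis using M0 by (simp add: field_simps)
  qed
  define K where "K = E0 / (M0 / 2)"
  have u_bound: "\<bar>u n i\<bar> \<le> (K / c) powr (1 / p)" if "i \<le> N n" for n i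
  proof -
    have "c * \<bar>u n i\<bar> powr p \<le> K"
      using n0(3)[OF Nn0 that, of "u n"] lam_le[of n] unfolding lam_def K_def by linarith
    then have "(\<bar>u n i\<bar> powr p) powr (1 / p) \<le> (K / c) powr (1 / p)"
      using c(1) p by (intro powr_mono2) (auto simp: field_simps)
    then show ?thesis using p by (simp add: powr_powr)
  qed
  define y where "y n = dflux p (T / real (N n)) (N n) (u n)" for n
  have h: "T / real (N n) > 0" for n using T Npos by simp
  have phi_cont: "continuous_on UNIV (phi_p p)"
    using continuous_on_phi_p[OF p continuous_on_id] .
  have u_step: "u n (Suc i) - u n i = T / real (N n) * phi_p (p / (p - 1)) (y n (Suc i))" for n i
    unfolding y_def by (rule dflux_step[OF p h])
  have y_step: "y n (Suc i) - y n i = T / real (N n) *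
      (q (node T (N n) i) * phi_p p (u n i) - lam n * m (node T (N n) i) * phi_p p (u n i))"
    if "i < N n" for n i
    unfolding y_def lam_def by (rule discrete_eigen_equation[OF T p Npos u(2) u(3) u(1) that])
  have y_per: "y n (N n) = y n 0" for n
    unfolding y_def by (rule dflux_periodic[OF u(1) Npos])
  have lam_bound: "\<bar>lam n\<bar> \<le> K" for n
    using lam_nonneg[of n] lam_le[of n] by (simp add: K_def)
  obtain r U W l where lim: "strict_mono (r :: nat \<Rightarrow> nat)" "(\<lambda>n. lam (r n)) \<longlonglongrightarrow> l"
    "\<forall>x\<in>{0..T}. (U has_real_derivative phi_p (p / (p - 1)) (W x)) (at x within {0..T})"
    "\<forall>x\<in>{0..T}. (W has_real_derivative q x * phi_p p (U x) - l * m x * phi_p p (U x)) (at x within {0..T})"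
    "U 0 = U T" "W 0 = W T"
    "\<forall>e>0. \<forall>\<^sub>F n in sequentially. \<forall>i\<le>N (r n).
        \<bar>u (r n) i - U (node T (N (r n)) i)\<bar> < e \<and> \<bar>y (r n) i - W (node T (N (r n)) i)\<bar> < e"
    by (rule discrete_solutions_limit[OF T p q(1) m(1) phi_cont N Npos u_step y_step u(1) y_per u_bound lam_bound])
  define V where "V x = phi_p (p / (p - 1)) (W x)" for x
  have U_cont: "continuous_on {0..T} U" and W_cont: "continuous_on {0..T} W"
    using DERIV_continuous_on[OF lim(3)[rule_format]] DERIV_continuous_on[OF lim(4)[rule_format]] by simp_all
  have V_cont: "continuous_on {0..T} V"
    unfolding V_def by (rule continuous_on_phi_p[OF conjugate_exponent_gt_1[OF p] W_cont])
  have w: "W1p_periodic p T U V"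
    by (rule C1_imp_W1p_periodic[OF T p lim(3)[folded V_def, rule_format] V_cont lim(5)])
  have Nr: "filterlim (\<lambda>n. N (r n)) at_top sequentially"
    by (rule filterlim_compose[OF N]) (rule filterlim_subseq[OF lim(1)])
  have conv: "\<forall>\<^sub>F n in sequentially. \<forall>i\<le>N (r n). \<bar>u (r n) i - U (node T (N (r n)) i)\<bar> < e"
      "\<forall>\<^sub>F n in sequentially. \<forall>i\<le>N (r n). \<bar>y (r n) i - W (node T (N (r n)) i)\<bar> < e" if "e > 0" for e
    using lim(7)[rule_format, OF that] by (auto elim: eventually_mono)
  have MU: "(LINT x|lebesgue_on {0<..<T}. m x * \<bar>U x\<bar> powr p) = 1"
    using LIMSEQ_unique[OF dweight_limit[OF T p Nr U_cont m(1) conv(1)]] u(2)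
    by (simp add: LINT_weight[OF p m(1) U_cont])
  have "(\<lambda>n. denergy p T q (N (r n)) (u (r n))) \<longlonglongrightarrow>
      integral {0..T} (\<lambda>x. \<bar>phi_p (p / (p - 1)) (W x)\<bar> powr p) + integral {0..T} (\<lambda>x. q x * \<bar>U x\<bar> powr p)"
  proof -
    have gc: "continuous_on UNIV (\<lambda>s. \<bar>phi_p (p / (p - 1)) s\<bar> powr p)"
      by (intro continuous_on_abs_powr[OF p] continuous_on_phi_p conjugate_exponent_gt_1[OF p] continuous_on_id)
    have "(\<lambda>n. \<Sum>i<N (r n). T / real (N (r n)) * \<bar>phi_p (p / (p - 1)) (y (r n) (Suc i))\<bar> powr p)
        \<longlonglongrightarrow> integral {0..T} (\<lambda>x. \<bar>phi_p (p / (p - 1)) (W x)\<bar> powr p)"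
      by (rule grid_sum_limit(2)[OF T Nr W_cont gc m(1) conv(2)])
    moreover
    have quot: "(u (r n) (Suc i) - u (r n) i) / (T / real (N (r n))) = phi_p (p / (p - 1)) (y (r n) (Suc i))" for n i
      unfolding u_step by (rule nonzero_mult_div_cancel_left) (use T Npos[of "r n"] in simp)
    have "denergy p T q (N (r n)) (u (r n))
        = (\<Sum>i<N (r n). T / real (N (r n)) * \<bar>phi_p (p / (p - 1)) (y (r n) (Suc i))\<bar> powr p)
          + dweight p T q (N (r n)) (u (r n))" for n
      by (simp only: denergy_def dweight_def quot)
    ultimately show ?thesis
      by (simp only: tendsto_add[OF _ dweight_limit[OF T p Nr U_cont q(1) conv(1)]])
  qed
  then have l: "l = energy p T q U V"
    using LIMSEQ_unique lim(2) unfolding lam_def energy_eq_integral[OF p q(1) w] V_def by blast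
  show thesis
  proof (rule that[OF w MU], intro allI impI)
    fix w z assume wz: "W1p_periodic p T w z" "(LINT x|lebesgue_on {0<..<T}. m x * \<bar>w x\<bar> powr p) = 1"
    have w_cont: "continuous_on {0..T} w" using wz by (simp add: W1p_periodic_def)
    have Mw: "integral {0..T} (\<lambda>x. m x * \<bar>w x\<bar> powr p) = 1"
      using wz(2) by (simp add: LINT_weight[OF p m(1) w_cont])
    have lim_m: "(\<lambda>n. dweight p T m (N (r n)) (\<lambda>i. w (node T (N (r n)) i))) \<longlonglongrightarrow> 1"
      using dweight_samples_limit[OF T p Nr w_cont m(1)] by (simp add: Mw)
    have lim_q: "(\<lambda>n. dweight p T q (N (r n)) (\<lambda>i. w (node T (N (r n)) i)))
        \<longlonglongrightarrow> integral {0..T} (\<lambda>x. q x * \<bar>w x\<bar> powr p)"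
      by (rule dweight_samples_limit[OF T p Nr w_cont q(1)])
    \<comment> \<open>The samples of \<open>w\<close> have weight close to 1 but not equal to 1, so
      the homogeneous form of discrete minimality is the one to use.\<close>
    have "\<forall>\<^sub>F n in sequentially. dweight p T m (N (r n)) (\<lambda>i. w (node T (N (r n)) i)) > 0"
      using lim_m by (intro order_tendstoD(1)) auto
    then have "\<forall>\<^sub>F n in sequentially. lam (r n) * dweight p T m (N (r n)) (\<lambda>i. w (node T (N (r n)) i))
        \<le> integral {0..T} (\<lambda>x. \<bar>z x\<bar> powr p) + dweight p T q (N (r n)) (\<lambda>i. w (node T (N (r n)) i))"
    proof eventually_elim
      case (elim n)
      have "w (node T (N (r n)) (N (r n))) = w (node T (N (r n)) 0)"
        using wz(1) Npos by (simp add: W1p_periodic_def)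
      then show ?case
        using u(3)[OF _ elim] denergy_samples_le[OF T p wz(1) Npos, of q "r n"] unfolding lam_def by linarith
    qed
    then have "l * 1 \<le> integral {0..T} (\<lambda>x. \<bar>z x\<bar> powr p) + integral {0..T} (\<lambda>x. q x * \<bar>w x\<bar> powr p)"
      by (rule tendsto_le[OF trivial_limit_sequentially tendsto_add[OF tendsto_const lim_q] tendsto_mult[OF lim(2) lim_m]])
    then show "energy p T q U V \<le> energy p T q w z"
      by (simp add: l[symmetric] energy_eq_integral[OF p q(1) wz(1)])
  qed
qed

subsection \<open>Strong positivity and primitives of the nonlinearity\<close>

lemma continuous_on_Icc_bounded:
  fixes h :: "real \<Rightarrow> real"
  assumes "continuous_on {a..b} h"
  obtains M where "M > 0" "\<And>x. x \<in> {a..b} \<Longrightarrow> \<bar>h x\<bar> \<le> M"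
proof -
  have "bounded (h ` {a..b})"
    using compact_imp_bounded[OF compact_continuous_image[OF assms compact_Icc]] .
  then show thesis
    using that unfolding bounded_pos by auto
qed

text \<open>Let M be the maximum of |U| within distance \<open>d\<close> of the double zero. Then
  |W| \<le> B M^(p-1), hence |U'| \<le> B^(p'-1) M because (p-1)(p'-1) = 1, and integration over a
  length \<open>d\<close> gives M \<le> M/2. This cancellation of exponents replaces a Lipschitz
  condition: phi_p and its inverse are not both Lipschitz near 0 unless p = 2.\<close>

lemma zero_propagates:
  fixes U W :: "real \<Rightarrow> real"
  assumes p: "p > 1" and B: "B \<ge> 0" and d: "0 \<le> d" "d \<le> 1" "d * B powr (p / (p - 1) - 1) \<le> 1 / 2"
    and dU: "\<And>x. x \<in> {a..b} \<Longrightarrow> (U has_real_derivative phi_p (p / (p - 1)) (W x)) (at x within {a..b})"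
    and dW: "\<And>x. x \<in> {a..b} \<Longrightarrow> (W has_real_derivative W' x) (at x within {a..b})"
    and W': "\<And>x. x \<in> {a..b} \<Longrightarrow> \<bar>W' x\<bar> \<le> B * \<bar>U x\<bar> powr (p - 1)"
    and x0: "x0 \<in> {a..b}" "U x0 = 0" "W x0 = 0" and x: "x \<in> {a..b}" "\<bar>x - x0\<bar> \<le> d"
  shows "U x = 0 \<and> W x = 0"
proof -
  define p' where "p' = p / (p - 1)"
  have p': "p' > 1" using p conjugate_exponent_gt_1 by (simp add: p'_def)
  have pp': "(p - 1) * (p' - 1) = 1" using p by (simp add: p'_def field_simps)
  define I where "I = {max a (x0 - d)..min b (x0 + d)}"
  have I: "I \<subseteq> {a..b}" "x0 \<in> I" "x \<in> I" "convex I" "compact I"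
    using x0 x d by (auto simp: I_def abs_le_iff)
  have close: "\<bar>y - x0\<bar> \<le> d" if "y \<in> I" for y
    using that by (auto simp: I_def abs_le_iff)
  have "continuous_on I (\<lambda>x. \<bar>U x\<bar>)"
    using DERIV_continuous_on[OF dU] continuous_on_subset[OF _ I(1)] by (intro continuous_on_rabs) blast
  then obtain x1 where x1: "x1 \<in> I" "\<And>y. y \<in> I \<Longrightarrow> \<bar>U y\<bar> \<le> \<bar>U x1\<bar>"
    using continuous_attains_sup[OF I(5)] I(2) by blast
  define M where "M = \<bar>U x1\<bar>"
  have M: "M \<ge> 0" by (simp add: M_def)
  have W_bound: "\<bar>W y\<bar> \<le> B * M powr (p - 1)" if y: "y \<in> I" for y
  proof -
    have "norm (W y - W x0) \<le> B * M powr (p - 1) * norm (y - x0)"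
    proof (rule field_differentiable_bound[OF I(4) _ _ y I(2)])
      show "(W has_field_derivative W' z) (at z within I)" if "z \<in> I" for z
        using dW I(1) that by (meson DERIV_subset subsetD)
      show "norm (W' z) \<le> B * M powr (p - 1)" if "z \<in> I" for z
      proof -
        have "B * \<bar>U z\<bar> powr (p - 1) \<le> B * M powr (p - 1)"
          using x1(2)[OF that] B p unfolding M_def by (intro mult_left_mono powr_mono2) auto
        then show ?thesis using W'[of z] I(1) that by (auto simp: subset_iff)
      qed
    qed
    also have "\<dots> \<le> B * M powr (p - 1) * 1"
      using close[OF y] d B by (intro mult_left_mono) auto
    finally show ?thesis using x0 by simp
  qed
  have "norm (U x1 - U x0) \<le> B powr (p' - 1) * M * norm (x1 - x0)"
  proof (rule field_differentiable_bound[OF I(4) _ _ x1(1) I(2)])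
    show "(U has_field_derivative phi_p p' (W z)) (at z within I)" if "z \<in> I" for z
      using dU I(1) that unfolding p'_def by (meson DERIV_subset subsetD)
    show "norm (phi_p p' (W z)) \<le> B powr (p' - 1) * M" if "z \<in> I" for z
    proof -
      have "\<bar>W z\<bar> powr (p' - 1) \<le> (B * M powr (p - 1)) powr (p' - 1)"
        using W_bound[OF that] p' by (intro powr_mono2) auto
      also have "\<dots> = B powr (p' - 1) * M"
        using B M by (simp add: powr_mult powr_powr pp')
      finally show ?thesis by (simp add: abs_phi_p)
    qed
  qed
  also have "\<dots> \<le> B powr (p' - 1) * M * d"
    using close[OF x1(1)] M by (intro mult_left_mono) auto
  also have "\<dots> \<le> M * (1 / 2)"
    using mult_left_mono[OF d(3) M] by (simp add: p'_def mult_ac)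
  finally have "M \<le> M / 2" using x0 by (simp add: M_def)
  then have "M = 0" using M by simp
  then show ?thesis
    using x1(2)[OF I(3)] W_bound[OF I(3)] by (simp add: M_def)
qed

text \<open>The radius in \<open>zero_propagates\<close> does not depend on the centre, so finitely
  many steps of that length reach every point of the interval.\<close>

lemma zero_spreads:
  fixes U W :: "real \<Rightarrow> real"
  assumes p: "p > 1" and B: "B \<ge> 0"
    and dU: "\<And>x. x \<in> {a..b} \<Longrightarrow> (U has_real_derivative phi_p (p / (p - 1)) (W x)) (at x within {a..b})"
    and dW: "\<And>x. x \<in> {a..b} \<Longrightarrow> (W has_real_derivative W' x) (at x within {a..b})"
    and W': "\<And>x. x \<in> {a..b} \<Longrightarrow> \<bar>W' x\<bar> \<le> B * \<bar>U x\<bar> powr (p - 1)"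
    and x0: "x0 \<in> {a..b}" "U x0 = 0" "W x0 = 0" and x: "x \<in> {a..b}"
  shows "U x = 0"
proof -
  define D where "D = B powr (p / (p - 1) - 1)"
  define d where "d = min 1 (1 / (2 * (D + 1)))"
  have D: "D \<ge> 0" by (simp add: D_def)
  have d: "d > 0" "d \<le> 1" using D by (auto simp: d_def)
  have "d * D \<le> 1 / (2 * (D + 1)) * D" using D by (intro mult_right_mono) (auto simp: d_def)
  also have "\<dots> \<le> 1 / 2" using D by (simp add: field_simps)
  finally have dD: "d * B powr (p / (p - 1) - 1) \<le> 1 / 2" by (simp add: D_def)
  have *: "\<forall>x\<in>{a..b}. \<bar>x - x0\<bar> \<le> real k * d \<longrightarrow> U x = 0 \<and> W x = 0" for k
  proof (induction k)
    case 0
    then show ?case using x0 by auto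
  next
    case (Suc k)
    show ?case
    proof (intro ballI impI)
      fix x assume x: "x \<in> {a..b}" "\<bar>x - x0\<bar> \<le> real (Suc k) * d"
      define K where "K = real k * d"
      \<comment> \<open>\<open>y\<close> is the projection of \<open>x\<close> onto the interval of
        radius \<open>K\<close> around \<open>x0\<close>, where the double zeros are already known;
        it is within \<open>d\<close> of \<open>x\<close>.\<close>
      define y where "y = max (x0 - K) (min (x0 + K) x)"
      have "K \<ge> 0" using d by (simp add: K_def)
      moreover have "\<bar>x - x0\<bar> \<le> K + d" using x(2) by (simp add: K_def distrib_right)
      ultimately have y: "y \<in> {a..b}" "\<bar>y - x0\<bar> \<le> real k * d" "\<bar>x - y\<bar> \<le> d"
        using x(1) x0(1) d(1) unfolding K_def[symmetric]
        by (auto simp: y_def abs_le_iff max_def min_def)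
      then have "U y = 0" "W y = 0" using Suc by auto
      then show "U x = 0 \<and> W x = 0"
        using zero_propagates[OF p B _ d(2) dD dU dW W' y(1) _ _ x(1) y(3)] d(1) by simp
    qed
  qed
  obtain k where "\<bar>x - x0\<bar> / d \<le> real k" using real_arch_simple by blast
  then have "\<bar>x - x0\<bar> \<le> real k * d" using d by (simp add: field_simps)
  then show ?thesis using * x by blast
qed

text \<open>A zero of a nonnegative function is a minimum, so the flux vanishes there. At an
  endpoint the one-sided derivative gives only one inequality: \<open>W 0 \<ge> 0\<close> and
  \<open>W T \<le> 0\<close>; periodicity of \<open>U\<close> and \<open>W\<close> joins them. The
  double zero contradicts \<open>nontriv\<close>.\<close>

lemma periodic_nonneg_solution_positive:
  fixes U W :: "real \<Rightarrow> real"
  assumes T: "T > 0" and p: "p > 1" and B: "B \<ge> 0"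
    and dU: "\<And>x. x \<in> {0..T} \<Longrightarrow> (U has_real_derivative phi_p (p / (p - 1)) (W x)) (at x within {0..T})"
    and dW: "\<And>x. x \<in> {0..T} \<Longrightarrow> (W has_real_derivative W' x) (at x within {0..T})"
    and W': "\<And>x. x \<in> {0..T} \<Longrightarrow> \<bar>W' x\<bar> \<le> B * \<bar>U x\<bar> powr (p - 1)"
    and per: "U 0 = U T" "W 0 = W T" and nonneg: "\<And>x. x \<in> {0..T} \<Longrightarrow> U x \<ge> 0"
    and nontriv: "x1 \<in> {0..T}" "U x1 \<noteq> 0" and x: "x \<in> {0..T}"
  shows "U x > 0"
proof (rule ccontr)
  define p' where "p' = p / (p - 1)"
  have sgn_phi: "phi_p p' s > 0 \<longleftrightarrow> s > 0" "phi_p p' s < 0 \<longleftrightarrow> s < 0" for s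
    using sgn_phi_p[of p' s] by (auto simp: sgn_if split: if_splits)
  assume "\<not> U x > 0"
  then have Ux: "U x = 0" using nonneg[OF x] by simp
  have ge: "W y \<ge> 0" if y: "y \<in> {0..T}" "y < T" "U y = 0" for y
  proof (rule ccontr)
    assume "\<not> W y \<ge> 0"
    then obtain d where d: "d > 0" "\<And>h. h > 0 \<Longrightarrow> y + h \<in> {0..T} \<Longrightarrow> h < d \<Longrightarrow> U (y + h) < U y"
      using has_real_derivative_neg_dec_right[OF dU[OF y(1)]] sgn_phi by (auto simp: p'_def)
    define h where "h = min (d / 2) (T - y)"
    have "h > 0" "y + h \<in> {0..T}" "h < d" using d y by (auto simp: h_def)
    then show False using d(2)[of h] nonneg[of "y + h"] y by simp
  qed
  have le: "W y \<le> 0" if y: "y \<in> {0..T}" "y > 0" "U y = 0" for y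
  proof (rule ccontr)
    assume "\<not> W y \<le> 0"
    then obtain d where d: "d > 0" "\<And>h. h > 0 \<Longrightarrow> y - h \<in> {0..T} \<Longrightarrow> h < d \<Longrightarrow> U (y - h) < U y"
      using has_real_derivative_pos_inc_left[OF dU[OF y(1)]] sgn_phi by (auto simp: p'_def)
    define h where "h = min (d / 2) y"
    have "h > 0" "y - h \<in> {0..T}" "h < d" using d y by (auto simp: h_def)
    then show False using d(2)[of h] nonneg[of "y - h"] y by simp
  qed
  have "W x = 0"
  proof -
    consider "x = 0" | "x = T" | "0 < x" "x < T" using x by fastforce
    then show ?thesis
    proof cases
      case 1
      then have "U T = 0" "U 0 = 0" using Ux per by auto
      then show ?thesis using ge[of 0] le[of T] T per 1 by simp
    next
      case 2
      then have "U T = 0" "U 0 = 0" using Ux per by auto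
      then show ?thesis using ge[of 0] le[of T] T per 2 by simp
    next
      case 3
      then show ?thesis using ge[of x] le[of x] x Ux by simp
    qed
  qed
  then show False
    using zero_spreads[OF p B dU dW W' x Ux _ nontriv(1)] nontriv(2) by blast
qed

section \<open>Growth of the nonlinearity and of its primitive\<close>

lemma primitive_growth:
  fixes F f :: "real \<Rightarrow> real"
  assumes F: "\<And>s. (F has_real_derivative f s) (at s)" and F0: "F 0 = 0"
    and f: "\<And>t. \<bar>t\<bar> \<le> \<bar>s\<bar> \<Longrightarrow> \<bar>f t\<bar> \<le> M"
  shows "\<bar>F s\<bar> \<le> M * \<bar>s\<bar>"
proof -
  have "norm (F s - F 0) \<le> M * norm (s - 0)"
  proof (rule field_differentiable_bound[of "cball 0 \<bar>s\<bar>" F f])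
    show "(F has_field_derivative f z) (at z within cball 0 \<bar>s\<bar>)" for z
      using F by (rule has_field_derivative_at_within)
  qed (use f in auto)
  then show ?thesis using F0 by simp
qed

lemma sublinear_primitive_bound:
  fixes F f :: "real \<Rightarrow> real"
  assumes p: "p > 1" and f: "continuous_on UNIV f"
    and f_inf: "((\<lambda>s. f s / phi_p p s) \<longlongrightarrow> 0) at_infinity"
    and F: "\<And>s. (F has_real_derivative f s) (at s)" and F0: "F 0 = 0" and e: "e > 0"
  obtains C where "\<And>s. \<bar>F s\<bar> \<le> e * \<bar>s\<bar> powr p + C"
proof -
  \<comment> \<open>One half of \<open>e\<close> goes to the growth of \<open>f\<close> at infinity,
    the other absorbs the linear term \<open>M * \<bar>s\<bar>\<close>.\<close>
  define e2 where "e2 = e / 2"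
  have e2: "e2 > 0" using e by (simp add: e2_def)
  obtain R where R: "R > 0" "\<And>s. \<bar>s\<bar> \<ge> R \<Longrightarrow> \<bar>f s / phi_p p s\<bar> < e2"
    using f_inf e2 unfolding Lim_at_infinity dist_real_def
    by (metis (no_types, lifting) diff_zero dual_order.trans gt_ex less_eq_real_def linorder_not_le real_norm_def)
  obtain M where M: "M > 0" "\<And>s. s \<in> {-R..R} \<Longrightarrow> \<bar>f s\<bar> \<le> M"
    using continuous_on_Icc_bounded[OF continuous_on_subset[OF f subset_UNIV]] by metis
  have f_bound: "\<bar>f t\<bar> \<le> e2 * \<bar>t\<bar> powr (p - 1) + M" for t
  proof (cases "\<bar>t\<bar> \<ge> R")
    case True
    then have "\<bar>t\<bar> > 0" using R by simp
    then have "\<bar>f t\<bar> < e2 * \<bar>t\<bar> powr (p - 1)"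
      using R(2)[OF True] by (simp add: abs_phi_p abs_divide field_simps)
    then show ?thesis using M by simp
  next
    case False
    then have "\<bar>f t\<bar> \<le> M" by (intro M) auto
    then show ?thesis using e2 by (simp add: add_increasing)
  qed
  \<comment> \<open>Beyond \<open>S\<close> one has M \<le> e2 |s|^(p-1), so the linear term is
    absorbed; up to \<open>S\<close> it is at most \<open>M * S\<close>.\<close>
  define S where "S = (M / e2) powr (1 / (p - 1))"
  have "\<bar>F s\<bar> \<le> e * \<bar>s\<bar> powr p + M * S" for s
  proof -
    have "\<bar>F s\<bar> \<le> (e2 * \<bar>s\<bar> powr (p - 1) + M) * \<bar>s\<bar>"
    proof (rule primitive_growth[OF F F0])
      fix t assume "\<bar>t\<bar> \<le> \<bar>s\<bar>"
      then have "e2 * \<bar>t\<bar> powr (p - 1) \<le> e2 * \<bar>s\<bar> powr (p - 1)"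
        using e2 p by (intro mult_left_mono powr_mono2) auto
      then show "\<bar>f t\<bar> \<le> e2 * \<bar>s\<bar> powr (p - 1) + M" using f_bound[of t] by linarith
    qed
    also have "\<dots> = e2 * \<bar>s\<bar> powr p + M * \<bar>s\<bar>"
      using powr_mult_base[of "\<bar>s\<bar>" "p - 1"] by (simp add: distrib_right mult.assoc) (simp add: mult.commute)
    also have "M * \<bar>s\<bar> \<le> e2 * \<bar>s\<bar> powr p + M * S"
    proof (cases "\<bar>s\<bar> \<le> S")
      case True
      have "M * \<bar>s\<bar> \<le> M * S" using M True by (intro mult_left_mono) auto
      then show ?thesis using e2 by (simp add: add_increasing)
    next
      case False
      have "S powr (p - 1) \<le> \<bar>s\<bar> powr (p - 1)"
        using False p by (intro powr_mono2) (auto simp: S_def)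
      then have "M / e2 \<le> \<bar>s\<bar> powr (p - 1)"
        using p M e2 by (simp add: S_def powr_powr)
      then have "M \<le> e2 * \<bar>s\<bar> powr (p - 1)" using e2 by (simp add: field_simps)
      then have "M * \<bar>s\<bar> \<le> e2 * \<bar>s\<bar> powr (p - 1) * \<bar>s\<bar>" by (intro mult_right_mono) auto
      also have "\<dots> = e2 * \<bar>s\<bar> powr p"
        using powr_mult_base[of "\<bar>s\<bar>" "p - 1"] by (simp add: mult.assoc) (simp add: mult.commute)
      finally show ?thesis using M by (simp add: S_def add_increasing2)
    qed
    finally show ?thesis by (simp add: e2_def)
  qed
  then show thesis using that by blast
qed

text \<open>The growth bound applied to F(s) - (f0/p) |s|^p, whose derivative f - f0 phi_p is small
  compared with |s|^(p-1) near 0.\<close>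

lemma primitive_near_zero:
  fixes F f :: "real \<Rightarrow> real"
  assumes p: "p > 1" and f0: "((\<lambda>s. f s / phi_p p s) \<longlongrightarrow> f0) (at 0)" and f_0: "f 0 = 0"
    and F: "\<And>s. (F has_real_derivative f s) (at s)" and F0: "F 0 = 0" and e: "e > 0"
  obtains d where "d > 0" "\<And>s. \<bar>s\<bar> < d \<Longrightarrow> \<bar>F s - f0 / p * \<bar>s\<bar> powr p\<bar> \<le> e * \<bar>s\<bar> powr p"
proof -
  obtain d where d: "d > 0" "\<And>s. s \<noteq> 0 \<Longrightarrow> \<bar>s\<bar> < d \<Longrightarrow> \<bar>f s / phi_p p s - f0\<bar> < e"
    using f0 e unfolding tendsto_iff eventually_at dist_real_def by auto
  have f_close: "\<bar>f t - f0 * phi_p p t\<bar> \<le> e * \<bar>t\<bar> powr (p - 1)" if "\<bar>t\<bar> < d" for t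
  proof (cases "t = 0")
    case False
    have ne: "phi_p p t \<noteq> 0" using False sgn_phi_p[of p t] by (metis sgn_0_0)
    have "\<bar>f t - f0 * phi_p p t\<bar> = \<bar>f t / phi_p p t - f0\<bar> * \<bar>phi_p p t\<bar>"
      using ne by (simp add: abs_mult[symmetric] left_diff_distrib)
    also have "\<dots> \<le> e * \<bar>phi_p p t\<bar>"
      using d(2)[OF False that] by (intro mult_right_mono) auto
    finally show ?thesis by (simp add: abs_phi_p)
  qed (simp add: f_0)
  have "\<bar>F s - f0 / p * \<bar>s\<bar> powr p\<bar> \<le> e * \<bar>s\<bar> powr p" if s: "\<bar>s\<bar> < d" for s
  proof -
    have dH: "((\<lambda>s. F s - f0 / p * \<bar>s\<bar> powr p) has_real_derivative f t - f0 * phi_p p t) (at t)" for t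
      using DERIV_diff[OF F DERIV_cmult[OF DERIV_abs_powr[OF p], of "f0 / p"]] p by simp
    have "\<bar>F s - f0 / p * \<bar>s\<bar> powr p\<bar> \<le> e * \<bar>s\<bar> powr (p - 1) * \<bar>s\<bar>"
    proof (rule primitive_growth[OF dH])
      show "F 0 - f0 / p * \<bar>0\<bar> powr p = 0" using F0 by simp
      fix t assume t: "\<bar>t\<bar> \<le> \<bar>s\<bar>"
      have "e * \<bar>t\<bar> powr (p - 1) \<le> e * \<bar>s\<bar> powr (p - 1)"
        using e p t by (intro mult_left_mono powr_mono2) auto
      then show "\<bar>f t - f0 * phi_p p t\<bar> \<le> e * \<bar>s\<bar> powr (p - 1)"
        using f_close[of t] t s by linarith
    qed
    then show ?thesis
      using powr_mult_base[of "\<bar>s\<bar>" "p - 1"] by (simp add: mult.assoc) (simp add: mult.commute)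
  qed
  then show thesis using that d(1) by blast
qed

text \<open>The limits at 0 and at infinity settle small and large \<open>s\<close>, compactness the
  range between. The bound supplies the constant \<open>B\<close> of
  \<open>periodic_nonneg_solution_positive\<close>.\<close>

lemma phi_p_bound_exists:
  assumes p: "p > 1" and f: "continuous_on UNIV f" and f_0: "f 0 = 0"
    and f0: "((\<lambda>s. f s / phi_p p s) \<longlongrightarrow> f0) (at 0)"
    and f_inf: "((\<lambda>s. f s / phi_p p s) \<longlongrightarrow> 0) at_infinity"
  obtains C where "C > 0" "\<And>s. \<bar>f s\<bar> \<le> C * \<bar>s\<bar> powr (p - 1)"
proof -
  obtain d where d: "d > 0" "\<And>s. s \<noteq> 0 \<Longrightarrow> \<bar>s\<bar> < d \<Longrightarrow> \<bar>f s / phi_p p s - f0\<bar> < 1"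
    using f0 unfolding tendsto_iff eventually_at dist_real_def by (auto dest: spec[where x = 1])
  obtain R where R: "R > 0" "\<And>s. \<bar>s\<bar> \<ge> R \<Longrightarrow> \<bar>f s / phi_p p s\<bar> < 1"
    using f_inf[unfolded Lim_at_infinity dist_real_def, rule_format, of 1]
    by (metis (no_types, lifting) diff_zero dual_order.trans gt_ex less_eq_real_def linorder_not_le real_norm_def zero_less_one)
  obtain M where M: "M > 0" "\<And>s. s \<in> {-R..R} \<Longrightarrow> \<bar>f s\<bar> \<le> M"
    using continuous_on_Icc_bounded[OF continuous_on_subset[OF f subset_UNIV]] by metis
  define D where "D = M / d powr (p - 1)"
  have D: "D > 0" using M d by (simp add: D_def)
  define C where "C = \<bar>f0\<bar> + 1 + D"
  have C: "C \<ge> \<bar>f0\<bar> + 1" "C \<ge> D" "C > 0" using D by (auto simp: C_def)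
  have "\<bar>f s\<bar> \<le> C * \<bar>s\<bar> powr (p - 1)" for s
  proof -
    have quot: "\<bar>f s\<bar> = \<bar>f s / phi_p p s\<bar> * \<bar>s\<bar> powr (p - 1)" if "s \<noteq> 0"
      using that by (simp add: abs_divide abs_phi_p)
    consider "s = 0" | "s \<noteq> 0" "\<bar>s\<bar> < d" | "\<bar>s\<bar> \<ge> R" | "\<bar>s\<bar> \<ge> d" "\<bar>s\<bar> < R" by linarith
    then show ?thesis
    proof cases
      case 2
      then have "\<bar>f s / phi_p p s\<bar> \<le> C" using d(2)[of s] C by linarith
      then show ?thesis using quot[OF 2(1)] by (metis mult_right_mono powr_ge_zero)
    next
      case 3
      then have "\<bar>f s / phi_p p s\<bar> \<le> C" using R(2)[of s] C by linarith
      moreover have "s \<noteq> 0" using 3 R by auto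
      ultimately show ?thesis using quot by (metis mult_right_mono powr_ge_zero)
    next
      case 4
      have "\<bar>f s\<bar> \<le> M" using 4 by (intro M) auto
      also have "M = D * d powr (p - 1)" using d by (simp add: D_def)
      also have "\<dots> \<le> C * \<bar>s\<bar> powr (p - 1)"
        using 4 C D d p by (intro mult_mono powr_mono2) auto
      finally show ?thesis .
    qed (simp add: f_0)
  qed
  then show thesis using that C(3) by blast
qed

lemma even_primitive_exists:
  fixes f :: "real \<Rightarrow> real"
  assumes f: "continuous_on UNIV f" and odd: "\<And>s. f (- s) = - f s"
  obtains F where "\<And>s. (F has_real_derivative f s) (at s)" "F 0 = 0" "\<And>s. F (- s) = F s"
proof -
  obtain G where G: "\<And>s. (G has_real_derivative f s) (at s)"
    using einterval_antiderivative[of "-\<infinity>" "\<infinity>" f] f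
    by (auto simp: continuous_on_eq_continuous_at has_real_derivative_iff_has_vector_derivative)
  define F where "F s = G s - G 0" for s
  have F: "(F has_real_derivative f s) (at s)" for s
    unfolding F_def using G by (auto intro!: derivative_eq_intros)
  have "((\<lambda>s. F (- s) - F s) has_real_derivative 0) (at s)" for s
  proof -
    have "((\<lambda>s. F (- s)) has_real_derivative f (- s) * (- 1)) (at s)"
      by (rule DERIV_chain2[where g = uminus, OF F]) (auto intro!: derivative_eq_intros)
    then show ?thesis
      using DERIV_diff[OF _ F[of s], of "\<lambda>s. F (- s)"] odd by fastforce
  qed
  then have "F (- s) - F s = F (- 0) - F 0" for s
    using DERIV_isconst_all[of "\<lambda>s. F (- s) - F s" s 0] by blast
  then have "F (- s) = F s" for s by (simp only: minus_zero diff_self right_minus_eq)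
  moreover have "F 0 = 0" by (simp add: F_def)
  ultimately show thesis using that F by blast
qed

subsection \<open>Existence of one-signed solutions\<close>

lemma nonneg_of_grid_limit:
  assumes T: "T > 0" and N: "filterlim N at_top sequentially"
    and U: "continuous_on {0..T} U" and v: "\<And>n i. v n i \<ge> 0"
    and conv: "\<And>e. e > 0 \<Longrightarrow> \<forall>\<^sub>F n in sequentially. \<forall>i\<le>N n. \<bar>v n i - U (node T (N n) i)\<bar> < e"
    and x: "x \<in> {0..T}"
  shows "U x \<ge> (0 :: real)"
proof (rule ccontr)
  assume neg: "\<not> U x \<ge> 0"
  define e where "e = - U x / 2"
  have e: "e > 0" using neg by (simp add: e_def)
  obtain d where d: "d > 0" "\<And>y. y \<in> {0..T} \<Longrightarrow> \<bar>y - x\<bar> < d \<Longrightarrow> \<bar>U y - U x\<bar> < e"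
    using U x e unfolding continuous_on_iff dist_real_def by metis
  have "\<forall>\<^sub>F n in sequentially. N n \<ge> nat \<lceil>T / d\<rceil> + 1"
    using N by (simp add: filterlim_at_top)
  then have "\<forall>\<^sub>F n::nat in sequentially. False"
    using conv[OF e]
  proof eventually_elim
    case (elim n)
    have M: "N n > 0" "T / d < real (N n)"
      using elim(1) by linarith+
    have h: "T / real (N n) < d"
      using M d T by (auto simp: field_simps)
    obtain k where k: "k \<le> N n" "\<bar>x - node T (N n) k\<bar> \<le> T / real (N n)"
      using node_floor[OF T M(1) x] by blast
    have "\<bar>U (node T (N n) k) - U x\<bar> < e"
      using k h by (intro d(2) node_mem[OF T]) auto
    moreover have "\<bar>v n k - U (node T (N n) k)\<bar> < e"
      using elim(2) k(1) by blast
    ultimately show ?case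
      using v[of n k] unfolding e_def by linarith
  qed
  then show False by simp
qed

text \<open>By the behaviour of \<open>F\<close> at 0 the action of t w is t^p (E(w) - f0 M(w)) / p
  up to an error small compared with t^p, where E is the energy and M the weight integral. One small
  \<open>t\<close> serves all fine grids, and the gap \<delta> does not depend on \<open>n\<close>,
  so it can be carried to the limit.\<close>

lemma daction_scaled_samples_negative:
  assumes T: "T > 0" and p: "p > 1" and q: "continuous_on {0..T} q" and m: "continuous_on {0..T} m"
    and F: "\<And>e. e > 0 \<Longrightarrow> \<exists>d>0. \<forall>s. \<bar>s\<bar> < d \<longrightarrow> \<bar>F s - f0 / p * \<bar>s\<bar> powr p\<bar> \<le> e * \<bar>s\<bar> powr p"
    and w: "W1p_periodic p T w z"
    and E: "energy p T q w z < f0 * integral {0..T} (\<lambda>x. m x * \<bar>w x\<bar> powr p)"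
  obtains t \<delta> where "\<delta> > 0"
    "\<forall>\<^sub>F n in sequentially. daction p T q m F n (\<lambda>i. t * w (node T n i)) \<le> - \<delta>"
proof -
  define M where "M = integral {0..T} (\<lambda>x. m x * \<bar>w x\<bar> powr p)"
  define Z where "Z = integral {0..T} (\<lambda>x. \<bar>z x\<bar> powr p)"
  \<comment> \<open>The error budget, up to the factor \<open>t powr p\<close>: quadrature may cost
    \<kappa>/4 and replacing \<open>F\<close> by its leading term another \<kappa>/4, which leaves
    \<kappa>/2.\<close>
  define \<kappa> where "\<kappa> = (f0 * M - energy p T q w z) / p"
  have \<kappa>: "\<kappa> > 0" using E p by (simp add: \<kappa>_def M_def)
  have w_cont: "continuous_on {0..T} w" using w by (simp add: W1p_periodic_def)
  obtain K where K: "K > 0" "\<And>x. x \<in> {0..T} \<Longrightarrow> \<bar>m x\<bar> \<le> K"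
    using continuous_on_Icc_bounded[OF m] by metis
  obtain B where B: "B > 0" "\<And>x. x \<in> {0..T} \<Longrightarrow> \<bar>w x\<bar> \<le> B"
    using continuous_on_Icc_bounded[OF w_cont] by metis
  define \<epsilon> where "\<epsilon> = \<kappa> / (4 * (K * T * B powr p))"
  have \<epsilon>: "\<epsilon> > 0" using \<kappa> K T B by (simp add: \<epsilon>_def)
  have \<epsilon>_eq: "T * (K * (\<epsilon> * B powr p)) = \<kappa> / 4" using K T B by (simp add: \<epsilon>_def)
  obtain d where d: "d > 0" "\<And>s. \<bar>s\<bar> < d \<Longrightarrow> \<bar>F s - f0 / p * \<bar>s\<bar> powr p\<bar> \<le> \<epsilon> * \<bar>s\<bar> powr p"
    using F[OF \<epsilon>] by blast
  \<comment> \<open>This keeps \<open>t * w\<close> at most d/2 in modulus, where the leading term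
    of \<open>F\<close> is accurate.\<close>
  define t where "t = d / (2 * B)"
  have t: "t > 0" using d B by (simp add: t_def)
  have id: "filterlim (\<lambda>n::nat. n) at_top sequentially" by (rule filterlim_ident)
  have "(\<lambda>n. (Z + dweight p T q n (\<lambda>i. w (node T n i)) - f0 * dweight p T m n (\<lambda>i. w (node T n i))) / p)
      \<longlonglongrightarrow> (Z + integral {0..T} (\<lambda>x. q x * \<bar>w x\<bar> powr p) - f0 * M) / p"
    unfolding M_def using p
    by (intro tendsto_divide tendsto_diff tendsto_add tendsto_mult tendsto_const
        dweight_samples_limit[OF T p id w_cont q] dweight_samples_limit[OF T p id w_cont m]) auto
  moreover have "(Z + integral {0..T} (\<lambda>x. q x * \<bar>w x\<bar> powr p) - f0 * M) / p = - \<kappa>"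
    by (simp add: \<kappa>_def energy_eq_integral[OF p q w] Z_def minus_divide_left)
  ultimately have "\<forall>\<^sub>F n in sequentially. (Z + dweight p T q n (\<lambda>i. w (node T n i))
      - f0 * dweight p T m n (\<lambda>i. w (node T n i))) / p < - (3 / 4 * \<kappa>)"
    using \<kappa> by (intro order_tendstoD(2)) auto
  then have "\<forall>\<^sub>F n in sequentially. daction p T q m F n (\<lambda>i. t * w (node T n i)) \<le> - (t powr p * (\<kappa> / 2))"
    using eventually_ge_at_top[of 1]
  proof eventually_elim
    case (elim n)
    have n: "n > 0" using elim by simp
    define v where "v i = w (node T n i)" for i
    have term_bound: "T / real n * (m (node T n i) * F (t * v i))
        \<ge> t powr p * (f0 / p) * (T / real n * (m (node T n i) * \<bar>v i\<bar> powr p))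
          - T / real n * (K * (\<epsilon> * (t powr p * B powr p)))" if i: "i < n" for i
    proof -
      have mem: "node T n i \<in> {0..T}" using node_mem[OF T] i by simp
      have "\<bar>t * v i\<bar> \<le> t * B"
        using B(2)[OF mem] t by (simp add: v_def abs_mult)
      also have "\<dots> < d" using d B by (simp add: t_def)
      finally have "\<bar>F (t * v i) - f0 / p * \<bar>t * v i\<bar> powr p\<bar> \<le> \<epsilon> * \<bar>t * v i\<bar> powr p"
        by (rule d(2))
      also have "\<dots> \<le> \<epsilon> * (t powr p * B powr p)"
        using B(2)[OF mem] t \<epsilon> p
        by (auto simp: v_def abs_mult powr_mult intro!: mult_left_mono powr_mono2)
      finally have F_close: "\<bar>F (t * v i) - f0 / p * \<bar>t * v i\<bar> powr p\<bar> \<le> \<epsilon> * (t powr p * B powr p)" .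
      have "\<bar>m (node T n i) * (F (t * v i) - f0 / p * \<bar>t * v i\<bar> powr p)\<bar> \<le> K * (\<epsilon> * (t powr p * B powr p))"
        unfolding abs_mult[of "m (node T n i)"]
        by (rule mult_mono[OF K(2)[OF mem] F_close less_imp_le[OF K(1)] abs_ge_zero])
      then have "m (node T n i) * F (t * v i)
          \<ge> m (node T n i) * (f0 / p * \<bar>t * v i\<bar> powr p) - K * (\<epsilon> * (t powr p * B powr p))"
        by (simp only: right_diff_distrib)
      then have "T / real n * (m (node T n i) * F (t * v i))
          \<ge> T / real n * (m (node T n i) * (f0 / p * \<bar>t * v i\<bar> powr p) - K * (\<epsilon> * (t powr p * B powr p)))"
        using T by (intro mult_left_mono) auto
      moreover have "\<bar>t * v i\<bar> powr p = t powr p * \<bar>v i\<bar> powr p"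
        using t by (simp add: abs_mult powr_mult)
      ultimately show ?thesis
        by (simp only: right_diff_distrib mult_ac)
    qed
    have "(\<Sum>i<n. T / real n * (m (node T n i) * F (t * v i)))
        \<ge> (\<Sum>i<n. t powr p * (f0 / p) * (T / real n * (m (node T n i) * \<bar>v i\<bar> powr p))
          - T / real n * (K * (\<epsilon> * (t powr p * B powr p))))"
      by (intro sum_mono) (use term_bound in auto)
    also have "(\<Sum>i<n. t powr p * (f0 / p) * (T / real n * (m (node T n i) * \<bar>v i\<bar> powr p))
          - T / real n * (K * (\<epsilon> * (t powr p * B powr p))))
        = t powr p * (f0 / p) * dweight p T m n v - T * (K * (\<epsilon> * (t powr p * B powr p)))"
      unfolding dweight_def sum_subtractf sum_distrib_left[symmetric] using n by simp
    also have "T * (K * (\<epsilon> * (t powr p * B powr p))) = t powr p * (\<kappa> / 4)"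
      unfolding \<epsilon>_eq[symmetric] by (simp only: mult_ac)
    finally have F_sum: "(\<Sum>i<n. T / real n * (m (node T n i) * F (t * v i)))
        \<ge> t powr p * (f0 / p * dweight p T m n v - \<kappa> / 4)"
      by (simp only: right_diff_distrib mult.assoc)
    have "denergy p T q n v \<le> Z + dweight p T q n v"
      unfolding v_def Z_def by (rule denergy_samples_le[OF T p w n])
    then have "denergy p T q n v / p - f0 / p * dweight p T m n v
        \<le> (Z + dweight p T q n v - f0 * dweight p T m n v) / p"
      using p by (simp add: field_simps)
    then have bracket: "denergy p T q n v / p - f0 / p * dweight p T m n v + \<kappa> / 4 \<le> - (\<kappa> / 2)"
      using elim(1) unfolding v_def[symmetric] by linarith
    have "daction p T q m F n (\<lambda>i. t * v i)
        = t powr p * (denergy p T q n v / p) - (\<Sum>i<n. T / real n * (m (node T n i) * F (t * v i)))"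
      using t by (simp add: daction_def denergy_scale)
    also have "\<dots> \<le> t powr p * (denergy p T q n v / p) - t powr p * (f0 / p * dweight p T m n v - \<kappa> / 4)"
      using F_sum by linarith
    also have "\<dots> = t powr p * (denergy p T q n v / p - f0 / p * dweight p T m n v + \<kappa> / 4)"
      by (simp add: algebra_simps)
    also have "\<dots> \<le> t powr p * (- (\<kappa> / 2))"
      by (intro mult_left_mono bracket) simp
    finally show ?case by (simp add: v_def)
  qed
  moreover have "t powr p * (\<kappa> / 2) > 0" using t \<kappa> by simp
  ultimately show thesis using that by blast
qed

text \<open>Oddness of \<open>f\<close> gives an even primitive, on which nonnegativity of the
  minimisers rests. The condition on the parameter arrives in the form \<open>E\<close>, with the
  parameter already contained in \<open>m\<close>.\<close>

lemma positive_solution_odd: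
  assumes T: "T > 0" and p: "p > 1" and q: "continuous_on {0..T} q" "\<And>x. x \<in> {0..T} \<Longrightarrow> q x \<ge> 0"
    "\<exists>x\<in>{0..T}. q x \<noteq> 0" and m: "continuous_on {0..T} m"
    and f: "continuous_on UNIV f" and odd: "\<And>s. f (- s) = - f s"
    and f0: "((\<lambda>s. f s / phi_p p s) \<longlongrightarrow> f0) (at 0)"
    and f_inf: "((\<lambda>s. f s / phi_p p s) \<longlongrightarrow> 0) at_infinity"
    and w: "W1p_periodic p T w z"
    and E: "energy p T q w z < f0 * integral {0..T} (\<lambda>x. m x * \<bar>w x\<bar> powr p)"
  obtains u where "classical_solution p T q m f 1 u" "\<forall>x\<in>{0..T}. u x > 0"
proof -
  have f_0: "f 0 = 0" using odd[of 0] by simp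
  obtain F where F: "\<And>s. (F has_real_derivative f s) (at s)" "F 0 = 0" "\<And>s. F (- s) = F s"
    using even_primitive_exists[OF f odd] by metis
  have F_cont: "continuous_on UNIV F"
    using F(1) by (meson DERIV_isCont continuous_at_imp_continuous_on)
  obtain c where c: "c > 0"
      "\<forall>\<^sub>F N in sequentially. \<forall>u j. j \<le> N \<longrightarrow> c * \<bar>u j\<bar> powr p \<le> denergy p T q N u"
    by (rule eventually_coercive[OF T p q])
  obtain K where K: "K > 0" "\<And>x. x \<in> {0..T} \<Longrightarrow> \<bar>m x\<bar> \<le> K"
    using continuous_on_Icc_bounded[OF m] by metis
  have "c / (2 * p) / (K * T) > 0" using c K T p by simp
  then obtain C0 where C0: "\<And>s. \<bar>F s\<bar> \<le> c / (2 * p) / (K * T) * \<bar>s\<bar> powr p + C0"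
    using sublinear_primitive_bound[OF p f f_inf F(1,2)] by metis
  define C where "C = K * T * C0"
  have F_growth: "K * T * \<bar>F s\<bar> \<le> c / (2 * p) * \<bar>s\<bar> powr p + C" for s
  proof -
    have "K * T * \<bar>F s\<bar> \<le> K * T * (c / (2 * p) / (K * T) * \<bar>s\<bar> powr p + C0)"
      using C0[of s] K T by (intro mult_left_mono) auto
    also have "\<dots> = c / (2 * p) * \<bar>s\<bar> powr p + C"
      using K T by (simp add: C_def distrib_left)
    finally show ?thesis .
  qed
  have F_near: "\<exists>d>0. \<forall>s. \<bar>s\<bar> < d \<longrightarrow> \<bar>F s - f0 / p * \<bar>s\<bar> powr p\<bar> \<le> e * \<bar>s\<bar> powr p" if "e > 0" for e
    using primitive_near_zero[OF p f0 f_0 F(1,2) that] by metis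
  obtain t \<delta> where \<delta>: "\<delta> > 0"
      "\<forall>\<^sub>F n in sequentially. daction p T q m F n (\<lambda>i. t * w (node T n i)) \<le> - \<delta>"
    by (rule daction_scaled_samples_negative[OF T p q(1) m F_near w E])
  have "\<forall>\<^sub>F n in sequentially. daction p T q m F n (\<lambda>i. t * w (node T n i)) \<le> - \<delta> \<and>
      (\<forall>u j. j \<le> n \<longrightarrow> c * \<bar>u j\<bar> powr p \<le> denergy p T q n u) \<and> n \<ge> 1"
    using c(2) \<delta>(2) eventually_ge_at_top[of 1] by eventually_elim blast
  then obtain n0 where n0: "\<And>n. n \<ge> n0 \<Longrightarrow> daction p T q m F n (\<lambda>i. t * w (node T n i)) \<le> - \<delta>"
      "\<And>n u j. n \<ge> n0 \<Longrightarrow> j \<le> n \<Longrightarrow> c * \<bar>u j\<bar> powr p \<le> denergy p T q n u"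
      "\<And>n. n \<ge> n0 \<Longrightarrow> n \<ge> 1"
    unfolding eventually_sequentially by blast
  define N where "N n = n + n0" for n :: nat
  have N: "filterlim N at_top sequentially"
    unfolding N_def by (rule filterlim_add_const_nat_at_top)
  have Nn0: "N n \<ge> n0" for n by (simp add: N_def)
  have Npos: "N n > 0" for n using n0(3)[OF Nn0, of n] by simp
  define R where "R = (2 * p * C / c) powr (1 / p)"
  have "\<exists>u. u (N n) = u 0 \<and> (\<forall>i. u i \<ge> 0) \<and> (\<forall>i\<le>N n. u i \<le> R) \<and>
      (\<forall>z. z (N n) = z 0 \<longrightarrow> daction p T q m F (N n) u \<le> daction p T q m F (N n) z)" for n
    unfolding R_def
    by (rule discrete_action_minimizer[OF T p Npos c(1) n0(2)[OF Nn0] K(2) F_growth F_cont F(3,2)]) blast+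
  then obtain u where u: "\<And>n. u n (N n) = u n 0" "\<And>n i. u n i \<ge> 0" "\<And>n i. i \<le> N n \<Longrightarrow> u n i \<le> R"
      "\<And>n z. z (N n) = z 0 \<Longrightarrow> daction p T q m F (N n) (u n) \<le> daction p T q m F (N n) z"
    by metis
  have u_bound: "\<bar>u n i\<bar> \<le> R" if "i \<le> N n" for n i using u(2,3) that by simp
  define y where "y n = dflux p (T / real (N n)) (N n) (u n)" for n
  have h: "T / real (N n) > 0" for n using T Npos by simp
  have u_step: "u n (Suc i) - u n i = T / real (N n) * phi_p (p / (p - 1)) (y n (Suc i))" for n i
    unfolding y_def by (rule dflux_step[OF p h])
  have y_step: "y n (Suc i) - y n i = T / real (N n) *
      (q (node T (N n) i) * phi_p p (u n i) - 1 * m (node T (N n) i) * f (u n i))"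
    if "i < N n" for n i
    unfolding y_def mult_1_left by (rule discrete_action_equation[OF T p Npos F(1) u(4) u(1) that])
  have y_per: "y n (N n) = y n 0" for n
    unfolding y_def by (rule dflux_periodic[OF u(1) Npos])
  have one: "\<bar>1\<bar> \<le> (1::real)" by simp
  obtain r U W l where lim: "strict_mono (r :: nat \<Rightarrow> nat)" "(\<lambda>n. 1) \<longlonglongrightarrow> (l :: real)"
    "\<forall>x\<in>{0..T}. (U has_real_derivative phi_p (p / (p - 1)) (W x)) (at x within {0..T})"
    "\<forall>x\<in>{0..T}. (W has_real_derivative q x * phi_p p (U x) - l * m x * f (U x)) (at x within {0..T})"
    "U 0 = U T" "W 0 = W T"
    "\<forall>e>0. \<forall>\<^sub>F n in sequentially. \<forall>i\<le>N (r n).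
        \<bar>u (r n) i - U (node T (N (r n)) i)\<bar> < e \<and> \<bar>y (r n) i - W (node T (N (r n)) i)\<bar> < e"
    by (rule discrete_solutions_limit[where lam = "\<lambda>n. 1",
          OF T p q(1) m f N Npos u_step y_step u(1) y_per u_bound one])
  have l: "l = 1" using lim(2) by (simp add: LIMSEQ_const_iff)
  have Nr: "filterlim (\<lambda>n. N (r n)) at_top sequentially"
    by (rule filterlim_compose[OF N]) (rule filterlim_subseq[OF lim(1)])
  have U_cont: "continuous_on {0..T} U" and W_cont: "continuous_on {0..T} W"
    using DERIV_continuous_on[OF lim(3)[rule_format]] DERIV_continuous_on[OF lim(4)[rule_format]] by simp_all
  have conv: "\<forall>\<^sub>F n in sequentially. \<forall>i\<le>N (r n). \<bar>u (r n) i - U (node T (N (r n)) i)\<bar> < e" if "e > 0" for e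
    using lim(7)[rule_format, OF that] by (auto elim: eventually_mono)
  have U_nonneg: "U x \<ge> 0" if "x \<in> {0..T}" for x
    by (rule nonneg_of_grid_limit[where v = "\<lambda>n. u (r n)", OF T Nr U_cont u(2) conv that])
  have "(\<lambda>n. \<Sum>i<N (r n). T / real (N (r n)) * (m (node T (N (r n)) i) * F (u (r n) i)))
      \<longlonglongrightarrow> integral {0..T} (\<lambda>x. m x * F (U x))"
    by (rule grid_sum_limit(1)[OF T Nr U_cont F_cont m conv])
  \<comment> \<open>The energy is dropped as nonnegative, so the gap passes to the weight term,
    which converges by convergence of values alone.\<close>
  moreover have "\<delta> \<le> (\<Sum>i<N n. T / real (N n) * (m (node T (N n) i) * F (u n i)))" for n
  proof -
    have "w T = w 0" using w by (simp add: W1p_periodic_def)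
    then have "daction p T q m F (N n) (u n) \<le> - \<delta>"
      using u(4)[of "\<lambda>i. t * w (node T (N n) i)" n] n0(1)[OF Nn0, of n] Npos[of n] by simp
    moreover have "denergy p T q (N n) (u n) / p \<ge> 0"
      using denergy_nonneg[OF T q(2)] p by simp
    ultimately show ?thesis unfolding daction_def by linarith
  qed
  ultimately have int: "\<delta> \<le> integral {0..T} (\<lambda>x. m x * F (U x))"
    by (intro LIMSEQ_le_const) auto
  have "\<exists>x\<in>{0..T}. U x \<noteq> 0"
  proof (rule ccontr)
    assume "\<not> ?thesis"
    then have "integral {0..T} (\<lambda>x. m x * F (U x)) = integral {0..T} (\<lambda>x. 0 :: real)"
      by (intro Henstock_Kurzweil_Integration.integral_cong) (simp add: F(2))
    then show False using int \<delta>(1) by simp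
  qed
  then obtain x1 where x1: "x1 \<in> {0..T}" "U x1 \<noteq> 0" by blast
  obtain Q where Q: "Q > 0" "\<And>x. x \<in> {0..T} \<Longrightarrow> \<bar>q x\<bar> \<le> Q"
    using continuous_on_Icc_bounded[OF q(1)] by metis
  obtain D where D: "D > 0" "\<And>s. \<bar>f s\<bar> \<le> D * \<bar>s\<bar> powr (p - 1)"
    using phi_p_bound_exists[OF p f f_0 f0 f_inf] by metis
  have W'_bound: "\<bar>q x * phi_p p (U x) - l * m x * f (U x)\<bar> \<le> (Q + K * D) * \<bar>U x\<bar> powr (p - 1)"
    if x: "x \<in> {0..T}" for x
  proof -
    have "\<bar>q x * phi_p p (U x)\<bar> \<le> Q * \<bar>U x\<bar> powr (p - 1)"
      unfolding abs_mult abs_phi_p by (intro mult_right_mono Q(2)[OF x]) simp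
    moreover have "\<bar>l * m x * f (U x)\<bar> \<le> K * (D * \<bar>U x\<bar> powr (p - 1))"
      unfolding l mult_1_left abs_mult using K(1) by (intro mult_mono K(2)[OF x] D(2)) auto
    ultimately show ?thesis
      by (simp add: distrib_right mult.assoc)
  qed
  have "Q + K * D \<ge> 0" using Q K D by simp
  then have pos: "U x > 0" if x: "x \<in> {0..T}" for x
    by (rule periodic_nonneg_solution_positive[OF T p _ lim(3)[rule_format] lim(4)[rule_format]
          W'_bound lim(5,6) U_nonneg x1 x])
  have "classical_solution p T q m f 1 U"
    unfolding classical_solution_def
  proof (intro exI conjI ballI)
    show "(U has_real_derivative phi_p (p / (p - 1)) (W x)) (at x within {0..T})" if "x \<in> {0..T}" for x
      using lim(3) that by blast
    show "continuous_on {0..T} (\<lambda>x. phi_p (p / (p - 1)) (W x))"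
      by (rule continuous_on_phi_p[OF conjugate_exponent_gt_1[OF p] W_cont])
    \<comment> \<open>Applying \<open>phi_p p\<close> to the slope returns \<open>W\<close>, so
      \<open>phi_p\<close> itself is never differentiated.\<close>
    show "((\<lambda>y. phi_p p (phi_p (p / (p - 1)) (W y))) has_real_derivative
        q x * phi_p p (U x) - l * m x * f (U x)) (at x)" if x: "x \<in> {0<..<T}" for x
    proof -
      have "x \<in> {0..T}" "at x within {0..T} = at x"
        using x by (auto intro!: at_within_Icc_at)
      then show ?thesis
        using lim(4) unfolding phi_p_inverse[OF p] by force
    qed
    show "- (q x * phi_p p (U x) - l * m x * f (U x)) + q x * phi_p p (U x) = 1 * m x * f (U x)" for x
      by (simp add: l)
    show "U 0 = U T" by (rule lim(5))
    show "phi_p (p / (p - 1)) (W 0) = phi_p (p / (p - 1)) (W T)" by (simp add: lim(6))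
  qed
  then show thesis using pos that by blast
qed

text \<open>The quotient by \<open>phi_p\<close> becomes even, g(s)/phi_p(s) = f(|s|)/phi_p(|s|), so
  both limits follow by composition with the absolute value.\<close>

lemma odd_extension_limits:
  assumes f: "continuous_on UNIV f" and f_0: "f 0 = 0"
    and f0: "((\<lambda>s. f s / phi_p p s) \<longlongrightarrow> f0) (at 0)"
    and f_inf: "((\<lambda>s. f s / phi_p p s) \<longlongrightarrow> 0) at_infinity"
  defines "g \<equiv> \<lambda>s. if s \<ge> 0 then f s else - f (- s)"
  shows "continuous_on UNIV g" "g (- s) = - g s"
    "((\<lambda>s. g s / phi_p p s) \<longlongrightarrow> f0) (at 0)" "((\<lambda>s. g s / phi_p p s) \<longlongrightarrow> 0) at_infinity"
proof -
  have "continuous_on ({s. s \<ge> 0} \<union> {s. s \<le> 0}) g"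
    unfolding g_def
    by (intro continuous_on_If closed_Collect_le continuous_intros continuous_on_compose2[OF f])
      (auto simp: f_0 order.antisym)
  moreover have "{s. s \<ge> 0} \<union> {s. s \<le> 0} = (UNIV :: real set)" by auto
  ultimately show "continuous_on UNIV g" by (simp only:)
  show "g (- s) = - g s" by (cases "s > 0"; cases "s = 0") (auto simp: g_def f_0)
  have quot: "g s / phi_p p s = f \<bar>s\<bar> / phi_p p \<bar>s\<bar>" for s
    by (auto simp: g_def abs_if)
  have "filterlim (\<lambda>s::real. \<bar>s\<bar>) (at 0) (at 0)"
  proof -
    have "((\<lambda>s::real. \<bar>s\<bar>) \<longlongrightarrow> \<bar>0\<bar>) (at 0)" by (intro tendsto_intros)
    then show ?thesis by (auto simp: filterlim_at eventually_at_filter)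
  qed
  then show "((\<lambda>s. g s / phi_p p s) \<longlongrightarrow> f0) (at 0)"
    unfolding quot by (rule filterlim_compose[OF f0])
  have "filterlim (\<lambda>s::real. \<bar>s\<bar>) at_infinity at_infinity"
    by (auto simp: filterlim_at_infinity[OF order_refl] eventually_at_infinity)
  then show "((\<lambda>s. g s / phi_p p s) \<longlongrightarrow> 0) at_infinity"
    unfolding quot by (rule filterlim_compose[OF f_inf])
qed

lemma reflected_limits:
  assumes f: "continuous_on UNIV f"
    and f0: "((\<lambda>s. f s / phi_p p s) \<longlongrightarrow> f0) (at 0)"
    and f_inf: "((\<lambda>s. f s / phi_p p s) \<longlongrightarrow> 0) at_infinity"
  shows "continuous_on UNIV (\<lambda>s. - f (- s))"
    "((\<lambda>s. - f (- s) / phi_p p s) \<longlongrightarrow> f0) (at 0)" "((\<lambda>s. - f (- s) / phi_p p s) \<longlongrightarrow> 0) at_infinity"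
proof -
  show "continuous_on UNIV (\<lambda>s. - f (- s))"
    by (intro continuous_intros continuous_on_compose2[OF f]) auto
  have quot: "- f (- s) / phi_p p s = f (- s) / phi_p p (- s)" for s by simp
  have "filterlim uminus (at 0) (at (0::real))"
  proof -
    have "((\<lambda>s::real. - s) \<longlongrightarrow> - 0) (at 0)" by (intro tendsto_intros)
    then show ?thesis by (auto simp: filterlim_at eventually_at_filter)
  qed
  then show "((\<lambda>s. - f (- s) / phi_p p s) \<longlongrightarrow> f0) (at 0)"
    unfolding quot by (rule filterlim_compose[OF f0])
  have "filterlim uminus at_infinity (at_infinity :: real filter)"
    by (auto simp: filterlim_at_infinity[OF order_refl] eventually_at_infinity)
  then show "((\<lambda>s. - f (- s) / phi_p p s) \<longlongrightarrow> 0) at_infinity"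
    unfolding quot by (rule filterlim_compose[OF f_inf])
qed

lemma classical_solution_uminus:
  assumes "classical_solution p T q m (\<lambda>s. - f (- s)) l u"
  shows "classical_solution p T q m f l (\<lambda>x. - u x)"
proof -
  obtain u' w where u: "\<forall>x\<in>{0..T}. (u has_real_derivative u' x) (at x within {0..T})"
      "continuous_on {0..T} u'"
      "\<forall>x\<in>{0<..<T}. ((\<lambda>y. phi_p p (u' y)) has_real_derivative w x) (at x) \<and>
            - w x + q x * phi_p p (u x) = l * m x * - f (- u x)"
      "u 0 = u T" "u' 0 = u' T"
    using assms unfolding classical_solution_def by blast
  have "((\<lambda>y. - phi_p p (u' y)) has_real_derivative - w x) (at x) \<and>
      - (- w x) + q x * - phi_p p (u x) = l * m x * f (- u x)" if "x \<in> {0<..<T}" for x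
  proof -
    have w: "((\<lambda>y. phi_p p (u' y)) has_real_derivative w x) (at x)"
      "- w x + q x * phi_p p (u x) = l * m x * - f (- u x)" using u(3) that by auto
    show ?thesis using DERIV_minus[OF w(1)] w(2) by simp
  qed
  then show ?thesis
    unfolding classical_solution_def using u(1,2,4,5)
    by (intro exI[of _ "\<lambda>x. - u' x"] exI[of _ "\<lambda>x. - w x"])
      (auto intro: DERIV_minus continuous_on_minus)
qed

lemma classical_solution_cong_positive:
  assumes "classical_solution p T q m f l u" "\<forall>x\<in>{0..T}. u x > 0" "\<And>s. s > 0 \<Longrightarrow> f s = g s"
  shows "classical_solution p T q m g l u"
proof -
  have eq: "f (u x) = g (u x)" if "x \<in> {0<..<T}" for x
    using assms(2,3) that by simp
  obtain u' w where u: "\<forall>x\<in>{0..T}. (u has_real_derivative u' x) (at x within {0..T})"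
      "continuous_on {0..T} u'"
      "\<forall>x\<in>{0<..<T}. ((\<lambda>y. phi_p p (u' y)) has_real_derivative w x) (at x) \<and>
            - w x + q x * phi_p p (u x) = l * m x * f (u x)"
      "u 0 = u T" "u' 0 = u' T"
    using assms(1) unfolding classical_solution_def by blast
  have "\<forall>x\<in>{0<..<T}. ((\<lambda>y. phi_p p (u' y)) has_real_derivative w x) (at x) \<and>
            - w x + q x * phi_p p (u x) = l * m x * g (u x)"
    using u(3) eq by metis
  then show ?thesis
    unfolding classical_solution_def using u(1,2,4,5) by blast
qed

text \<open>With \<open>l\<close> absorbed into the weight, \<open>E\<close> covers both signs of
  \<open>l\<close>. The odd extension agrees with \<open>f\<close> wherever a positive solution
  takes its values.\<close>

lemma positive_solution:
  assumes T: "T > 0" and p: "p > 1" and q: "continuous_on {0..T} q" "\<And>x. x \<in> {0..T} \<Longrightarrow> q x \<ge> 0"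
    "\<exists>x\<in>{0..T}. q x \<noteq> 0" and m: "continuous_on {0..T} m"
    and f: "continuous_on UNIV f" "f 0 = 0"
    and f0: "((\<lambda>s. f s / phi_p p s) \<longlongrightarrow> f0) (at 0)"
    and f_inf: "((\<lambda>s. f s / phi_p p s) \<longlongrightarrow> 0) at_infinity"
    and w: "W1p_periodic p T w z"
    and E: "energy p T q w z < f0 * integral {0..T} (\<lambda>x. (l * m x) * \<bar>w x\<bar> powr p)"
  obtains u where "classical_solution p T q m f l u" "\<forall>x\<in>{0..T}. u x > 0"
proof -
  define g where "g s = (if s \<ge> 0 then f s else - f (- s))" for s
  note g = odd_extension_limits[OF f f0 f_inf, folded g_def]
  have lm: "continuous_on {0..T} (\<lambda>x. l * m x)"
    by (intro continuous_intros m)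
  obtain u where u: "classical_solution p T q (\<lambda>x. l * m x) g 1 u" "\<forall>x\<in>{0..T}. u x > 0"
    using positive_solution_odd[OF T p q lm g w E] by metis
  have "classical_solution p T q (\<lambda>x. l * m x) f 1 u"
    by (rule classical_solution_cong_positive[OF u]) (simp add: g_def)
  then have "classical_solution p T q m f l u"
    unfolding classical_solution_def by simp
  then show thesis using u(2) that by blast
qed

theorem theorem5p2:
  fixes p T f0 :: real and q m f :: "real \<Rightarrow> real"
  assumes "T > 0" and "p > 1"
    and "continuous_on {0..T} q" and "\<forall>x\<in>{0..T}. q x \<ge> 0" and "\<exists>x\<in>{0..T}. q x \<noteq> 0"
    and "continuous_on {0..T} m" and "\<exists>x\<in>{0..T}. m x > 0" and "\<exists>x\<in>{0..T}. m x < 0"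
    and "continuous_on UNIV f" and "\<forall>s. s \<noteq> 0 \<longrightarrow> f s * s > 0"
    and "((\<lambda>s. f s / phi_p p s) \<longlongrightarrow> f0) (at 0)" and "f0 > 0"
    and "((\<lambda>s. f s / phi_p p s) \<longlongrightarrow> 0) at_infinity"
  shows "\<forall>l \<in> {lambda0_plus p T q m / f0 <..} \<union> {..< lambda0_minus p T q m / f0}.
           \<exists>u_pos u_neg.
             classical_solution p T q m f l u_pos \<and> (\<forall>x\<in>{0..T}. u_pos x > 0) \<and>
             classical_solution p T q m f l u_neg \<and> (\<forall>x\<in>{0..T}. u_neg x < 0)"
proof
  fix l assume l: "l \<in> {lambda0_plus p T q m / f0 <..} \<union> {..< lambda0_minus p T q m / f0}"
  note T = assms(1) and p = assms(2) and q = assms(3) bspec[OF assms(4)] assms(5) and m = assms(6)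
  have mm: "continuous_on {0..T} (\<lambda>x. - m x)" "\<exists>x\<in>{0..T}. - m x > 0"
    using m assms(8) by (auto intro: continuous_on_minus)
  obtain u v where plus: "W1p_periodic p T u v" "(LINT x|lebesgue_on {0<..<T}. m x * \<bar>u x\<bar> powr p) = 1"
    "\<forall>w z. W1p_periodic p T w z \<longrightarrow> (LINT x|lebesgue_on {0<..<T}. m x * \<bar>w x\<bar> powr p) = 1 \<longrightarrow>
      energy p T q u v \<le> energy p T q w z"
    by (rule principal_minimizer_exists[OF T p q m assms(7)])
  obtain u2 v2 where minus: "W1p_periodic p T u2 v2" "(LINT x|lebesgue_on {0<..<T}. - m x * \<bar>u2 x\<bar> powr p) = 1"
    "\<forall>w z. W1p_periodic p T w z \<longrightarrow> (LINT x|lebesgue_on {0<..<T}. - m x * \<bar>w x\<bar> powr p) = 1 \<longrightarrow>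
      energy p T q u2 v2 \<le> energy p T q w z"
    by (rule principal_minimizer_exists[OF T p q mm])
  have lam_plus: "lambda0_plus p T q m = energy p T q u v"
    unfolding lambda0_plus_def by (rule cInf_eq_minimum) (use plus in auto)
  have lam_minus: "lambda0_minus p T q m = - energy p T q u2 v2"
    unfolding lambda0_minus_def by (rule Greatest_equality) (use minus in auto)
  \<comment> \<open>Above the positive threshold the minimiser for \<open>m\<close> serves. Below
    the negative one the minimiser for \<open>- m\<close> does, its weight integral against
    \<open>l * m\<close> being \<open>- l\<close>. Either way the strict inequality is the threshold
    condition multiplied by \<open>f0\<close>.\<close>
  obtain w z where wz: "W1p_periodic p T w z"
      "energy p T q w z < f0 * integral {0..T} (\<lambda>x. (l * m x) * \<bar>w x\<bar> powr p)"
  proof (cases "l > lambda0_plus p T q m / f0")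
    case True
    have "integral {0..T} (\<lambda>x. m x * \<bar>u x\<bar> powr p) = 1"
      using plus(1,2) by (simp add: LINT_weight[OF p m] W1p_periodic_def)
    then have "integral {0..T} (\<lambda>x. (l * m x) * \<bar>u x\<bar> powr p) = l"
      by (simp add: mult.assoc)
    moreover have "energy p T q u v < f0 * l"
      using True assms(12) by (simp add: lam_plus field_simps)
    ultimately show thesis using that[OF plus(1)] by simp
  next
    case False
    then have lt: "l < lambda0_minus p T q m / f0" using l by auto
    have "integral {0..T} (\<lambda>x. - m x * \<bar>u2 x\<bar> powr p) = 1"
      using minus(1,2) LINT_weight[OF p mm(1), of u2] by (simp add: W1p_periodic_def)
    then have "integral {0..T} (\<lambda>x. (l * m x) * \<bar>u2 x\<bar> powr p) = - l"
      by (simp add: mult.assoc)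
    moreover have "energy p T q u2 v2 < f0 * - l"
      using lt assms(12) by (simp add: lam_minus field_simps)
    ultimately show thesis using that[OF minus(1)] by simp
  qed
  \<comment> \<open>The sign condition says nothing at 0 itself; continuity and the opposite signs
    on the two sides give the value.\<close>
  have f_0: "f 0 = 0"
  proof -
    have lim: "(f \<longlongrightarrow> f 0) (at 0)"
      using assms(9) by (simp add: continuous_on_def)
    have "(f \<longlongrightarrow> f 0) (at_right 0)" "(f \<longlongrightarrow> f 0) (at_left 0)"
      using lim by (auto intro: tendsto_mono[OF at_le])
    moreover have "\<forall>\<^sub>F s in at_right 0. 0 \<le> f s" "\<forall>\<^sub>F s in at_left 0. f s \<le> 0"
      using assms(10) by (auto simp: eventually_at_filter zero_less_mult_iff intro!: always_eventually)
    ultimately show ?thesis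
      using tendsto_lowerbound[of f "f 0" "at_right 0" 0] tendsto_upperbound[of f "f 0" "at_left 0" 0]
      by fastforce
  qed
  obtain u_pos where u_pos: "classical_solution p T q m f l u_pos" "\<forall>x\<in>{0..T}. u_pos x > 0"
    by (rule positive_solution[OF T p q m assms(9) f_0 assms(11,13) wz])
  have f_refl_0: "- f (- 0) = 0" using f_0 by simp
  \<comment> \<open>The competitor \<open>w\<close> serves again, since the reflected nonlinearity
    has the same limits at 0 and at infinity.\<close>
  obtain u_neg where u_neg: "classical_solution p T q m (\<lambda>s. - f (- s)) l u_neg" "\<forall>x\<in>{0..T}. u_neg x > 0"
    by (rule positive_solution[OF T p q m reflected_limits(1)[OF assms(9,11,13)] f_refl_0
          reflected_limits(2,3)[OF assms(9,11,13)] wz])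
  have "\<forall>x\<in>{0..T}. - u_neg x < 0" using u_neg(2) by simp
  then show "\<exists>u_pos u_neg.
      classical_solution p T q m f l u_pos \<and> (\<forall>x\<in>{0..T}. u_pos x > 0) \<and>
      classical_solution p T q m f l u_neg \<and> (\<forall>x\<in>{0..T}. u_neg x < 0)"
    using u_pos classical_solution_uminus[OF u_neg(1)] by blast
qed

end
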